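(* Let $H\rtimes G$ be a Lie 2-group and let $\pi:P^{(1)}\to Y^{(1)}$ be a trivial base principal $(H\rtimes G)$-bundle groupoid $P^{(1)}\rightrightarrows P$ over a Lie groupoid $Y^{(1)}\rightrightarrows Y$, with $P\simeq G\times Y$. Let $\mathrm{pr}_G:P=G\times Y\to G$ be the projection, $\mathbf s_G:=\mathrm{pr}_G\circ\mathbf s:P^{(1)}\to G$, $$\Xi(P^{(1)}):=B:=\mathrm{Ker}(\mathbf s_G)=\{\xi\in P^{(1)}:\ \mathbf s_G(\xi)=e_G\},$$ and let $\varphi:P^{(1)}\to G\times B$ be the diffeomorphism $\varphi(\xi)=(\mathbf s_G(\xi),\,(e,\mathbf s_G(\xi)^{-1})\cdot\xi)$. Then the submanifold $B$ of $P^{(1)}$ is an $(H\rtimes G)$-bundle gerbe over the groupoid $Y^{(1)}\rightrightarrows Y$ with: (i) projection $\Pi:=(\pi\circ\varphi^{-1})|_B:B\to Y^{(1)}$, where $B$ is identified with $\{e_G\}\times B\subset G\times B$; (ii) anchor $\rho:B\to G$, $\rho(b)=(\mathrm{pr}_G(\mathbf t(b)))^{-1}$; (iii) groupoid action of $H\rtimes G\rightrightarrows G$ given by $(h,\rho(b))\star b=(C_{\rho(b)^{-1}}h^{-1},e)\cdot b$, where $b$ is viewed as an element of $P^{(1)}$; (iv) bundle gerbe product $\circ_\mu:B\,{}_{\mathbf s\Pi}\!\times_{\mathbf t\Pi}B\to B$, $(b_2,b_1)\mapsto((e,\rho(b_1)^{-1})\cdot b_2)\circ_{P^{(1)}}b_1$,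 where $b_2$ is viewed as an element of $P^{(1)}$ and $\circ_{P^{(1)}}$ is the composition of $P^{(1)}$.
   Context: A crossed module of Lie groups $(H,G,C,d)$ consists of Lie groups $H,G$, a smooth action $C:g\mapsto C_g$ of $G$ on $H$ by automorphisms and a Lie group homomorphism $d:H\to G$ with $d(C_gh)=g\,d(h)\,g^{-1}$ and $C_{d(h)}h'=hh'h^{-1}$. The associated Lie 2-group $H\rtimes G\rightrightarrows G$ has arrows $H\times G$, $\mathbf s(h,g)=g$, $\mathbf t(h,g)=d(h)g$, composition $(h_2,d(h_1)g_1)\circ(h_1,g_1)=(h_2h_1,g_1)$ and group product $(h_2,g_2)\cdot(h_1,g_1)=(h_2\,C_{g_2}h_1,\,g_2g_1)$. Every Lie 2-group is, up to isomorphism, of this form. A Lie 2-group action of $H\rtimes G\rightrightarrows G$ on a Lie groupoid $P^{(1)}\rightrightarrows P$ consists of (left) Lie group actions of $H\rtimes G$ on $P^{(1)}$ and of $G$ on $P$ (denoted by a dot) such that the action maps form a Lie groupoid morphism from the product groupoid $(H\rtimes G)\times P^{(1)}\rightrightarrows G\times P$ to $P^{(1)}\rightrightarrows P$. A principal $(H\rtimes G)$-bundle groupoid over $Y^{(1)}\rightrightarrows Y$ is a free and proper Lie 2-group action whose quotient groupoid is isomorphic to $Y^{(1)}\rightrightarrows Y$. It has trivial base if the object-level principal bundle is trivial, i.e. $P=G\times Y\to Y$. A (left) action of a Lie groupoid $\Gamma\rightrightarrows\Gamma_0$ on a manifold $B$ is given by a surjective submersion $\rho:B\to\Gamma_0$,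 called the anchor, and a smooth map $\star:\Gamma\,{}_{\mathbf s}\!\times_\rho B\to B$ with $\rho(\gamma\star b)=\mathbf t(\gamma)$ and $\gamma_2\star(\gamma_1\star b)=(\gamma_2\circ\gamma_1)\star b$. A principal $\Gamma$-bundle over a manifold $N$ consists of such an action together with a surjective submersion $\Pi:B\to N$ such that the quotient $B/\Gamma$ of $B$ by the action is a manifold, $\Pi$ is $\star$-invariant, and the induced map $B/\Gamma\to N$ is a diffeomorphism. An $(H\rtimes G)$-bundle gerbe over a Lie groupoid $Y^{(1)}\rightrightarrows Y$ consists of a Lie groupoid $B\rightrightarrows Y$ with composition $\circ_\mu$, a groupoid morphism $\Pi:B\to Y^{(1)}$ over $\mathrm{id}_Y$, and a groupoid action $\star$ of $H\rtimes G\rightrightarrows G$ on $B$ with anchor $\rho:B\to G$, such that (1) $\Pi:B\to Y^{(1)}$ is a principal $(H\rtimes G\rightrightarrows G)$-bundle, and (2) $\circ_\mu$ is $(H\rtimes G)$-equivariant, i.e. $((h_2,g_2)\star b_2)\circ_\mu((h_1,g_1)\star b_1)=((h_2,g_2)\cdot(h_1,g_1))\star(b_2\circ_\mu b_1)$ for all composable $b_2,b_1\in B$ and all $(h_2,g_2),(h_1,g_1)\in H\rtimes G$ for which these expressions are defined ($g_i=\rho(b_i)$).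
   Formalization: The anchor ρ is only required to be smooth, not a surjective submersion. With that requirement the claim is false: for H trivial, G nontrivial, Y a point and P^(1)=P=G with identity arrows under left translation, B={e} and ρ is not onto G. *)

theory Defs
  imports "HOL-Analysis.Analysis" "HOL-Algebra.Group"
begin

section \<open>Smooth maps between subsets of Euclidean spaces\<close>

text \<open>The class \<open>C\<^sup>k\<close> on an open set, by recursion on iterated directional derivatives.\<close>

primrec Ck_on :: "nat \<Rightarrow> 'a::real_normed_vector set \<Rightarrow> ('a \<Rightarrow> 'b::real_normed_vector) \<Rightarrow> bool" where
  "Ck_on 0 U f \<longleftrightarrow> continuous_on U f"
| "Ck_on (Suc k) U f \<longleftrightarrow> (\<forall>x\<in>U. f differentiable (at x)) \<and>
     (\<forall>v. Ck_on k U (\<lambda>x. frechet_derivative f (at x) v))"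

text \<open>On an arbitrary subset: locally the restriction of a \<open>C\<^sup>\<infinity>\<close> map on an open set.
  On a relatively open subset of a linear subspace this is ordinary smoothness.\<close>

definition smooth_on :: "'a::euclidean_space set \<Rightarrow> ('a \<Rightarrow> 'b::euclidean_space) \<Rightarrow> bool" where
  "smooth_on S f \<longleftrightarrow> (\<forall>x\<in>S. \<exists>U g. open U \<and> x \<in> U \<and> (\<forall>k. Ck_on k U g) \<and> (\<forall>y\<in>S \<inter> U. g y = f y))"


section \<open>Manifolds\<close>

text \<open>A manifold of dimension \<open>n\<close> is modelled on \<open>n\<close>-dimensional linear subspaces of a Euclidean
  space \<open>'e\<close> of possibly larger dimension. This allows dimension 0 (e.g. discrete groups), and
  a submanifold of \<open>M\<close> can use the same type \<open>'e\<close> as \<open>M\<close>. A chart is a pair of a domain and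
  a map; the values of the map outside the domain are irrelevant.\<close>

record ('a, 'e) manifold =
  mtop :: "'a topology"
  mdim :: nat
  charts :: "('a set \<times> ('a \<Rightarrow> 'e)) set"

abbreviation points :: "('a, 'e) manifold \<Rightarrow> 'a set" where
  "points M \<equiv> topspace (mtop M)"

definition is_chart :: "'a topology \<Rightarrow> nat \<Rightarrow> 'a set \<times> ('a \<Rightarrow> 'e::euclidean_space) \<Rightarrow> bool" where
  "is_chart X n = (\<lambda>(U, \<phi>). openin X U \<and>
     (\<exists>W. subspace W \<and> dim W = n \<and> openin (top_of_set W) (\<phi> ` U)) \<and>
     homeomorphic_map (subtopology X U) (top_of_set (\<phi> ` U)) \<phi>)"

definition compatible ::
  "'a set \<times> ('a \<Rightarrow> 'e::euclidean_space) \<Rightarrow> 'a set \<times> ('a \<Rightarrow> 'e) \<Rightarrow> bool" where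
  "compatible = (\<lambda>(U, \<phi>) (V, \<psi>).
     smooth_on (\<phi> ` (U \<inter> V)) (\<psi> \<circ> inv_into U \<phi>) \<and>
     smooth_on (\<psi> ` (U \<inter> V)) (\<phi> \<circ> inv_into V \<psi>))"

definition smooth_manifold :: "('a, 'e::euclidean_space) manifold \<Rightarrow> bool" where
  "smooth_manifold M \<longleftrightarrow>
     Hausdorff_space (mtop M) \<and> second_countable (mtop M) \<and>
     (\<forall>c\<in>charts M. is_chart (mtop M) (mdim M) c) \<and>
     \<Union> (fst ` charts M) = points M \<and>
     (\<forall>c\<in>charts M. \<forall>c'\<in>charts M. compatible c c')"

definition maximal_atlas ::
  "('a, 'e::euclidean_space) manifold \<Rightarrow> ('a set \<times> ('a \<Rightarrow> 'e)) set" where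
  "maximal_atlas M = {c. is_chart (mtop M) (mdim M) c \<and> (\<forall>c'\<in>charts M. compatible c c')}"

definition smooth_map ::
  "('a, 'e::euclidean_space) manifold \<Rightarrow> ('b, 'f::euclidean_space) manifold \<Rightarrow> ('a \<Rightarrow> 'b) \<Rightarrow> bool" where
  "smooth_map M N f \<longleftrightarrow> continuous_map (mtop M) (mtop N) f \<and>
     (\<forall>(U, \<phi>)\<in>charts M. \<forall>(V, \<psi>)\<in>charts N.
        smooth_on (\<phi> ` {x\<in>U. f x \<in> V}) (\<psi> \<circ> f \<circ> inv_into U \<phi>))"

definition diffeomorphism ::
  "('a, 'e::euclidean_space) manifold \<Rightarrow> ('b, 'f::euclidean_space) manifold \<Rightarrow> ('a \<Rightarrow> 'b) \<Rightarrow> bool" where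
  "diffeomorphism M N f \<longleftrightarrow> bij_betw f (points M) (points N) \<and>
     smooth_map M N f \<and> smooth_map N M (inv_into (points M) f)"

text \<open>For a chart \<open>(U, \<phi>)\<close> with nonempty domain, \<open>span (\<phi> ` U)\<close> is the linear subspace
  on which the chart is modelled, i.e. the tangent space in the chart. The derivative \<open>D\<close> below is
  unique on this subspace only.\<close>

definition submersion ::
  "('a, 'e::euclidean_space) manifold \<Rightarrow> ('b, 'f::euclidean_space) manifold \<Rightarrow> ('a \<Rightarrow> 'b) \<Rightarrow> bool" where
  "submersion M N f \<longleftrightarrow> smooth_map M N f \<and>
     (\<forall>(U, \<phi>)\<in>charts M. \<forall>(V, \<psi>)\<in>charts N. \<forall>x\<in>U. f x \<in> V \<longrightarrow>
        (\<exists>D. ((\<psi> \<circ> f \<circ> inv_into U \<phi>) has_derivative D) (at (\<phi> x) within \<phi> ` {y\<in>U. f y \<in> V}) \<and>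
             D ` span (\<phi> ` U) = span (\<psi> ` V)))"

definition surj_submersion ::
  "('a, 'e::euclidean_space) manifold \<Rightarrow> ('b, 'f::euclidean_space) manifold \<Rightarrow> ('a \<Rightarrow> 'b) \<Rightarrow> bool" where
  "surj_submersion M N f \<longleftrightarrow> submersion M N f \<and> f ` points M = points N"

definition prod_manifold ::
  "('a, 'e::euclidean_space) manifold \<Rightarrow> ('b, 'f::euclidean_space) manifold \<Rightarrow>
   ('a \<times> 'b, 'e \<times> 'f) manifold" where
  "prod_manifold M N =
     \<lparr>mtop = prod_topology (mtop M) (mtop N), mdim = mdim M + mdim N,
      charts = {(U \<times> V, map_prod \<phi> \<psi>) | U \<phi> V \<psi>. (U, \<phi>) \<in> charts M \<and> (V, \<psi>) \<in> charts N}\<rparr>"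

text \<open>The subset \<open>S\<close> of \<open>M\<close> with the subspace topology and its \<open>k\<close>-dimensional slice charts.
  It is an embedded submanifold iff these charts cover it.\<close>

definition submanifold ::
  "('a, 'e::euclidean_space) manifold \<Rightarrow> 'a set \<Rightarrow> nat \<Rightarrow> ('a, 'e) manifold" where
  "submanifold M S k =
     \<lparr>mtop = subtopology (mtop M) S, mdim = k,
      charts = {(U \<inter> S, \<phi>) | U \<phi>. (U, \<phi>) \<in> maximal_atlas M \<and>
        (\<exists>W. subspace W \<and> dim W = k \<and> W \<subseteq> span (\<phi> ` U) \<and> \<phi> ` (U \<inter> S) = \<phi> ` U \<inter> W)}\<rparr>"

definition embedded_submanifold ::
  "('a, 'e::euclidean_space) manifold \<Rightarrow> 'a set \<Rightarrow> nat \<Rightarrow> bool" where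
  "embedded_submanifold M S k \<longleftrightarrow>
     S \<subseteq> points M \<and> \<Union> (fst ` charts (submanifold M S k)) = S"

text \<open>The fibre product of \<open>f : M \<rightarrow> Z\<close> and \<open>g : N \<rightarrow> Z\<close>. It is used only when \<open>f\<close> or \<open>g\<close>
  is a submersion, so that it is an embedded submanifold of the product of the stated dimension.\<close>

definition fibre_product ::
  "('a, 'e::euclidean_space) manifold \<Rightarrow> ('a \<Rightarrow> 'c) \<Rightarrow> ('b, 'f::euclidean_space) manifold \<Rightarrow> ('b \<Rightarrow> 'c) \<Rightarrow>
   ('c, 'z::euclidean_space) manifold \<Rightarrow> ('a \<times> 'b, 'e \<times> 'f) manifold" where
  "fibre_product M f N g Z =
     submanifold (prod_manifold M N) {(x, y). x \<in> points M \<and> y \<in> points N \<and> f x = g y}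
       (mdim M + mdim N - mdim Z)"


section \<open>Lie groups and their actions\<close>

record ('a, 'e) lie_grp = "'a monoid" +
  man :: "('a, 'e) manifold"

definition lie_group :: "('g, 'e::euclidean_space) lie_grp \<Rightarrow> bool" where
  "lie_group G \<longleftrightarrow> group G \<and> smooth_manifold (man G) \<and> points (man G) = carrier G \<and>
     smooth_map (prod_manifold (man G) (man G)) (man G) (\<lambda>(x, y). x \<otimes>\<^bsub>G\<^esub> y) \<and>
     smooth_map (man G) (man G) (\<lambda>x. inv\<^bsub>G\<^esub> x)"

definition lie_group_action ::
  "('g, 'e::euclidean_space) lie_grp \<Rightarrow> ('a, 'f::euclidean_space) manifold \<Rightarrow> ('g \<Rightarrow> 'a \<Rightarrow> 'a) \<Rightarrow> bool" where
  "lie_group_action G M act \<longleftrightarrow> lie_group G \<and> smooth_manifold M \<and>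
     smooth_map (prod_manifold (man G) M) M (\<lambda>(g, x). act g x) \<and>
     (\<forall>x\<in>points M. act \<one>\<^bsub>G\<^esub> x = x) \<and>
     (\<forall>g\<in>carrier G. \<forall>g'\<in>carrier G. \<forall>x\<in>points M. act (g \<otimes>\<^bsub>G\<^esub> g') x = act g (act g' x))"

definition free_action ::
  "('g, 'e) lie_grp \<Rightarrow> ('a, 'f) manifold \<Rightarrow> ('g \<Rightarrow> 'a \<Rightarrow> 'a) \<Rightarrow> bool" where
  "free_action G M act \<longleftrightarrow> (\<forall>g\<in>carrier G. \<forall>x\<in>points M. act g x = x \<longrightarrow> g = \<one>\<^bsub>G\<^esub>)"

definition proper_action ::
  "('g, 'e) lie_grp \<Rightarrow> ('a, 'f) manifold \<Rightarrow> ('g \<Rightarrow> 'a \<Rightarrow> 'a) \<Rightarrow> bool" where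
  "proper_action G M act \<longleftrightarrow>
     proper_map (prod_topology (mtop (man G)) (mtop M)) (prod_topology (mtop M) (mtop M))
       (\<lambda>(g, x). (act g x, x))"

definition group_orbit :: "('g, 'e) lie_grp \<Rightarrow> ('g \<Rightarrow> 'a \<Rightarrow> 'a) \<Rightarrow> 'a \<Rightarrow> 'a set" where
  "group_orbit G act x = (\<lambda>g. act g x) ` carrier G"

text \<open>\<open>Q\<close> is the quotient manifold of \<open>M\<close>, where \<open>q\<close> maps a point to its orbit: its points are
  the orbits, and its smooth structure is the (unique) one for which \<open>q\<close> is a submersion.\<close>

definition quotient_manifold ::
  "('a, 'e::euclidean_space) manifold \<Rightarrow> ('a \<Rightarrow> 'a set) \<Rightarrow> ('a set, 'f::euclidean_space) manifold \<Rightarrow> bool" where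
  "quotient_manifold M q Q \<longleftrightarrow> smooth_manifold Q \<and> surj_submersion M Q q"


section \<open>Lie groupoids\<close>

text \<open>\<open>cmp a\<^sub>2 a\<^sub>1\<close> is the composition of \<open>a\<^sub>2\<close> after \<open>a\<^sub>1\<close>, defined for \<open>src a\<^sub>2 = tgt a\<^sub>1\<close>.\<close>

record ('o, 'eo, 'a, 'ea) groupoid =
  obj :: "('o, 'eo) manifold"
  arr :: "('a, 'ea) manifold"
  src :: "'a \<Rightarrow> 'o"
  tgt :: "'a \<Rightarrow> 'o"
  cmp :: "'a \<Rightarrow> 'a \<Rightarrow> 'a"
  unit_arr :: "'o \<Rightarrow> 'a"
  inv_arr :: "'a \<Rightarrow> 'a"

definition composable_arrows ::
  "('o, 'eo::euclidean_space, 'a, 'ea::euclidean_space) groupoid \<Rightarrow> ('a \<times> 'a, 'ea \<times> 'ea) manifold" where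
  "composable_arrows \<Gamma> = fibre_product (arr \<Gamma>) (src \<Gamma>) (arr \<Gamma>) (tgt \<Gamma>) (obj \<Gamma>)"

definition lie_groupoid ::
  "('o, 'eo::euclidean_space, 'a, 'ea::euclidean_space) groupoid \<Rightarrow> bool" where
  "lie_groupoid \<Gamma> \<longleftrightarrow>
     smooth_manifold (obj \<Gamma>) \<and> smooth_manifold (arr \<Gamma>) \<and>
     surj_submersion (arr \<Gamma>) (obj \<Gamma>) (src \<Gamma>) \<and>
     surj_submersion (arr \<Gamma>) (obj \<Gamma>) (tgt \<Gamma>) \<and>
     smooth_map (composable_arrows \<Gamma>) (arr \<Gamma>) (\<lambda>(a, b). cmp \<Gamma> a b) \<and>
     smooth_map (obj \<Gamma>) (arr \<Gamma>) (unit_arr \<Gamma>) \<and>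
     smooth_map (arr \<Gamma>) (arr \<Gamma>) (inv_arr \<Gamma>) \<and>
     (\<forall>a\<in>points (arr \<Gamma>). \<forall>b\<in>points (arr \<Gamma>). src \<Gamma> a = tgt \<Gamma> b \<longrightarrow>
        src \<Gamma> (cmp \<Gamma> a b) = src \<Gamma> b \<and> tgt \<Gamma> (cmp \<Gamma> a b) = tgt \<Gamma> a) \<and>
     (\<forall>a\<in>points (arr \<Gamma>). \<forall>b\<in>points (arr \<Gamma>). \<forall>c\<in>points (arr \<Gamma>).
        src \<Gamma> a = tgt \<Gamma> b \<longrightarrow> src \<Gamma> b = tgt \<Gamma> c \<longrightarrow>
        cmp \<Gamma> (cmp \<Gamma> a b) c = cmp \<Gamma> a (cmp \<Gamma> b c)) \<and>
     (\<forall>x\<in>points (obj \<Gamma>). src \<Gamma> (unit_arr \<Gamma> x) = x \<and> tgt \<Gamma> (unit_arr \<Gamma> x) = x) \<and>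
     (\<forall>a\<in>points (arr \<Gamma>). cmp \<Gamma> a (unit_arr \<Gamma> (src \<Gamma> a)) = a \<and> cmp \<Gamma> (unit_arr \<Gamma> (tgt \<Gamma> a)) a = a) \<and>
     (\<forall>a\<in>points (arr \<Gamma>). src \<Gamma> (inv_arr \<Gamma> a) = tgt \<Gamma> a \<and> tgt \<Gamma> (inv_arr \<Gamma> a) = src \<Gamma> a \<and>
        cmp \<Gamma> (inv_arr \<Gamma> a) a = unit_arr \<Gamma> (src \<Gamma> a) \<and>
        cmp \<Gamma> a (inv_arr \<Gamma> a) = unit_arr \<Gamma> (tgt \<Gamma> a))"

definition lie_groupoid_morphism ::
  "('o, 'eo::euclidean_space, 'a, 'ea::euclidean_space) groupoid \<Rightarrow>
   ('p, 'ep::euclidean_space, 'b, 'eb::euclidean_space) groupoid \<Rightarrow> ('a \<Rightarrow> 'b) \<Rightarrow> ('o \<Rightarrow> 'p) \<Rightarrow> bool" where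
  "lie_groupoid_morphism \<Gamma> \<Delta> F f \<longleftrightarrow>
     smooth_map (arr \<Gamma>) (arr \<Delta>) F \<and> smooth_map (obj \<Gamma>) (obj \<Delta>) f \<and>
     (\<forall>a\<in>points (arr \<Gamma>). src \<Delta> (F a) = f (src \<Gamma> a) \<and> tgt \<Delta> (F a) = f (tgt \<Gamma> a)) \<and>
     (\<forall>x\<in>points (obj \<Gamma>). F (unit_arr \<Gamma> x) = unit_arr \<Delta> (f x)) \<and>
     (\<forall>a\<in>points (arr \<Gamma>). \<forall>b\<in>points (arr \<Gamma>). src \<Gamma> a = tgt \<Gamma> b \<longrightarrow>
        F (cmp \<Gamma> a b) = cmp \<Delta> (F a) (F b))"

definition lie_groupoid_iso ::
  "('o, 'eo::euclidean_space, 'a, 'ea::euclidean_space) groupoid \<Rightarrow>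
   ('p, 'ep::euclidean_space, 'b, 'eb::euclidean_space) groupoid \<Rightarrow> ('a \<Rightarrow> 'b) \<Rightarrow> ('o \<Rightarrow> 'p) \<Rightarrow> bool" where
  "lie_groupoid_iso \<Gamma> \<Delta> F f \<longleftrightarrow> lie_groupoid_morphism \<Gamma> \<Delta> F f \<and>
     diffeomorphism (arr \<Gamma>) (arr \<Delta>) F \<and> diffeomorphism (obj \<Gamma>) (obj \<Delta>) f"

definition prod_groupoid ::
  "('o, 'eo::euclidean_space, 'a, 'ea::euclidean_space) groupoid \<Rightarrow>
   ('p, 'ep::euclidean_space, 'b, 'eb::euclidean_space) groupoid \<Rightarrow>
   ('o \<times> 'p, 'eo \<times> 'ep, 'a \<times> 'b, 'ea \<times> 'eb) groupoid" where
  "prod_groupoid \<Gamma> \<Delta> =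
     \<lparr>obj = prod_manifold (obj \<Gamma>) (obj \<Delta>), arr = prod_manifold (arr \<Gamma>) (arr \<Delta>),
      src = map_prod (src \<Gamma>) (src \<Delta>), tgt = map_prod (tgt \<Gamma>) (tgt \<Delta>),
      cmp = (\<lambda>(a, b) (a', b'). (cmp \<Gamma> a a', cmp \<Delta> b b')),
      unit_arr = map_prod (unit_arr \<Gamma>) (unit_arr \<Delta>),
      inv_arr = map_prod (inv_arr \<Gamma>) (inv_arr \<Delta>)\<rparr>"


section \<open>Crossed modules and Lie 2-groups\<close>

definition crossed_module ::
  "('h, 'eh::euclidean_space) lie_grp \<Rightarrow> ('g, 'eg::euclidean_space) lie_grp \<Rightarrow>
   ('g \<Rightarrow> 'h \<Rightarrow> 'h) \<Rightarrow> ('h \<Rightarrow> 'g) \<Rightarrow> bool" where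
  "crossed_module H G C d \<longleftrightarrow>
     lie_group H \<and> lie_group G \<and>
     lie_group_action G (man H) C \<and> (\<forall>g\<in>carrier G. C g \<in> iso H H) \<and>
     d \<in> hom H G \<and> smooth_map (man H) (man G) d \<and>
     (\<forall>g\<in>carrier G. \<forall>h\<in>carrier H. d (C g h) = g \<otimes>\<^bsub>G\<^esub> d h \<otimes>\<^bsub>G\<^esub> inv\<^bsub>G\<^esub> g) \<and>
     (\<forall>h\<in>carrier H. \<forall>h'\<in>carrier H. C (d h) h' = h \<otimes>\<^bsub>H\<^esub> h' \<otimes>\<^bsub>H\<^esub> inv\<^bsub>H\<^esub> h)"

text \<open>The Lie group of arrows, and the Lie groupoid, of the Lie 2-group of a crossed module.\<close>

definition semidirect ::
  "('h, 'eh::euclidean_space) lie_grp \<Rightarrow> ('g, 'eg::euclidean_space) lie_grp \<Rightarrow> ('g \<Rightarrow> 'h \<Rightarrow> 'h) \<Rightarrow>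
   ('h \<times> 'g, 'eh \<times> 'eg) lie_grp" where
  "semidirect H G C =
     \<lparr>carrier = carrier H \<times> carrier G,
      mult = (\<lambda>(h\<^sub>2, g\<^sub>2) (h\<^sub>1, g\<^sub>1). (h\<^sub>2 \<otimes>\<^bsub>H\<^esub> C g\<^sub>2 h\<^sub>1, g\<^sub>2 \<otimes>\<^bsub>G\<^esub> g\<^sub>1)),
      one = (\<one>\<^bsub>H\<^esub>, \<one>\<^bsub>G\<^esub>),
      man = prod_manifold (man H) (man G)\<rparr>"

definition two_group ::
  "('h, 'eh::euclidean_space) lie_grp \<Rightarrow> ('g, 'eg::euclidean_space) lie_grp \<Rightarrow> ('h \<Rightarrow> 'g) \<Rightarrow>
   ('g, 'eg, 'h \<times> 'g, 'eh \<times> 'eg) groupoid" where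
  "two_group H G d =
     \<lparr>obj = man G, arr = prod_manifold (man H) (man G),
      src = (\<lambda>(h, g). g), tgt = (\<lambda>(h, g). d h \<otimes>\<^bsub>G\<^esub> g),
      cmp = (\<lambda>(h\<^sub>2, g\<^sub>2) (h\<^sub>1, g\<^sub>1). (h\<^sub>2 \<otimes>\<^bsub>H\<^esub> h\<^sub>1, g\<^sub>1)),
      unit_arr = (\<lambda>g. (\<one>\<^bsub>H\<^esub>, g)),
      inv_arr = (\<lambda>(h, g). (inv\<^bsub>H\<^esub> h, d h \<otimes>\<^bsub>G\<^esub> g))\<rparr>"


section \<open>Principal bundle groupoids\<close>

definition lie_2group_action ::
  "('h, 'eh::euclidean_space) lie_grp \<Rightarrow> ('g, 'eg::euclidean_space) lie_grp \<Rightarrow>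
   ('g \<Rightarrow> 'h \<Rightarrow> 'h) \<Rightarrow> ('h \<Rightarrow> 'g) \<Rightarrow>
   ('p, 'ep::euclidean_space, 'a, 'ea::euclidean_space) groupoid \<Rightarrow>
   ('h \<times> 'g \<Rightarrow> 'a \<Rightarrow> 'a) \<Rightarrow> ('g \<Rightarrow> 'p \<Rightarrow> 'p) \<Rightarrow> bool" where
  "lie_2group_action H G C d P act1 act0 \<longleftrightarrow>
     crossed_module H G C d \<and> lie_groupoid P \<and>
     lie_group_action (semidirect H G C) (arr P) act1 \<and>
     lie_group_action G (obj P) act0 \<and>
     lie_groupoid_morphism (prod_groupoid (two_group H G d) P) P
       (\<lambda>(a, \<xi>). act1 a \<xi>) (\<lambda>(g, p). act0 g p)"

text \<open>\<open>Q\<close> is the quotient groupoid of \<open>P\<close>: arrows and objects are the orbits, and the structure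
  maps are induced from \<open>P\<close>.\<close>

definition quotient_groupoid ::
  "('h, 'eh::euclidean_space) lie_grp \<Rightarrow> ('g, 'eg::euclidean_space) lie_grp \<Rightarrow>
   ('g \<Rightarrow> 'h \<Rightarrow> 'h) \<Rightarrow>
   ('p, 'ep::euclidean_space, 'a, 'ea::euclidean_space) groupoid \<Rightarrow>
   ('h \<times> 'g \<Rightarrow> 'a \<Rightarrow> 'a) \<Rightarrow> ('g \<Rightarrow> 'p \<Rightarrow> 'p) \<Rightarrow>
   ('p set, 'fp::euclidean_space, 'a set, 'fa::euclidean_space) groupoid \<Rightarrow> bool" where
  "quotient_groupoid H G C P act1 act0 Q \<longleftrightarrow>
     lie_groupoid Q \<and>
     quotient_manifold (arr P) (group_orbit (semidirect H G C) act1) (arr Q) \<and>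
     quotient_manifold (obj P) (group_orbit G act0) (obj Q) \<and>
     lie_groupoid_morphism P Q (group_orbit (semidirect H G C) act1) (group_orbit G act0)"

text \<open>The bundle projections \<open>\<pi>\<close> (arrows) and \<open>\<pi>\<^sub>0\<close> (objects) are the quotient maps followed by an
  isomorphism \<open>(F, f)\<close> from the quotient groupoid to \<open>Y\<close>. The quotient is modelled on the model
  types of \<open>Y\<close>, which is no restriction, as the two are diffeomorphic.\<close>

definition principal_bundle_groupoid ::
  "('h, 'eh::euclidean_space) lie_grp \<Rightarrow> ('g, 'eg::euclidean_space) lie_grp \<Rightarrow>
   ('g \<Rightarrow> 'h \<Rightarrow> 'h) \<Rightarrow> ('h \<Rightarrow> 'g) \<Rightarrow>
   ('p, 'ep::euclidean_space, 'a, 'ea::euclidean_space) groupoid \<Rightarrow>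
   ('h \<times> 'g \<Rightarrow> 'a \<Rightarrow> 'a) \<Rightarrow> ('g \<Rightarrow> 'p \<Rightarrow> 'p) \<Rightarrow>
   ('y, 'ey::euclidean_space, 'b, 'eb::euclidean_space) groupoid \<Rightarrow>
   ('a \<Rightarrow> 'b) \<Rightarrow> ('p \<Rightarrow> 'y) \<Rightarrow> bool" where
  "principal_bundle_groupoid H G C d P act1 act0 Y \<pi> \<pi>\<^sub>0 \<longleftrightarrow>
     lie_groupoid Y \<and>
     lie_2group_action H G C d P act1 act0 \<and>
     free_action (semidirect H G C) (arr P) act1 \<and> free_action G (obj P) act0 \<and>
     proper_action (semidirect H G C) (arr P) act1 \<and> proper_action G (obj P) act0 \<and>
     (\<exists>(Q :: ('p set, 'ey, 'a set, 'eb) groupoid) F f.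
        quotient_groupoid H G C P act1 act0 Q \<and> lie_groupoid_iso Q Y F f \<and>
        (\<forall>\<xi>\<in>points (arr P). \<pi> \<xi> = F (group_orbit (semidirect H G C) act1 \<xi>)) \<and>
        (\<forall>p\<in>points (obj P). \<pi>\<^sub>0 p = f (group_orbit G act0 p)))"

text \<open>An isomorphism \<open>\<tau>\<close> of the principal \<open>G\<close>-bundle \<open>\<pi>\<^sub>0 : P \<rightarrow> Y\<close> with \<open>G \<times> Y\<close>, on which
  \<open>G\<close> acts by left translations of the first factor.\<close>

definition trivialization ::
  "('g, 'eg::euclidean_space) lie_grp \<Rightarrow> ('p, 'ep::euclidean_space) manifold \<Rightarrow> ('g \<Rightarrow> 'p \<Rightarrow> 'p) \<Rightarrow>
   ('y, 'ey::euclidean_space) manifold \<Rightarrow> ('p \<Rightarrow> 'y) \<Rightarrow> ('p \<Rightarrow> 'g \<times> 'y) \<Rightarrow> bool" where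
  "trivialization G P act Y \<pi>\<^sub>0 \<tau> \<longleftrightarrow>
     diffeomorphism P (prod_manifold (man G) Y) \<tau> \<and>
     (\<forall>p\<in>points P. snd (\<tau> p) = \<pi>\<^sub>0 p) \<and>
     (\<forall>g\<in>carrier G. \<forall>p\<in>points P. \<tau> (act g p) = (g \<otimes>\<^bsub>G\<^esub> fst (\<tau> p), snd (\<tau> p)))"


section \<open>Groupoid actions and bundle gerbes\<close>

text \<open>The anchor \<open>\<rho>\<close> is only required to be smooth, not to be a surjective submersion: the domain
  of \<open>\<star>\<close> is an embedded submanifold in any case, since the source map of \<open>\<Gamma>\<close> is a
  submersion. The stronger condition fails for gerbes built from trivial base bundle groupoids: if
  \<open>H\<close> is trivial, \<open>G\<close> is not, and \<open>P\<close> is the groupoid with objects \<open>G\<close> and only identity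
  arrows, over a point, then \<open>B = {e}\<close> and the anchor is not onto \<open>G\<close>.\<close>

definition groupoid_action ::
  "('o, 'eo::euclidean_space, 'c, 'ec::euclidean_space) groupoid \<Rightarrow>
   ('b, 'eb::euclidean_space) manifold \<Rightarrow> ('b \<Rightarrow> 'o) \<Rightarrow> ('c \<Rightarrow> 'b \<Rightarrow> 'b) \<Rightarrow> bool" where
  "groupoid_action \<Gamma> B \<rho> star \<longleftrightarrow>
     lie_groupoid \<Gamma> \<and> smooth_manifold B \<and> smooth_map B (obj \<Gamma>) \<rho> \<and>
     smooth_map (fibre_product (arr \<Gamma>) (src \<Gamma>) B \<rho> (obj \<Gamma>)) B (\<lambda>(\<gamma>, b). star \<gamma> b) \<and>
     (\<forall>\<gamma>\<in>points (arr \<Gamma>). \<forall>b\<in>points B. src \<Gamma> \<gamma> = \<rho> b \<longrightarrow> \<rho> (star \<gamma> b) = tgt \<Gamma> \<gamma>) \<and>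
     (\<forall>b\<in>points B. star (unit_arr \<Gamma> (\<rho> b)) b = b) \<and>
     (\<forall>\<gamma>\<^sub>2\<in>points (arr \<Gamma>). \<forall>\<gamma>\<^sub>1\<in>points (arr \<Gamma>). \<forall>b\<in>points B.
        src \<Gamma> \<gamma>\<^sub>2 = tgt \<Gamma> \<gamma>\<^sub>1 \<longrightarrow> src \<Gamma> \<gamma>\<^sub>1 = \<rho> b \<longrightarrow> star \<gamma>\<^sub>2 (star \<gamma>\<^sub>1 b) = star (cmp \<Gamma> \<gamma>\<^sub>2 \<gamma>\<^sub>1) b)"

definition groupoid_orbit ::
  "('o, 'eo, 'c, 'ec) groupoid \<Rightarrow> ('b \<Rightarrow> 'o) \<Rightarrow> ('c \<Rightarrow> 'b \<Rightarrow> 'b) \<Rightarrow> 'b \<Rightarrow> 'b set" where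
  "groupoid_orbit \<Gamma> \<rho> star b = {star \<gamma> b | \<gamma>. \<gamma> \<in> points (arr \<Gamma>) \<and> src \<Gamma> \<gamma> = \<rho> b}"

definition principal_groupoid_bundle ::
  "('o, 'eo::euclidean_space, 'c, 'ec::euclidean_space) groupoid \<Rightarrow>
   ('b, 'eb::euclidean_space) manifold \<Rightarrow> ('b \<Rightarrow> 'o) \<Rightarrow> ('c \<Rightarrow> 'b \<Rightarrow> 'b) \<Rightarrow>
   ('n, 'en::euclidean_space) manifold \<Rightarrow> ('b \<Rightarrow> 'n) \<Rightarrow> bool" where
  "principal_groupoid_bundle \<Gamma> B \<rho> star N Pr \<longleftrightarrow>
     groupoid_action \<Gamma> B \<rho> star \<and> smooth_manifold N \<and> surj_submersion B N Pr \<and>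
     (\<forall>\<gamma>\<in>points (arr \<Gamma>). \<forall>b\<in>points B. src \<Gamma> \<gamma> = \<rho> b \<longrightarrow> Pr (star \<gamma> b) = Pr b) \<and>
     (\<exists>(Q :: ('b set, 'en) manifold) F.
        quotient_manifold B (groupoid_orbit \<Gamma> \<rho> star) Q \<and> diffeomorphism Q N F \<and>
        (\<forall>b\<in>points B. F (groupoid_orbit \<Gamma> \<rho> star b) = Pr b))"

text \<open>The multiplicativity of \<open>\<rho>\<close> says that the right-hand side of the equivariance
  identity is defined; the left-hand side is defined because \<open>Pr\<close> is invariant and a groupoid
  morphism over the identity.\<close>

definition bundle_gerbe ::
  "('h, 'eh::euclidean_space) lie_grp \<Rightarrow> ('g, 'eg::euclidean_space) lie_grp \<Rightarrow>
   ('g \<Rightarrow> 'h \<Rightarrow> 'h) \<Rightarrow> ('h \<Rightarrow> 'g) \<Rightarrow>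
   ('y, 'ey::euclidean_space, 'c, 'ec::euclidean_space) groupoid \<Rightarrow>
   ('y, 'ey, 'b, 'eb::euclidean_space) groupoid \<Rightarrow>
   ('b \<Rightarrow> 'c) \<Rightarrow> ('b \<Rightarrow> 'g) \<Rightarrow> ('h \<times> 'g \<Rightarrow> 'b \<Rightarrow> 'b) \<Rightarrow> bool" where
  "bundle_gerbe H G C d Y B Pr \<rho> star \<longleftrightarrow>
     crossed_module H G C d \<and> lie_groupoid Y \<and> lie_groupoid B \<and> obj B = obj Y \<and>
     lie_groupoid_morphism B Y Pr id \<and>
     principal_groupoid_bundle (two_group H G d) (arr B) \<rho> star (arr Y) Pr \<and>
     (\<forall>b\<^sub>2\<in>points (arr B). \<forall>b\<^sub>1\<in>points (arr B). src B b\<^sub>2 = tgt B b\<^sub>1 \<longrightarrow>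
        \<rho> (cmp B b\<^sub>2 b\<^sub>1) = \<rho> b\<^sub>2 \<otimes>\<^bsub>G\<^esub> \<rho> b\<^sub>1 \<and>
        (\<forall>h\<^sub>2\<in>carrier H. \<forall>h\<^sub>1\<in>carrier H.
           cmp B (star (h\<^sub>2, \<rho> b\<^sub>2) b\<^sub>2) (star (h\<^sub>1, \<rho> b\<^sub>1) b\<^sub>1) =
           star ((h\<^sub>2, \<rho> b\<^sub>2) \<otimes>\<^bsub>semidirect H G C\<^esub> (h\<^sub>1, \<rho> b\<^sub>1)) (cmp B b\<^sub>2 b\<^sub>1)))"

end

theory Submission
  imports Defs
begin

text \<open>The map \<open>\<xi> \<mapsto> (e, s\<^sub>G(\<xi>)\<^sup>-\<^sup>1) \<cdot> \<xi>\<close> retracts \<open>P\<^sup>(\<^sup>1\<^sup>)\<close> onto the fibre \<open>B\<close> of the submersion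
  \<open>s\<^sub>G\<close>. Composed with this retraction, \<open>\<Pi>\<close> becomes \<open>\<pi>\<close>, so \<open>\<Pi>\<close> is a submersion; its fibres are the
  orbits of \<open>\<star>\<close>, because an element of \<open>H \<rtimes> G\<close> relating two points of \<open>B\<close> has trivial \<open>G\<close>-component.
  The groupoid axioms and the equivariance of the product come from the interchange law for the action
  on \<open>P\<^sup>(\<^sup>1\<^sup>)\<close> and the Peiffer identity \<open>C\<^sub>d\<^sub>(\<^sub>h\<^sub>) h' = h h' h\<^sup>-\<^sup>1\<close>.

  Submersions are handled through smooth local sections: by the inverse function theorem a smooth map is
  a submersion iff it has such a section through every point, and in this form composition and
  cancellation of submersions need no derivatives. A submersion is linear in suitable charts, which gives
  slice charts for its level sets and for the fibre products that carry the groupoid compositions.\<close>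

section \<open>Calculus of smooth maps\<close>

text \<open>Both inversions in the formulas are forced. The product translates
  \<open>b\<^sub>2\<close> by the \<open>G\<close>-component \<open>g\<^sub>1\<close> of the target
  of \<open>b\<^sub>1\<close>, so its own target has \<open>G\<close>-component
  \<open>g\<^sub>1 g\<^sub>2\<close>, in reversed order; passing to inverses makes
  \<open>\<rho>\<close> multiplicative. An element \<open>(k, e)\<close> multiplies the
  \<open>G\<close>-component of a target by \<open>d k\<close> on the left, hence
  \<open>\<rho>(b)\<close> by the inverse of \<open>d k\<close> on the right. The analytic obstacle
  is that charts take values in linear subspaces of a larger Euclidean space. A derivative is
  determined only along such a subspace, so inverse functions are formed in the ambient space and
  must preserve the subspace. Moreover the inverse function theorem speaks of a single derivative;
  higher regularity is recovered from its formula for the derivative of the inverse.\<close>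

lemma Ck_on_subset: "Ck_on k U f \<Longrightarrow> V \<subseteq> U \<Longrightarrow> Ck_on k V f"
proof (induction k arbitrary: f)
  case 0
  then show ?case by (auto intro: continuous_on_subset)
next
  case (Suc k)
  then show ?case by (auto simp: subset_iff)
qed

text \<open>Openness of \<open>U\<close> makes this work: a derivative at a point sees the function
  on a whole neighbourhood, and agreement on \<open>U\<close> provides one around each of its
  points.\<close>

lemma Ck_on_cong:
  assumes "open U" "\<And>x. x \<in> U \<Longrightarrow> f x = g x" "Ck_on k U f"
  shows "Ck_on k U g"
  using assms(2,3)
proof (induction k arbitrary: f g)
  case 0
  then show ?case by (auto cong: continuous_on_cong_simp)
next
  case (Suc k)
  have eq: "(f has_derivative D) (at x) \<longleftrightarrow> (g has_derivative D) (at x)" if "x \<in> U" for x D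
    using has_derivative_transform_within_open[OF _ \<open>open U\<close> that, of f D UNIV g]
      has_derivative_transform_within_open[OF _ \<open>open U\<close> that, of g D UNIV f] Suc.prems(1) by auto
  have fr: "frechet_derivative f (at x) = frechet_derivative g (at x)" if "x \<in> U" for x
    using eq[OF that] unfolding frechet_derivative_def by presburger
  have "g differentiable at x" if x: "x \<in> U" for x
  proof -
    have "f differentiable at x" using Suc.prems(2) x by simp
    then show ?thesis unfolding differentiable_def eq[OF x] .
  qed
  moreover have "Ck_on k U (\<lambda>x. frechet_derivative g (at x) v)" for v
    by (rule Suc.IH[of "\<lambda>x. frechet_derivative f (at x) v"]) (use fr Suc.prems(2) in auto)
  ultimately show ?case by auto
qed

lemma Ck_on_SucD: "Ck_on (Suc k) U f \<Longrightarrow> Ck_on k U f"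
proof (induction k arbitrary: f)
  case 0
  then show ?case
    by (auto intro!: continuous_at_imp_continuous_on differentiable_imp_continuous_within)
next
  case (Suc k)
  then show ?case by (metis Ck_on.simps(2))
qed

lemma Ck_on_imp_continuous_on: "Ck_on k U f \<Longrightarrow> continuous_on U f"
proof (induction k)
  case (Suc k)
  then show ?case by (metis Ck_on_SucD)
qed simp

text \<open>Frees the recursion from \<open>frechet_derivative\<close>: a derivative
  \<open>F\<close> found by the usual rules coincides with it by uniqueness. The closure properties
  below all go through this rule.\<close>

lemma Ck_on_SucI:
  assumes "open U" "\<And>x. x \<in> U \<Longrightarrow> (f has_derivative F x) (at x)" "\<And>v. Ck_on k U (\<lambda>x. F x v)"
  shows "Ck_on (Suc k) U f"
proof -
  have fr: "F x = frechet_derivative f (at x)" if "x \<in> U" for x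
    using assms(2) frechet_derivative_at that by blast
  have "Ck_on k U (\<lambda>x. frechet_derivative f (at x) v)" for v
    by (rule Ck_on_cong[OF \<open>open U\<close> _ assms(3)[of v]]) (simp add: fr)
  then show ?thesis
    using assms(2) by (auto simp: differentiable_def)
qed

lemma Ck_on_Suc_has_derivative:
  "Ck_on (Suc k) U f \<Longrightarrow> x \<in> U \<Longrightarrow> (f has_derivative frechet_derivative f (at x)) (at x)"
  using frechet_derivative_works by (simp only: Ck_on.simps) blast

section \<open>Closure properties of the classes \<open>C\<^sup>k\<close>\<close>

lemma Ck_on_const: "open U \<Longrightarrow> Ck_on k U (\<lambda>x. c)"
proof (induction k arbitrary: c)
  case (Suc k)
  show ?case
    by (rule Ck_on_SucI[where F = "\<lambda>_ _. 0"]) (use Suc in auto)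
qed auto

lemma Ck_on_bounded_linear:
  assumes "open U" "bounded_linear L"
  shows "Ck_on k U L"
proof (cases k)
  case 0
  then show ?thesis using assms by (simp add: linear_continuous_on)
next
  case (Suc j)
  show ?thesis unfolding Suc
    by (rule Ck_on_SucI[where F = "\<lambda>_. L"])
       (use assms in \<open>auto intro: bounded_linear_imp_has_derivative Ck_on_const\<close>)
qed

lemma Ck_on_linear_compose:
  assumes "open U" "bounded_linear L" "Ck_on k U f"
  shows "Ck_on k U (\<lambda>x. L (f x))"
  using assms(3)
proof (induction k arbitrary: f)
  case 0
  then show ?case using assms(2)
    by (auto intro: bounded_linear.continuous_on)
next
  case (Suc k)
  show ?case
    by (rule Ck_on_SucI[where F = "\<lambda>x v. L (frechet_derivative f (at x) v)"])
       (use Suc.prems in \<open>auto intro!: assms Suc.IH bounded_linear.has_derivative[OF assms(2)] Ck_on_Suc_has_derivative[OF Suc.prems]\<close>)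
qed

lemma Ck_on_add:
  assumes "open U" "Ck_on k U f" "Ck_on k U g"
  shows "Ck_on k U (\<lambda>x. f x + g x)"
  using assms(2,3)
proof (induction k arbitrary: f g)
  case 0
  then show ?case by (auto intro: continuous_on_add)
next
  case (Suc k)
  show ?case
    by (rule Ck_on_SucI[where F = "\<lambda>x v. frechet_derivative f (at x) v + frechet_derivative g (at x) v"])
       (use Suc.prems in \<open>auto intro!: assms Suc.IH has_derivative_add Ck_on_Suc_has_derivative[OF Suc.prems(1)]
          Ck_on_Suc_has_derivative[OF Suc.prems(2)]\<close>)
qed

lemma Ck_on_sum:
  assumes "open U" "\<And>i. i \<in> I \<Longrightarrow> Ck_on k U (f i)"
  shows "Ck_on k U (\<lambda>x. \<Sum>i\<in>I. f i x)"
  using assms(2)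
proof (induction I rule: infinite_finite_induct)
  case (insert i I)
  then have "Ck_on k U (f i)" "Ck_on k U (\<lambda>x. \<Sum>i\<in>I. f i x)"
    by simp_all
  from Ck_on_add[OF assms(1) this] show ?case
    using insert by simp
qed (simp_all add: Ck_on_const assms(1))

lemma Ck_on_bilinear:
  assumes "open U" "bounded_bilinear b" "Ck_on k U f" "Ck_on k U g"
  shows "Ck_on k U (\<lambda>x. b (f x) (g x))"
  using assms(3,4)
proof (induction k arbitrary: f g)
  case 0
  then show ?case using assms(2) by (auto intro: bounded_bilinear.continuous_on)
next
  case (Suc k)
  show ?case
    by (rule Ck_on_SucI[where F = "\<lambda>x v. b (f x) (frechet_derivative g (at x) v)
          + b (frechet_derivative f (at x) v) (g x)"])
       (use Suc.prems Ck_on_SucD[OF Suc.prems(1)] Ck_on_SucD[OF Suc.prems(2)] in \<open>auto intro!: assms(1) bounded_bilinear.FDERIV[OF assms(2)]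
          Ck_on_Suc_has_derivative[OF Suc.prems(1)] Ck_on_Suc_has_derivative[OF Suc.prems(2)] Ck_on_add[OF assms(1)] Suc.IH\<close>)
qed

lemma Ck_on_Pair:
  assumes "open U" "Ck_on k U f" "Ck_on k U g"
  shows "Ck_on k U (\<lambda>x. (f x, g x))"
proof -
  have "bounded_linear (\<lambda>x::'b. (x, 0::'c))" "bounded_linear (\<lambda>y::'c. (0::'b, y))"
    by (auto intro: bounded_linear_Pair)
  then have "Ck_on k U (\<lambda>x. (f x, 0) + (0, g x))"
    by (intro Ck_on_add assms Ck_on_linear_compose[of U "\<lambda>x. (x, 0)"] Ck_on_linear_compose[of U "\<lambda>y. (0, y)"]) 
  then show ?thesis by simp
qed

section \<open>Linear maps depending on a parameter\<close>

lemma linear_Basis_expand: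
  fixes A :: "'a::euclidean_space \<Rightarrow> 'b::real_vector"
  assumes "linear A"
  shows "A w = (\<Sum>i\<in>Basis. (w \<bullet> i) *\<^sub>R A i)"
proof -
  have "A w = A (\<Sum>i\<in>Basis. (w \<bullet> i) *\<^sub>R i)"
    by (simp add: euclidean_representation)
  also have "\<dots> = (\<Sum>i\<in>Basis. (w \<bullet> i) *\<^sub>R A i)"
    using assms by (simp add: linear_sum linear_scale)
  finally show ?thesis .
qed

text \<open>The sum over basis vectors stands in for the operator norm of the difference: it
  dominates that norm, and it tends to zero as soon as the finitely many values on basis vectors
  converge.\<close>

lemma linear_diff_norm_bound:
  fixes A B :: "'a::euclidean_space \<Rightarrow> 'b::real_normed_vector"
  assumes "linear A" "linear B"
  shows "norm (A w - B w) \<le> norm w * (\<Sum>i\<in>Basis. norm (A i - B i))"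
proof -
  have "A w - B w = (\<Sum>i\<in>Basis. (w \<bullet> i) *\<^sub>R (A i - B i))"
    using linear_Basis_expand[OF linear_compose_sub[OF assms]] .
  also have "norm \<dots> \<le> (\<Sum>i\<in>Basis. norm w * norm (A i - B i))"
    by (rule order_trans[OF norm_sum sum_mono]) (auto simp: Basis_le_norm intro!: mult_right_mono)
  finally show ?thesis by (simp add: sum_distrib_left)
qed

text \<open>Regularity for every fixed vector \<open>v\<close> gives regularity for a moving vector
  \<open>w x\<close>, because in finite dimension the value is a finite sum of products of the
  coordinates of \<open>w x\<close> with the values \<open>A x i\<close>.\<close>

lemma Ck_on_linear_family:
  fixes A :: "'a::real_normed_vector \<Rightarrow> 'b::euclidean_space \<Rightarrow> 'c::real_normed_vector"
  assumes "open U" "\<And>x. x \<in> U \<Longrightarrow> linear (A x)" "\<And>v. Ck_on k U (\<lambda>x. A x v)" "Ck_on k U w"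
  shows "Ck_on k U (\<lambda>x. A x (w x))"
proof (rule Ck_on_cong[OF assms(1)])
  show "Ck_on k U (\<lambda>x. \<Sum>i\<in>Basis. (w x \<bullet> i) *\<^sub>R A x i)"
    by (intro Ck_on_sum Ck_on_bilinear[OF _ bounded_bilinear_scaleR] assms
        Ck_on_linear_compose[OF _ bounded_linear_inner_left])
  show "(\<Sum>i\<in>Basis. (w x \<bullet> i) *\<^sub>R A x i) = A x (w x)" if "x \<in> U" for x
    using linear_Basis_expand[OF assms(2)[OF that]] by metis
qed

text \<open>By the chain rule a directional derivative of the composite is the linear map
  \<open>Dg (f x)\<close> applied to the moving vector \<open>Df x v\<close>. The induction runs
  over \<open>g\<close>: its directional derivatives take the place of \<open>g\<close>, while
  \<open>f\<close> is merely lowered to class \<open>k\<close>.\<close>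

lemma Ck_on_compose:
  fixes f :: "'a::real_normed_vector \<Rightarrow> 'b::euclidean_space" and g :: "'b \<Rightarrow> 'c::real_normed_vector"
  assumes "open U" "open V" "f ` U \<subseteq> V" "Ck_on k U f" "Ck_on k V g"
  shows "Ck_on k U (\<lambda>x. g (f x))"
  using assms(4,5)
proof (induction k arbitrary: g)
  case 0
  then show ?case using assms(3) by (auto intro: continuous_on_compose2)
next
  case (Suc k)
  have IH: "Ck_on k U (\<lambda>x. frechet_derivative g (at (f x)) v)" for v
    by (rule Suc.IH[OF Ck_on_SucD[OF Suc.prems(1)]]) (use Suc.prems(2) in simp)
  show ?case
  proof (rule Ck_on_SucI[where F = "\<lambda>x v. frechet_derivative g (at (f x)) (frechet_derivative f (at x) v)"])
    fix x assume x: "x \<in> U"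
    have "(g \<circ> f has_derivative frechet_derivative g (at (f x)) \<circ> frechet_derivative f (at x)) (at x)"
      by (rule diff_chain_at[OF Ck_on_Suc_has_derivative[OF Suc.prems(1) x]
            Ck_on_Suc_has_derivative[OF Suc.prems(2)]]) (use x assms(3) in auto)
    then show "((\<lambda>x. g (f x)) has_derivative
        (\<lambda>v. frechet_derivative g (at (f x)) (frechet_derivative f (at x) v))) (at x)"
      by (simp add: o_def)
  next
    fix v
    show "Ck_on k U (\<lambda>x. frechet_derivative g (at (f x)) (frechet_derivative f (at x) v))"
    proof (rule Ck_on_linear_family[OF assms(1) _ IH])
      show "linear (frechet_derivative g (at (f x)))" if "x \<in> U" for x
        using Suc.prems(2) assms(3) that by (auto intro!: linear_frechet_derivative)
      show "Ck_on k U (\<lambda>x. frechet_derivative f (at x) v)"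
        using Suc.prems(1) by simp
    qed
  qed (rule assms)
qed

section \<open>Inverses of families of linear maps\<close>

lemma tendsto_at_open: "open U \<Longrightarrow> x \<in> U \<Longrightarrow> continuous_on U f \<Longrightarrow> (f \<longlongrightarrow> f x) (at x)"
  by (metis at_within_open continuous_on_def)

lemma tendsto_linear_family_diff:
  fixes A :: "'a::real_normed_vector \<Rightarrow> 'b::euclidean_space \<Rightarrow> 'c::real_normed_vector"
  assumes "open U" "x \<in> U" "\<And>v. continuous_on U (\<lambda>x. A x v)"
  shows "((\<lambda>y. \<Sum>i\<in>Basis. norm (A y i - A x i)) \<longlongrightarrow> 0) (at x)"
proof (rule tendsto_null_sum)
  fix i
  have "((\<lambda>y. A y i - A x i) \<longlongrightarrow> A x i - A x i) (at x)"
    by (intro tendsto_diff tendsto_const tendsto_at_open[OF assms])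
  then show "((\<lambda>y. norm (A y i - A x i)) \<longlongrightarrow> 0) (at x)"
    by (simp add: tendsto_norm_zero)
qed

text \<open>If \<open>K\<close> bounds \<open>B x\<close>, then
  \<open>norm v \<le> K * norm (A x v)\<close>. For \<open>y\<close> so near to \<open>x\<close>
  that \<open>A y\<close> differs from \<open>A x\<close> by less than \<open>1 / (2 * K)\<close> in
  norm, the resulting error is at most half of \<open>norm v\<close> and is absorbed on the left.
  Hence \<open>2 * K\<close> bounds every \<open>B y\<close> near \<open>x\<close>.\<close>

lemma inverse_family_bound:
  fixes A :: "'a::real_normed_vector \<Rightarrow> 'b::euclidean_space \<Rightarrow> 'b"
  assumes "open U" "x \<in> U" and lin: "\<And>x. x \<in> U \<Longrightarrow> linear (A x)" "linear (B x)"
    and inv: "\<And>v. B x (A x v) = v" "\<And>x v. x \<in> U \<Longrightarrow> A x (B x v) = v"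
    and cont: "\<And>v. continuous_on U (\<lambda>x. A x v)"
  obtains M where "M > 0" "eventually (\<lambda>y. \<forall>u. norm (B y u) \<le> M * norm u) (at x)"
proof -
  obtain K where K: "K > 0" "\<And>u. norm (B x u) \<le> norm u * K"
    using bounded_linear.pos_bounded lin(2) linear_conv_bounded_linear by metis
  let ?\<delta> = "\<lambda>y. \<Sum>i\<in>Basis. norm (A y i - A x i)"
  have "(?\<delta> \<longlongrightarrow> 0) (at x)"
    by (rule tendsto_linear_family_diff[OF assms(1,2) cont])
  then have "eventually (\<lambda>y. ?\<delta> y < 1 / (2 * K)) (at x)"
    using K(1) by (intro order_tendstoD) auto
  moreover have "eventually (\<lambda>y. y \<in> U) (at x)"
    using assms(1,2) eventually_at_in_open' by blast
  ultimately have "eventually (\<lambda>y. \<forall>u. norm (B y u) \<le> (2 * K) * norm u) (at x)"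
  proof eventually_elim
    case (elim y)
    show ?case
    proof
      fix u
      let ?v = "B y u"
      have "norm ?v \<le> norm (A x ?v) * K"
        using K(2)[of "A x ?v"] inv(1) by simp
      moreover have "norm (A x ?v) \<le> norm u + norm (A y ?v - A x ?v)"
        using norm_triangle_ineq4[of u "A y ?v - A x ?v"] inv(2)[OF elim(2), of u] by simp
      moreover have "norm (A y ?v - A x ?v) \<le> norm ?v * ?\<delta> y"
        using linear_diff_norm_bound[OF lin(1)[OF elim(2)] lin(1)[OF assms(2)]] .
      moreover have "norm ?v * ?\<delta> y \<le> norm ?v * (1 / (2 * K))"
        using elim(1) by (intro mult_left_mono) auto
      ultimately have "norm ?v \<le> (norm u + norm ?v * (1 / (2 * K))) * K"
        using K(1) by (smt (verit, best) mult_right_mono)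
      also have "\<dots> = norm u * K + norm ?v / 2"
        using K(1) by (simp add: field_simps)
      finally show "norm ?v \<le> 2 * K * norm u" by (simp add: algebra_simps)
    qed
  qed
  then show thesis using K(1) that[of "2 * K"] by auto
qed

text \<open>Rests on the identity \<open>B y - B x = - B y (A y - A x) B x\<close>: the outer factor
  is bounded near \<open>x\<close> and the middle one tends to zero on the fixed vector
  \<open>B x v\<close>.\<close>

lemma continuous_on_inverse_family:
  fixes A :: "'a::real_normed_vector \<Rightarrow> 'b::euclidean_space \<Rightarrow> 'b"
  assumes "open U" and lin: "\<And>x. x \<in> U \<Longrightarrow> linear (A x)" "\<And>x. x \<in> U \<Longrightarrow> linear (B x)"
    and inv: "\<And>x v. x \<in> U \<Longrightarrow> B x (A x v) = v" "\<And>x v. x \<in> U \<Longrightarrow> A x (B x v) = v"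
    and cont: "\<And>v. continuous_on U (\<lambda>x. A x v)"
  shows "continuous_on U (\<lambda>x. B x v)"
  unfolding continuous_on_def
proof
  fix x assume x: "x \<in> U"
  obtain M where M: "M > 0" "eventually (\<lambda>y. \<forall>u. norm (B y u) \<le> M * norm u) (at x)"
    using inverse_family_bound[of U x A B] assms x by blast
  have "eventually (\<lambda>y. y \<in> U) (at x)"
    using assms(1) x eventually_at_in_open' by blast
  with M(2) have "eventually (\<lambda>y. norm (B y v - B x v) \<le> M * norm (A y (B x v) - A x (B x v))) (at x)"
  proof eventually_elim
    case (elim y)
    have "B y v - B x v = - B y (A y (B x v) - A x (B x v))"
      using inv elim(2) x lin(2)[OF elim(2)] by (simp add: linear_diff)
    then show ?case using elim(1) by (metis norm_minus_cancel)
  qed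
  moreover have "((\<lambda>y. M * norm (A y (B x v) - A x (B x v))) \<longlongrightarrow> 0) (at x)"
    using tendsto_mult_right_zero[OF tendsto_norm_zero[OF LIM_zero[OF tendsto_at_open[OF assms(1) x cont]]]] .
  ultimately have "((\<lambda>y. B y v - B x v) \<longlongrightarrow> 0) (at x)"
    by (rule Lim_null_comparison)
  then show "((\<lambda>y. B y v) \<longlongrightarrow> B x v) (at x within U)"
    unfolding at_within_open[OF x assms(1)] by (rule LIM_zero_cancel)
qed

text \<open>\<open>D(A\<^sup>-\<^sup>1 v) = - A\<^sup>-\<^sup>1 (DA) (A\<^sup>-\<^sup>1 v)\<close>, which makes the inverse as regular as \<open>A\<close>.\<close>

lemma has_derivative_inverse_family:
  fixes A :: "'a::real_normed_vector \<Rightarrow> 'b::euclidean_space \<Rightarrow> 'b"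
  assumes "open U" "x \<in> U" and lin: "\<And>x. x \<in> U \<Longrightarrow> linear (A x)" "\<And>x. x \<in> U \<Longrightarrow> linear (B x)"
    and inv: "\<And>x v. x \<in> U \<Longrightarrow> B x (A x v) = v" "\<And>x v. x \<in> U \<Longrightarrow> A x (B x v) = v"
    and cont: "\<And>v. continuous_on U (\<lambda>x. A x v)"
    and der: "((\<lambda>y. A y (B x v)) has_derivative A') (at x)"
  shows "((\<lambda>y. B y v) has_derivative (\<lambda>u. - B x (A' u))) (at x)"
proof -
  let ?w = "B x v"
  let ?\<delta> = "\<lambda>y. \<Sum>i\<in>Basis. norm (A y i - A x i)"
  obtain M where M: "M > 0" "eventually (\<lambda>y. \<forall>u. norm (B y u) \<le> M * norm u) (at x)"
    by (rule inverse_family_bound[of U x A B, OF assms(1,2) lin(1) lin(2)[OF assms(2)] inv(1)[OF assms(2)] inv(2) cont])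
  have blB: "bounded_linear (B x)"
    using lin(2)[OF assms(2)] linear_conv_bounded_linear by blast
  have blA': "bounded_linear A'"
    using der has_derivative_bounded_linear by blast
  have "\<exists>K>0. \<forall>u. norm (B x (A' u)) \<le> norm u * K"
    by (rule bounded_linear.pos_bounded[OF bounded_linear_compose[OF blB blA']])
  then obtain K where K: "K > 0" "\<And>u. norm (B x (A' u)) \<le> norm u * K"
    by auto
  have \<delta>: "(?\<delta> \<longlongrightarrow> 0) (at x)"
    by (rule tendsto_linear_family_diff[OF assms(1,2) cont])
  let ?r = "\<lambda>y. norm (A y ?w - A x ?w - A' (y - x)) / norm (y - x)"
  have r: "(?r \<longlongrightarrow> 0) (at x)"
    using der unfolding has_derivative_iff_norm by simp
  have "eventually (\<lambda>y. norm (norm (B y v - B x v - - B x (A' (y - x))) / norm (y - x)) \<le> M * ?r y + M * ?\<delta> y * K) (at x)"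
    using M(2) eventually_at_in_open'[OF assms(1,2)] eventually_neq_at_within[of x x UNIV]
  proof eventually_elim
    case (elim y)
    let ?h = "y - x"
    \<comment> \<open>Splits the error into two terms: \<open>B y\<close> applied to the first-order
      remainder of \<open>A\<close> at the fixed vector \<open>?w\<close>, which is small of order
      \<open>o(h)\<close>, and \<open>B y (A y - A x)\<close> applied to a vector of size
      \<open>O(h)\<close>, where \<open>A y - A x\<close> supplies the additional smallness.\<close>
    have "B y v - B x v - - B x (A' ?h) = B y (A y (B x (A' ?h)) - A x (B x (A' ?h))) - B y (A y ?w - A x ?w - A' ?h)"
      using inv elim(2) assms(2) lin(2)[OF elim(2)] by (simp add: linear_diff)
    then have "norm (B y v - B x v - - B x (A' ?h)) \<le> norm (B y (A y ?w - A x ?w - A' ?h)) + norm (B y (A y (B x (A' ?h)) - A x (B x (A' ?h))))"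
      by (metis add.commute norm_triangle_ineq4)
    also have "\<dots> \<le> M * norm (A y ?w - A x ?w - A' ?h) + M * norm (A y (B x (A' ?h)) - A x (B x (A' ?h)))"
      using elim(1) by (intro add_mono) auto
    also have "norm (A y (B x (A' ?h)) - A x (B x (A' ?h))) \<le> norm (B x (A' ?h)) * ?\<delta> y"
      by (rule linear_diff_norm_bound) (use lin elim assms in auto)
    also have "norm (B x (A' ?h)) * ?\<delta> y \<le> (norm ?h * K) * ?\<delta> y"
      by (intro mult_right_mono K sum_nonneg) auto
    finally have "norm (B y v - B x v - - B x (A' ?h)) \<le> M * norm (A y ?w - A x ?w - A' ?h) + M * ((norm ?h * K) * ?\<delta> y)"
      using M(1) by simp
    then have "norm (B y v - B x v - - B x (A' ?h)) / norm ?h \<le> (M * norm (A y ?w - A x ?w - A' ?h) + M * ((norm ?h * K) * ?\<delta> y)) / norm ?h"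
      by (rule divide_right_mono) auto
    also have "\<dots> = M * ?r y + M * ?\<delta> y * K"
      using elim(3) by (simp add: field_simps)
    finally show ?case by simp
  qed
  moreover have "((\<lambda>y. M * ?r y + M * ?\<delta> y * K) \<longlongrightarrow> 0) (at x)"
    by (intro tendsto_add_zero tendsto_mult_left_zero tendsto_mult_right_zero \<delta> r)
  ultimately have "((\<lambda>y. norm (B y v - B x v - - B x (A' (y - x))) / norm (y - x)) \<longlongrightarrow> 0) (at x)"
    by (rule Lim_null_comparison)
  moreover have "bounded_linear (\<lambda>u. - B x (A' u))"
    using bounded_linear_minus[OF bounded_linear_compose[OF blB blA']] .
  ultimately show ?thesis
    unfolding has_derivative_iff_norm by blast
qed

text \<open>Bootstrapping: the derivative formula expresses the derivative of \<open>B\<close> by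
  \<open>B\<close> itself and by the derivative of \<open>A\<close>. If \<open>B\<close> is of class
  \<open>k\<close> and \<open>A\<close> of class \<open>k + 1\<close>, the right-hand side is of
  class \<open>k\<close>, so \<open>B\<close> is of class \<open>k + 1\<close>.\<close>

lemma Ck_on_inverse_family:
  fixes A :: "'a::real_normed_vector \<Rightarrow> 'b::euclidean_space \<Rightarrow> 'b"
  assumes "open U" and lin: "\<And>x. x \<in> U \<Longrightarrow> linear (A x)" "\<And>x. x \<in> U \<Longrightarrow> linear (B x)"
    and inv: "\<And>x v. x \<in> U \<Longrightarrow> B x (A x v) = v" "\<And>x v. x \<in> U \<Longrightarrow> A x (B x v) = v"
    and A: "\<And>v. Ck_on k U (\<lambda>x. A x v)"
  shows "Ck_on k U (\<lambda>x. B x v)"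
  using A
proof (induction k arbitrary: v)
  case 0
  then have "continuous_on U (\<lambda>x. A x v)" for v by simp
  then show ?case using continuous_on_inverse_family[OF assms(1) lin inv] by simp
next
  case (Suc k)
  have Ak: "Ck_on k U (\<lambda>x. A x v)" for v by (rule Ck_on_SucD[OF Suc.prems])
  have cont: "continuous_on U (\<lambda>x. A x v)" for v
    using Suc.prems by (rule Ck_on_imp_continuous_on)
  have der: "((\<lambda>y. A y w) has_derivative frechet_derivative (\<lambda>y. A y w) (at x)) (at x)" if "x \<in> U" for x w
    by (rule Ck_on_Suc_has_derivative[OF Suc.prems that])
  show ?case
  proof (rule Ck_on_SucI[where F = "\<lambda>x u. - B x (frechet_derivative (\<lambda>y. A y (B x v)) (at x) u)"])
    show "((\<lambda>x. B x v) has_derivative (\<lambda>u. - B x (frechet_derivative (\<lambda>y. A y (B x v)) (at x) u))) (at x)" if "x \<in> U" for x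
      by (rule has_derivative_inverse_family[OF assms(1) that lin inv cont der[OF that]])
    \<comment> \<open>The vector inserted into \<open>A\<close> will move with \<open>x\<close>, so
      \<open>Ck_on_linear_family\<close> asks for linearity of the derivative in that vector as
      well. It is inherited from the linearity of each \<open>A y\<close> by uniqueness of
      derivatives.\<close>
    have lind: "linear (\<lambda>w. frechet_derivative (\<lambda>y. A y w) (at x) u)" if x: "x \<in> U" for x u
    proof (rule linearI)
      fix a b c
      have "((\<lambda>y. A y (a + b)) has_derivative (\<lambda>u. frechet_derivative (\<lambda>y. A y a) (at x) u + frechet_derivative (\<lambda>y. A y b) (at x) u)) (at x)"
        by (rule has_derivative_transform_within_open[OF has_derivative_add[OF der[OF x, of a] der[OF x, of b]] assms(1) x])
           (simp add: lin linear_add)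
      from frechet_derivative_at[OF this, symmetric] 
      show "frechet_derivative (\<lambda>y. A y (a + b)) (at x) u = frechet_derivative (\<lambda>y. A y a) (at x) u + frechet_derivative (\<lambda>y. A y b) (at x) u"
        by simp
      have "((\<lambda>y. A y (c *\<^sub>R b)) has_derivative (\<lambda>u. c *\<^sub>R frechet_derivative (\<lambda>y. A y b) (at x) u)) (at x)"
        by (rule has_derivative_transform_within_open[OF has_derivative_scaleR_right[OF der[OF x, of b]] assms(1) x])
           (simp add: lin linear_scale)
      from frechet_derivative_at[OF this, symmetric]
      show "frechet_derivative (\<lambda>y. A y (c *\<^sub>R b)) (at x) u = c *\<^sub>R frechet_derivative (\<lambda>y. A y b) (at x) u"
        by simp
    qed
    have "Ck_on k U (\<lambda>x. - (B x (frechet_derivative (\<lambda>y. A y (B x v)) (at x) u)))" for u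
    proof (rule Ck_on_linear_compose[OF assms(1) bounded_linear_minus[OF bounded_linear_ident]])
      show "Ck_on k U (\<lambda>x. B x (frechet_derivative (\<lambda>y. A y (B x v)) (at x) u))"
      proof (rule Ck_on_linear_family[OF assms(1) lin(2)])
        show "Ck_on k U (\<lambda>x. B x w)" for w by (rule Suc.IH[OF Ak])
        show "Ck_on k U (\<lambda>x. frechet_derivative (\<lambda>y. A y (B x v)) (at x) u)"
        proof (rule Ck_on_linear_family[OF assms(1) lind])
          show "Ck_on k U (\<lambda>x. frechet_derivative (\<lambda>y. A y w) (at x) u)" for w
            using Suc.prems[of w] by simp
          show "Ck_on k U (\<lambda>x. B x v)" by (rule Suc.IH[OF Ak])
        qed
      qed
    qed
    then show "Ck_on k U (\<lambda>x. - B x (frechet_derivative (\<lambda>y. A y (B x v)) (at x) u))" for u by simp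
  qed (rule assms)
qed

text \<open>The derivative of \<open>g\<close> at \<open>y\<close> is the inverse of the linear map
  \<open>Df (g y)\<close>. If \<open>g\<close> is of class \<open>k\<close>, so is this linear
  family, hence also the family of inverses, and \<open>g\<close> gains one order.\<close>

lemma Ck_on_inverse_function:
  fixes f g :: "'a::euclidean_space \<Rightarrow> 'a"
  assumes "open U" "open V" "g ` V \<subseteq> U" and f: "\<And>k. Ck_on k U f"
    and der: "\<And>y. y \<in> V \<Longrightarrow> (g has_derivative g' y) (at y)"
    and g': "\<And>y. y \<in> V \<Longrightarrow> g' y = inv_into UNIV (frechet_derivative f (at (g y)))"
    and bij: "\<And>y. y \<in> V \<Longrightarrow> bij (frechet_derivative f (at (g y)))"
  shows "Ck_on k V g"
proof (induction k)
  case 0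
  show ?case
    using has_derivative_continuous[OF der] by (simp add: continuous_at_imp_continuous_on)
next
  case (Suc k)
  have lin: "linear (frechet_derivative f (at (g y)))" if "y \<in> V" for y
    using f[of 1] assms(3) that by (auto intro!: linear_frechet_derivative)
  show ?case
  proof (rule Ck_on_SucI[OF assms(2) der])
    show "Ck_on k V (\<lambda>y. g' y v)" for v
    proof (rule Ck_on_inverse_family[OF assms(2), where A = "\<lambda>y. frechet_derivative f (at (g y))"])
      show "linear (g' y)" if "y \<in> V" for y using der that by (auto dest: has_derivative_linear)
      show "Ck_on k V (\<lambda>y. frechet_derivative f (at (g y)) v)" for v
        by (rule Ck_on_compose[OF assms(2,1,3) Suc]) (use f[of "Suc k"] in auto)
    qed (use lin bij g' in \<open>auto simp: inv_f_f bij_is_inj surj_f_inv_f bij_is_surj\<close>)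
  qed
qed

text \<open>Only maps tangent to the identity at \<open>p\<close> are treated; the coordinates used
  for straightening a submersion are normalised in this way.\<close>

lemma smooth_inverse_function:
  fixes f :: "'a::euclidean_space \<Rightarrow> 'a"
  assumes "open U" "p \<in> U" and f: "\<And>k. Ck_on k U f"
    and id: "(f has_derivative (\<lambda>x. x)) (at p)"
  obtains N N' g where "open N" "N \<subseteq> U" "p \<in> N" "open N'" "homeomorphism N N' f g"
    "\<And>k. Ck_on k N' g"
proof -
  \<comment> \<open>The inverse function theorem expects a continuous family of bounded linear
    functions. \<open>Blinfun\<close> has a meaning only where its argument is bounded linear, hence
    the restriction to \<open>x \<in> U\<close> in all facts about \<open>F\<close>.\<close>
  define F where "F x = Blinfun (frechet_derivative f (at x))" for x
  have bl: "bounded_linear (frechet_derivative f (at x))" if "x \<in> U" for x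
    using Ck_on_Suc_has_derivative[OF f that] has_derivative_bounded_linear by blast
  have F: "blinfun_apply (F x) = frechet_derivative f (at x)" if "x \<in> U" for x
    using bl[OF that] by (simp add: F_def bounded_linear_Blinfun_apply)
  have "continuous_on U F"
  proof (rule continuous_on_blinfun_componentwise)
    fix i
    have "continuous_on U (\<lambda>x. frechet_derivative f (at x) i)"
      using f[of "Suc 0"] by simp
    then show "continuous_on U (\<lambda>x. blinfun_apply (F x) i)"
      by (rule continuous_on_eq) (simp add: F)
  qed
  moreover have "(f has_derivative blinfun_apply (F x)) (at x)" if "x \<in> U" for x
    using Ck_on_Suc_has_derivative[OF f that] F that by simp
  moreover have "id_blinfun o\<^sub>L F p = id_blinfun"
    using F[OF assms(2)] by (auto intro!: blinfun_eqI simp: frechet_derivative_at[OF id, symmetric])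
  ultimately obtain N N' g g' where *: "open N" "N \<subseteq> U" "p \<in> N" "open N'" "f p \<in> N'" "homeomorphism N N' f g"
    "\<And>y. y \<in> N' \<Longrightarrow> (g has_derivative (g' y)) (at y)"
    "\<And>y. y \<in> N' \<Longrightarrow> g' y = inv_into UNIV (blinfun_apply (F (g y)))"
    "\<And>y. y \<in> N' \<Longrightarrow> bij (blinfun_apply (F (g y)))"
    using inverse_function_theorem[OF assms(1) _ _ assms(2)] by metis
  have gN: "g ` N' \<subseteq> N" using *(6) by (simp add: homeomorphism_def)
  have F': "blinfun_apply (F (g y)) = frechet_derivative f (at (g y))" if "y \<in> N'" for y
    using F gN *(2) that by blast
  have "Ck_on k N' g" for k
    by (rule Ck_on_inverse_function[OF *(1,4) gN Ck_on_subset[OF f *(2)] *(7)])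
      (simp_all add: *(8,9) flip: F')
  then show thesis using that * by metis
qed

section \<open>Charts and smooth maps\<close>

text \<open>\<open>h\<close> is a smooth function of the coordinates \<open>\<phi>\<close> on \<open>A\<close>. Unlike \<^const>\<open>smooth_on\<close> on
  \<open>\<phi> ` A\<close>, this does not mention the inverse of \<open>\<phi>\<close>.\<close>

definition smooth_wrt ::
  "('a \<Rightarrow> 'e::euclidean_space) \<Rightarrow> 'a set \<Rightarrow> ('a \<Rightarrow> 'f::euclidean_space) \<Rightarrow> bool" where
  "smooth_wrt \<phi> A h \<longleftrightarrow> (\<forall>a\<in>A. \<exists>U g. open U \<and> \<phi> a \<in> U \<and> (\<forall>k. Ck_on k U g) \<and>
     (\<forall>b\<in>A. \<phi> b \<in> U \<longrightarrow> g (\<phi> b) = h b))"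

lemma smooth_wrtE:
  assumes "smooth_wrt \<phi> A h" "a \<in> A"
  obtains U g where "open U" "\<phi> a \<in> U" "\<And>k. Ck_on k U g" "\<And>b. b \<in> A \<Longrightarrow> \<phi> b \<in> U \<Longrightarrow> g (\<phi> b) = h b"
  using assms unfolding smooth_wrt_def by metis

text \<open>The passage from the smoothness notion in the definitions: on \<open>A\<close> the chart
  inverse cancels the injective chart, so that no inverse remains.\<close>

lemma smooth_on_image_iff:
  assumes "inj_on \<phi> U" "A \<subseteq> U"
  shows "smooth_on (\<phi> ` A) (h \<circ> inv_into U \<phi>) \<longleftrightarrow> smooth_wrt \<phi> A h"
proof -
  have "inv_into U \<phi> (\<phi> b) = b" if "b \<in> A" for b
    using assms that by (simp add: inv_into_f_f subset_iff)
  then have "(\<forall>y\<in>\<phi> ` A \<inter> V. g y = (h \<circ> inv_into U \<phi>) y) \<longleftrightarrow> (\<forall>b\<in>A. \<phi> b \<in> V \<longrightarrow> g (\<phi> b) = h b)" for V g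
    by auto
  then show ?thesis
    unfolding smooth_on_def smooth_wrt_def by simp
qed

lemma smooth_wrt_subset: "smooth_wrt \<phi> A h \<Longrightarrow> B \<subseteq> A \<Longrightarrow> smooth_wrt \<phi> B h"
  unfolding smooth_wrt_def subset_iff by metis

lemma smooth_wrt_cong: "(\<And>a. a \<in> A \<Longrightarrow> h a = k a) \<Longrightarrow> smooth_wrt \<phi> A h \<longleftrightarrow> smooth_wrt \<phi> A k"
  unfolding smooth_wrt_def by simp

lemma smooth_wrt_local:
  assumes "\<And>a. a \<in> A \<Longrightarrow> \<exists>V. open V \<and> \<phi> a \<in> V \<and> smooth_wrt \<phi> {b \<in> A. \<phi> b \<in> V} h"
  shows "smooth_wrt \<phi> A h"
  unfolding smooth_wrt_def
proof
  fix a assume a: "a \<in> A"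
  then obtain V where V: "open V" "\<phi> a \<in> V" "smooth_wrt \<phi> {b \<in> A. \<phi> b \<in> V} h" using assms by blast
  then obtain U g where U: "open U" "\<phi> a \<in> U" "\<And>k. Ck_on k U g"
    "\<And>b. b \<in> {b \<in> A. \<phi> b \<in> V} \<Longrightarrow> \<phi> b \<in> U \<Longrightarrow> g (\<phi> b) = h b"
    using smooth_wrtE[of \<phi> "{b \<in> A. \<phi> b \<in> V}" h a] a by (metis (no_types, lifting) mem_Collect_eq)
  show "\<exists>U g. open U \<and> \<phi> a \<in> U \<and> (\<forall>k. Ck_on k U g) \<and> (\<forall>b\<in>A. \<phi> b \<in> U \<longrightarrow> g (\<phi> b) = h b)"
    by (rule exI[of _ "U \<inter> V"], rule exI[of _ g])
       (use U V Ck_on_subset[OF U(3), of "U \<inter> V"] in auto)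
qed

lemma smooth_wrt_Ck:
  assumes "open U" "\<And>k. Ck_on k U g" "\<phi> ` A \<subseteq> U"
  shows "smooth_wrt \<phi> A (\<lambda>x. g (\<phi> x))"
  unfolding smooth_wrt_def using assms by blast

lemma smooth_wrt_compose:
  assumes "smooth_wrt \<phi> A (\<lambda>x. \<psi> (f x))" "smooth_wrt \<psi> B h" "f ` A \<subseteq> B"
  shows "smooth_wrt \<phi> A (\<lambda>x. h (f x))"
  unfolding smooth_wrt_def
proof
  fix a assume a: "a \<in> A"
  obtain U u where U: "open U" "\<phi> a \<in> U" "\<And>k. Ck_on k U u" "\<And>b. b \<in> A \<Longrightarrow> \<phi> b \<in> U \<Longrightarrow> u (\<phi> b) = \<psi> (f b)"
    using smooth_wrtE[OF assms(1) a] by metis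
  have fa: "f a \<in> B" using a assms(3) by auto
  obtain V v where V: "open V" "\<psi> (f a) \<in> V" "\<And>k. Ck_on k V v" "\<And>b. b \<in> B \<Longrightarrow> \<psi> b \<in> V \<Longrightarrow> v (\<psi> b) = h b"
    using smooth_wrtE[OF assms(2) fa] by metis
  let ?W = "U \<inter> u -` V"
  have W: "open ?W"
    using U(1,3) V(1) Ck_on_imp_continuous_on continuous_open_preimage by blast
  have u: "Ck_on k ?W u" for k
    by (rule Ck_on_subset[OF U(3)]) auto
  have "Ck_on k ?W (\<lambda>x. v (u x))" for k
    by (rule Ck_on_compose[OF W V(1) _ u V(3)]) auto
  moreover have "\<phi> a \<in> ?W" using U(2,4) V(2) a by simp
  moreover have "v (u (\<phi> b)) = h (f b)" if "b \<in> A" "\<phi> b \<in> ?W" for b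
    using that U(4)[of b] V(4)[of "f b"] assms(3) by auto
  ultimately show "\<exists>U g. open U \<and> \<phi> a \<in> U \<and> (\<forall>k. Ck_on k U g) \<and> (\<forall>b\<in>A. \<phi> b \<in> U \<longrightarrow> g (\<phi> b) = h (f b))"
    using W by (intro exI[of _ ?W] exI[of _ "\<lambda>x. v (u x)"]) simp
qed

lemma smooth_wrt_trans: "smooth_wrt \<phi> A \<psi> \<Longrightarrow> smooth_wrt \<psi> A h \<Longrightarrow> smooth_wrt \<phi> A h"
  using smooth_wrt_compose[of \<phi> A \<psi> "\<lambda>x. x" A h] by simp

lemma smooth_wrt_self: "smooth_wrt \<phi> A \<phi>"
  using smooth_wrt_Ck[OF open_UNIV, of "\<lambda>x. x"] Ck_on_bounded_linear[OF open_UNIV bounded_linear_ident] by auto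

lemma smooth_wrt_const: "smooth_wrt \<phi> A (\<lambda>_. c)"
  using smooth_wrt_Ck[OF open_UNIV, of "\<lambda>x. c"] Ck_on_const[OF open_UNIV] by auto

lemma smooth_wrt_linear:
  assumes "bounded_linear L" "smooth_wrt \<phi> A h"
  shows "smooth_wrt \<phi> A (\<lambda>x. L (h x))"
  by (rule smooth_wrt_trans[OF assms(2)], rule smooth_wrt_Ck[OF open_UNIV])
    (use Ck_on_bounded_linear[OF open_UNIV assms(1)] in auto)

lemma smooth_wrt_Pair:
  assumes "smooth_wrt \<phi> A h" "smooth_wrt \<phi> A k"
  shows "smooth_wrt \<phi> A (\<lambda>x. (h x, k x))"
  unfolding smooth_wrt_def
proof
  fix a assume a: "a \<in> A"
  obtain U u where U: "open U" "\<phi> a \<in> U" "\<And>k. Ck_on k U u" "\<And>b. b \<in> A \<Longrightarrow> \<phi> b \<in> U \<Longrightarrow> u (\<phi> b) = h b"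
    using smooth_wrtE[OF assms(1) a] by metis
  obtain V v where V: "open V" "\<phi> a \<in> V" "\<And>k. Ck_on k V v" "\<And>b. b \<in> A \<Longrightarrow> \<phi> b \<in> V \<Longrightarrow> v (\<phi> b) = k b"
    using smooth_wrtE[OF assms(2) a] by metis
  have UV: "open (U \<inter> V)" using U(1) V(1) by auto
  have "Ck_on k (U \<inter> V) (\<lambda>x. (u x, v x))" for k
    by (rule Ck_on_Pair[OF UV]) (auto intro: Ck_on_subset[OF U(3)] Ck_on_subset[OF V(3)])
  then show "\<exists>U g. open U \<and> \<phi> a \<in> U \<and> (\<forall>k. Ck_on k U g) \<and> (\<forall>b\<in>A. \<phi> b \<in> U \<longrightarrow> g (\<phi> b) = (h b, k b))"
    using UV U(2,4) V(2,4) by (intro exI[of _ "U \<inter> V"] exI[of _ "\<lambda>x. (u x, v x)"]) simp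
qed

lemma smooth_wrt_diff:
  assumes "smooth_wrt \<phi> A h" "smooth_wrt \<phi> A k"
  shows "smooth_wrt \<phi> A (\<lambda>x. h x - k x)"
  using smooth_wrt_linear[OF bounded_linear_sub[OF bounded_linear_fst bounded_linear_snd] smooth_wrt_Pair[OF assms]]
  by simp

lemma smooth_wrt_map_prod:
  assumes "smooth_wrt \<phi> A h" "smooth_wrt \<psi> B k"
  shows "smooth_wrt (map_prod \<phi> \<psi>) (A \<times> B) (map_prod h k)"
proof -
  have "smooth_wrt (map_prod \<phi> \<psi>) (A \<times> B) (\<lambda>x. \<phi> (fst x))"
    using smooth_wrt_linear[OF bounded_linear_fst smooth_wrt_self[of "map_prod \<phi> \<psi>"]] by simp
  then have h: "smooth_wrt (map_prod \<phi> \<psi>) (A \<times> B) (\<lambda>x. h (fst x))"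
    by (rule smooth_wrt_compose[OF _ assms(1)]) auto
  have "smooth_wrt (map_prod \<phi> \<psi>) (A \<times> B) (\<lambda>x. \<psi> (snd x))"
    using smooth_wrt_linear[OF bounded_linear_snd smooth_wrt_self[of "map_prod \<phi> \<psi>"]] by simp
  then have k: "smooth_wrt (map_prod \<phi> \<psi>) (A \<times> B) (\<lambda>x. k (snd x))"
    by (rule smooth_wrt_compose[OF _ assms(2)]) auto
  have eq: "(\<lambda>x. (h (fst x), k (snd x))) = map_prod h k" by auto
  show ?thesis using smooth_wrt_Pair[OF h k] unfolding eq .
qed

text \<open>The homeomorphism condition becomes a description of the open subsets of
  \<open>U\<close>: they are exactly the preimages under \<phi> of open subsets of the ambient
  space. Topological questions in a chart can then be settled without mentioning its image.\<close>

lemma is_chart_iff: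
  "is_chart X n (U, \<phi>) \<longleftrightarrow> openin X U \<and> inj_on \<phi> U \<and>
     (\<exists>W. subspace W \<and> dim W = n \<and> openin (top_of_set W) (\<phi> ` U)) \<and>
     (\<forall>T\<subseteq>U. openin X T \<longleftrightarrow> (\<exists>V. open V \<and> T = {x \<in> U. \<phi> x \<in> V}))" (is "?L \<longleftrightarrow> ?R")
proof (cases "openin X U \<and> inj_on \<phi> U")
  case True
  then have U: "openin X U" and inj: "inj_on \<phi> U" by auto
  have top: "topspace (subtopology X U) = U"
    using openin_subset[OF U] by auto
  have opn: "openin (subtopology X U) T \<longleftrightarrow> openin X T" if "T \<subseteq> U" for T
    using openin_open_subtopology[OF U] that by auto
  have opn': "openin (top_of_set (\<phi> ` U)) S \<longleftrightarrow> (\<exists>V. open V \<and> {x\<in>U. \<phi> x \<in> S} = {x \<in> U. \<phi> x \<in> V})" if "S \<subseteq> \<phi> ` U" for S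
  proof -
    have "S = \<phi> ` U \<inter> V \<longleftrightarrow> {x\<in>U. \<phi> x \<in> S} = {x \<in> U. \<phi> x \<in> V}" for V
      using that by auto
    then show ?thesis unfolding openin_open by auto
  qed
  have "quotient_map (subtopology X U) (top_of_set (\<phi> ` U)) \<phi> \<longleftrightarrow>
     (\<forall>S\<subseteq>\<phi> ` U. openin X {x \<in> U. \<phi> x \<in> S} \<longleftrightarrow> (\<exists>V. open V \<and> {x\<in>U. \<phi> x \<in> S} = {x \<in> U. \<phi> x \<in> V}))"
    unfolding quotient_map_def top using opn opn' by auto
  also have "\<dots> \<longleftrightarrow> (\<forall>T\<subseteq>U. openin X T \<longleftrightarrow> (\<exists>V. open V \<and> T = {x \<in> U. \<phi> x \<in> V}))"
  proof (rule iffI; intro allI impI)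
    fix T assume *: "\<forall>S\<subseteq>\<phi> ` U. openin X {x \<in> U. \<phi> x \<in> S} \<longleftrightarrow> (\<exists>V. open V \<and> {x\<in>U. \<phi> x \<in> S} = {x \<in> U. \<phi> x \<in> V})"
      and T: "T \<subseteq> U"
    have eq: "{x \<in> U. \<phi> x \<in> \<phi> ` T} = T" using inj T by (auto simp: inj_on_def)
    show "openin X T \<longleftrightarrow> (\<exists>V. open V \<and> T = {x \<in> U. \<phi> x \<in> V})"
      using *[rule_format, of "\<phi> ` T"] T unfolding eq by blast
  next
    fix S assume *: "\<forall>T\<subseteq>U. openin X T \<longleftrightarrow> (\<exists>V. open V \<and> T = {x \<in> U. \<phi> x \<in> V})" and S: "S \<subseteq> \<phi> ` U"
    show "openin X {x \<in> U. \<phi> x \<in> S} \<longleftrightarrow> (\<exists>V. open V \<and> {x\<in>U. \<phi> x \<in> S} = {x \<in> U. \<phi> x \<in> V})"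
      by (rule *[rule_format]) auto
  qed
  finally show ?thesis
    using inj U unfolding is_chart_def homeomorphic_map_def top split by blast
next
  case False
  then show ?thesis
    using openin_subset[of X U] by (auto simp: is_chart_def homeomorphic_map_def Int_absorb1)
qed

lemma is_chart_openin: "is_chart X n (U, \<phi>) \<Longrightarrow> openin X U"
  and is_chart_inj: "is_chart X n (U, \<phi>) \<Longrightarrow> inj_on \<phi> U"
  by (simp_all add: is_chart_iff)

lemma is_chart_openin_iff:
  "is_chart X n (U, \<phi>) \<Longrightarrow> T \<subseteq> U \<Longrightarrow> openin X T \<longleftrightarrow> (\<exists>V. open V \<and> T = {x \<in> U. \<phi> x \<in> V})"
  by (simp add: is_chart_iff)

lemma is_chart_preimage:
  assumes "is_chart X n (U, \<phi>)" "open V"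
  shows "openin X {x \<in> U. \<phi> x \<in> V}"
  by (subst is_chart_openin_iff[OF assms(1)]) (use assms(2) in auto)

lemma is_chart_openE:
  assumes "is_chart X n (U, \<phi>)" "openin X T" "T \<subseteq> U"
  obtains V where "open V" "T = {x \<in> U. \<phi> x \<in> V}"
  using is_chart_openin_iff[OF assms(1,3)] assms(2) by auto

text \<open>A nonempty relatively open subset of a subspace has full dimension in it and therefore
  spans it, which identifies the model subspace. For an empty domain the span is the zero space,
  whatever the dimension of the manifold.\<close>

lemma is_chart_subspace:
  assumes "is_chart X n (U, \<phi>)" "U \<noteq> {}"
  shows "dim (span (\<phi> ` U)) = n" "openin (top_of_set (span (\<phi> ` U))) (\<phi> ` U)"
proof -
  obtain W where W: "subspace W" "dim W = n" "openin (top_of_set W) (\<phi> ` U)"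
    using assms(1) unfolding is_chart_iff by blast
  have "span (\<phi> ` U) = W"
  proof (rule subspace_dim_equal[OF subspace_span W(1)])
    show "span (\<phi> ` U) \<subseteq> W" using W(1,3) by (simp add: openin_subset span_minimal openin_imp_subset)
    show "dim W \<le> dim (span (\<phi> ` U))"
      using dim_openin[OF W(3)] assms(2) W(1) by simp
  qed
  then show "dim (span (\<phi> ` U)) = n" "openin (top_of_set (span (\<phi> ` U))) (\<phi> ` U)" using W by auto
qed

lemma is_chart_restrict:
  assumes "is_chart X n (U, \<phi>)" "openin X T" "T \<subseteq> U"
  shows "is_chart X n (T, \<phi>)"
proof -
  obtain V where V: "open V" "T = {x \<in> U. \<phi> x \<in> V}" using is_chart_openE[OF assms] .
  obtain W where W: "subspace W" "dim W = n" "openin (top_of_set W) (\<phi> ` U)"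
    using assms(1) unfolding is_chart_iff by blast
  have "\<phi> ` T = \<phi> ` U \<inter> V" using V by auto
  then have "openin (top_of_set W) (\<phi> ` T)"
    using W(3) V(1) by (metis openin_Int_open)
  moreover have "(\<exists>V. open V \<and> S = {x \<in> U. \<phi> x \<in> V}) \<longleftrightarrow> (\<exists>V. open V \<and> S = {x \<in> T. \<phi> x \<in> V})" if "S \<subseteq> T" for S
  proof (intro iffI; elim exE conjE)
    fix V' assume "open V'" "S = {x \<in> U. \<phi> x \<in> V'}"
    then show "\<exists>V. open V \<and> S = {x \<in> T. \<phi> x \<in> V}" using that assms(3) by (intro exI[of _ V']) auto
  next
    fix V' assume "open V'" "S = {x \<in> T. \<phi> x \<in> V'}"
    then show "\<exists>V. open V \<and> S = {x \<in> U. \<phi> x \<in> V}" using V by (intro exI[of _ "V \<inter> V'"]) auto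
  qed
  moreover have "inj_on \<phi> T" using is_chart_inj[OF assms(1)] assms(3) inj_on_subset by blast
  ultimately show ?thesis
    using assms W(1,2) unfolding is_chart_iff
    using dual_order.trans[of _ T U] by (intro conjI exI[of _ W]) simp_all
qed

lemma compatible_iff:
  assumes "inj_on \<phi> U" "inj_on \<psi> V"
  shows "compatible (U, \<phi>) (V, \<psi>) \<longleftrightarrow> smooth_wrt \<phi> (U \<inter> V) \<psi> \<and> smooth_wrt \<psi> (U \<inter> V) \<phi>"
  using smooth_on_image_iff[OF assms(1), of "U \<inter> V" \<psi>] smooth_on_image_iff[OF assms(2), of "U \<inter> V" \<phi>]
  by (simp add: compatible_def)

text \<open>Locality with respect to open sets of the manifold; the chart turns each of them into an
  open set of coordinate values, to which \<open>smooth_wrt_local\<close> applies.\<close>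

lemma smooth_wrt_nbhd:
  assumes "is_chart X n (U, \<phi>)" "A \<subseteq> U"
    "\<And>a. a \<in> A \<Longrightarrow> \<exists>T. openin X T \<and> a \<in> T \<and> smooth_wrt \<phi> (A \<inter> T) h"
  shows "smooth_wrt \<phi> A h"
proof (rule smooth_wrt_local)
  fix a assume a: "a \<in> A"
  then obtain T where T: "openin X T" "a \<in> T" "smooth_wrt \<phi> (A \<inter> T) h" using assms(3) by blast
  obtain V where V: "open V" "U \<inter> T = {x \<in> U. \<phi> x \<in> V}"
    using is_chart_openE[OF assms(1), of "U \<inter> T"] T(1) is_chart_openin[OF assms(1)] by (metis inf_le1 openin_Int)
  have "{b \<in> A. \<phi> b \<in> V} = A \<inter> T" using V(2) assms(2) by blast
  then show "\<exists>V. open V \<and> \<phi> a \<in> V \<and> smooth_wrt \<phi> {b \<in> A. \<phi> b \<in> V} h"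
    using V T a assms(2) by (metis (mono_tags, lifting) IntI mem_Collect_eq subset_iff)
qed

section \<open>The maximal atlas\<close>

context
  fixes M :: "('a, 'e::euclidean_space) manifold"
  assumes M: "smooth_manifold M"
begin

lemma charts_is_chart: "c \<in> charts M \<Longrightarrow> is_chart (mtop M) (mdim M) c"
  using M by (simp add: smooth_manifold_def)

lemma charts_subset_maximal_atlas: "charts M \<subseteq> maximal_atlas M"
  using M unfolding smooth_manifold_def maximal_atlas_def by auto

lemma charts_cover:
  assumes "x \<in> points M"
  obtains U \<phi> where "(U, \<phi>) \<in> charts M" "x \<in> U"
  using M assms unfolding smooth_manifold_def by (metis (no_types, lifting) UN_E prod.collapse)

text \<open>Members of the maximal atlas are compared only with the given charts. Two of them are
  compared near each point by passing through a given chart around that point.\<close>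

lemma maximal_atlas_compat:
  assumes "(U, \<phi>) \<in> maximal_atlas M" "(V, \<psi>) \<in> maximal_atlas M"
  shows "smooth_wrt \<phi> (U \<inter> V) \<psi>"
proof -
  have ch: "is_chart (mtop M) (mdim M) (U, \<phi>)" "is_chart (mtop M) (mdim M) (V, \<psi>)"
    using assms by (auto simp: maximal_atlas_def)
  show ?thesis
  proof (rule smooth_wrt_nbhd[OF ch(1)])
    fix a assume a: "a \<in> U \<inter> V"
    then have "a \<in> points M" using is_chart_openin[OF ch(1)] openin_subset by blast
    then obtain T \<omega> where T: "(T, \<omega>) \<in> charts M" "a \<in> T" by (rule charts_cover)
    note chT = charts_is_chart[OF T(1)]
    have "compatible (U, \<phi>) (T, \<omega>)" "compatible (V, \<psi>) (T, \<omega>)"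
      using assms T(1) by (auto simp: maximal_atlas_def)
    then have "smooth_wrt \<phi> (U \<inter> T) \<omega>" "smooth_wrt \<omega> (V \<inter> T) \<psi>"
      using compatible_iff[OF is_chart_inj[OF ch(1)] is_chart_inj[OF chT]]
        compatible_iff[OF is_chart_inj[OF ch(2)] is_chart_inj[OF chT]] by auto
    then have "smooth_wrt \<phi> (U \<inter> V \<inter> T) \<psi>"
      by (intro smooth_wrt_trans[of \<phi> "U \<inter> V \<inter> T" \<omega> \<psi>]) (auto elim: smooth_wrt_subset)
    then show "\<exists>T. openin (mtop M) T \<and> a \<in> T \<and> smooth_wrt \<phi> (U \<inter> V \<inter> T) \<psi>"
      using T(2) is_chart_openin[OF chT] by blast
  qed auto
qed

lemma maximal_atlasI:
  assumes "(U, \<phi>) \<in> maximal_atlas M" "is_chart (mtop M) (mdim M) (V, \<psi>)" "V \<subseteq> U"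
    "smooth_wrt \<phi> V \<psi>" "smooth_wrt \<psi> V \<phi>"
  shows "(V, \<psi>) \<in> maximal_atlas M"
  unfolding maximal_atlas_def
proof (intro CollectI conjI ballI assms(2))
  fix c assume "c \<in> charts M"
  moreover obtain T \<omega> where c: "c = (T, \<omega>)" by (cases c)
  ultimately have T: "(T, \<omega>) \<in> charts M" by simp
  then have *: "smooth_wrt \<phi> (U \<inter> T) \<omega>" "smooth_wrt \<omega> (T \<inter> U) \<phi>"
    using maximal_atlas_compat assms(1) charts_subset_maximal_atlas by auto
  have "smooth_wrt \<psi> (V \<inter> T) \<omega>"
    by (rule smooth_wrt_trans[of \<psi> "V \<inter> T" \<phi>])
       (use assms(3) in \<open>auto intro: smooth_wrt_subset[OF assms(5)] smooth_wrt_subset[OF *(1)]\<close>)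
  moreover have "smooth_wrt \<omega> (V \<inter> T) \<psi>"
    by (rule smooth_wrt_trans[of \<omega> "V \<inter> T" \<phi>])
       (use assms(3) in \<open>auto intro: smooth_wrt_subset[OF assms(4)] smooth_wrt_subset[OF *(2)]\<close>)
  ultimately show "compatible (V, \<psi>) c"
    unfolding c using compatible_iff[OF is_chart_inj[OF assms(2)] is_chart_inj[OF charts_is_chart[OF T]]] by simp
qed

lemma maximal_atlas_restrict:
  assumes "(U, \<phi>) \<in> maximal_atlas M" "openin (mtop M) T" "T \<subseteq> U"
  shows "(T, \<phi>) \<in> maximal_atlas M"
  using maximal_atlasI[OF assms(1) is_chart_restrict[OF _ assms(2,3)] assms(3) smooth_wrt_self smooth_wrt_self] assms(1)
  by (simp add: maximal_atlas_def)

lemma maximal_atlas_cover: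
  assumes "x \<in> points M"
  obtains U \<phi> where "(U, \<phi>) \<in> maximal_atlas M" "x \<in> U"
  using charts_cover[OF assms] charts_subset_maximal_atlas by blast

end

lemma maximal_atlas_is_chart: "c \<in> maximal_atlas M \<Longrightarrow> is_chart (mtop M) (mdim M) c"
  by (simp add: maximal_atlas_def)

lemma maximal_atlas_subset: "(U, \<phi>) \<in> maximal_atlas M \<Longrightarrow> U \<subseteq> points M"
  using maximal_atlas_is_chart is_chart_openin openin_subset by metis

definition smooth_at ::
  "('a, 'e::euclidean_space) manifold \<Rightarrow> ('b, 'f::euclidean_space) manifold \<Rightarrow> ('a \<Rightarrow> 'b) \<Rightarrow> 'a \<Rightarrow> bool" where
  "smooth_at M N f x \<longleftrightarrow> (\<exists>(U, \<phi>)\<in>maximal_atlas M. \<exists>(V, \<psi>)\<in>maximal_atlas N.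
     x \<in> U \<and> f ` U \<subseteq> V \<and> smooth_wrt \<phi> U (\<lambda>y. \<psi> (f y)))"

lemma smooth_atE:
  assumes "smooth_at M N f x"
  obtains U \<phi> V \<psi> where "(U, \<phi>) \<in> maximal_atlas M" "(V, \<psi>) \<in> maximal_atlas N"
    "x \<in> U" "f ` U \<subseteq> V" "smooth_wrt \<phi> U (\<lambda>y. \<psi> (f y))"
  using assms unfolding smooth_at_def by auto

lemma smooth_atI:
  "(U, \<phi>) \<in> maximal_atlas M \<Longrightarrow> (V, \<psi>) \<in> maximal_atlas N \<Longrightarrow> x \<in> U \<Longrightarrow> f ` U \<subseteq> V \<Longrightarrow>
   smooth_wrt \<phi> U (\<lambda>y. \<psi> (f y)) \<Longrightarrow> smooth_at M N f x"
  unfolding smooth_at_def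
  by (rule rev_bexI, assumption, simp only: split, rule rev_bexI, assumption, simp)

lemma smooth_wrt_preimage_open:
  assumes "is_chart X n (U, \<phi>)" "smooth_wrt \<phi> U h" "open V"
  shows "openin X {x \<in> U. h x \<in> V}"
proof (subst openin_subopen, intro ballI)
  fix x assume "x \<in> {x \<in> U. h x \<in> V}"
  then have x: "x \<in> U" "h x \<in> V" by auto
  obtain T g where T: "open T" "\<phi> x \<in> T" "\<And>k. Ck_on k T g" "\<And>b. b \<in> U \<Longrightarrow> \<phi> b \<in> T \<Longrightarrow> g (\<phi> b) = h b"
    using smooth_wrtE[OF assms(2) x(1)] by metis
  have "open (T \<inter> g -` V)"
    using T(1,3) assms(3) Ck_on_imp_continuous_on continuous_open_preimage by blast
  then have "openin X {y \<in> U. \<phi> y \<in> T \<inter> g -` V}"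
    by (rule is_chart_preimage[OF assms(1)])
  then show "\<exists>T. openin X T \<and> x \<in> T \<and> T \<subseteq> {x \<in> U. h x \<in> V}"
    using x T(2,4) by (intro exI[of _ "{y \<in> U. \<phi> y \<in> T \<inter> g -` V}"]) auto
qed

lemma smooth_local_continuous:
  assumes "is_chart X n (U, \<phi>)" "is_chart Z m (V, \<psi>)" "f ` U \<subseteq> V" "smooth_wrt \<phi> U (\<lambda>y. \<psi> (f y))" "openin Z T"
  shows "openin X {x \<in> U. f x \<in> T}"
proof -
  obtain S where S: "open S" "V \<inter> T = {x \<in> V. \<psi> x \<in> S}"
    using is_chart_openE[OF assms(2), of "V \<inter> T"] assms(5) is_chart_openin[OF assms(2)] by (metis inf_le1 openin_Int)
  have "{x \<in> U. f x \<in> T} = {x \<in> U. \<psi> (f x) \<in> S}"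
    using S(2) assms(3) by auto
  then show ?thesis using smooth_wrt_preimage_open[OF assms(1,4) S(1)] by simp
qed

text \<open>Independence of the charts: coordinates are changed on both sides, after cutting the
  domain down to the points that \<open>f\<close> sends into \<open>V\<close>. This set is open
  because \<open>f\<close> is continuous in the pair of charts given by
  \<open>smooth_at\<close>.\<close>

lemma smooth_at_charts:
  assumes M: "smooth_manifold M" and N: "smooth_manifold N" and f: "smooth_at M N f x"
    and c: "(U, \<phi>) \<in> maximal_atlas M" "(V, \<psi>) \<in> maximal_atlas N" "x \<in> U" "f x \<in> V"
  obtains U' where "openin (mtop M) U'" "x \<in> U'" "U' \<subseteq> U" "f ` U' \<subseteq> V" "smooth_wrt \<phi> U' (\<lambda>y. \<psi> (f y))"
    "(U', \<phi>) \<in> maximal_atlas M"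
proof -
  obtain T \<alpha> S \<beta> where *: "(T, \<alpha>) \<in> maximal_atlas M" "(S, \<beta>) \<in> maximal_atlas N"
    "x \<in> T" "f ` T \<subseteq> S" "smooth_wrt \<alpha> T (\<lambda>y. \<beta> (f y))"
    using smooth_atE[OF f] by metis
  note ch = maximal_atlas_is_chart[OF *(1)] maximal_atlas_is_chart[OF *(2)] maximal_atlas_is_chart[OF c(1)]
    maximal_atlas_is_chart[OF c(2)]
  define U' where "U' = U \<inter> {y \<in> T. f y \<in> V}"
  have op: "openin (mtop M) U'"
    unfolding U'_def by (intro openin_Int is_chart_openin[OF ch(3)] smooth_local_continuous[OF ch(1,2) *(4,5)] is_chart_openin[OF ch(4)])
  have "smooth_wrt \<phi> U' \<alpha>"
    by (rule smooth_wrt_subset[OF maximal_atlas_compat[OF M c(1) *(1)]]) (auto simp: U'_def)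
  then have "smooth_wrt \<phi> U' (\<lambda>y. \<beta> (f y))"
    by (rule smooth_wrt_trans) (rule smooth_wrt_subset[OF *(5)], auto simp: U'_def)
  then have "smooth_wrt \<phi> U' (\<lambda>y. \<psi> (f y))"
    by (rule smooth_wrt_compose[OF _ maximal_atlas_compat[OF N *(2) c(2)]]) (use *(4) in \<open>auto simp: U'_def\<close>)
  then show thesis
    using op c *(3) maximal_atlas_restrict[OF M c(1) op] by (intro that[of U']) (auto simp: U'_def)
qed

text \<open>In one direction continuity makes the part of a chart mapped into another chart open, so
  that it is again a chart domain. In the other direction both continuity and the condition on all
  pairs of charts are recovered pointwise.\<close>

lemma smooth_map_iff:
  assumes M: "smooth_manifold M" and N: "smooth_manifold N"
  shows "smooth_map M N f \<longleftrightarrow> (\<forall>x\<in>points M. smooth_at M N f x)" (is "?L \<longleftrightarrow> ?R")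
proof
  assume f: ?L
  then have cont: "continuous_map (mtop M) (mtop N) f" by (simp add: smooth_map_def)
  show ?R
  proof
    fix x assume x: "x \<in> points M"
    then have "f x \<in> points N" using cont by (auto simp: continuous_map_def)
    then obtain V \<psi> where V: "(V, \<psi>) \<in> charts N" "f x \<in> V" by (rule charts_cover[OF N])
    obtain U \<phi> where U: "(U, \<phi>) \<in> charts M" "x \<in> U" by (rule charts_cover[OF M x])
    have U': "(U, \<phi>) \<in> maximal_atlas M" and V': "(V, \<psi>) \<in> maximal_atlas N"
      using U V charts_subset_maximal_atlas M N by auto
    let ?T = "{x \<in> U. f x \<in> V}"
    have "openin (mtop M) (U \<inter> {x \<in> points M. f x \<in> V})"
      by (intro openin_Int openin_continuous_map_preimage[OF cont]
          is_chart_openin[OF maximal_atlas_is_chart[OF U']] is_chart_openin[OF maximal_atlas_is_chart[OF V']])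
    moreover have "U \<inter> {x \<in> points M. f x \<in> V} = ?T" using maximal_atlas_subset[OF U'] by auto
    ultimately have "(?T, \<phi>) \<in> maximal_atlas M" using maximal_atlas_restrict[OF M U'] by simp
    moreover have "smooth_on (\<phi> ` ?T) ((\<lambda>y. \<psi> (f y)) \<circ> inv_into U \<phi>)"
    proof -
      have "smooth_on (\<phi> ` ?T) (\<psi> \<circ> f \<circ> inv_into U \<phi>)"
        using f U(1) V(1) unfolding smooth_map_def by fast
      then show ?thesis by (simp add: o_def)
    qed
    then have "smooth_wrt \<phi> ?T (\<lambda>y. \<psi> (f y))"
      using smooth_on_image_iff[OF is_chart_inj[OF maximal_atlas_is_chart[OF U']], of ?T "\<lambda>y. \<psi> (f y)"] by auto
    ultimately show "smooth_at M N f x"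
      using V' V(2) U(2) \<open>f x \<in> V\<close> by (intro smooth_atI[of ?T \<phi> M V \<psi>]) auto
  qed
next
  assume f: ?R
  have "continuous_map (mtop M) (mtop N) f"
    unfolding continuous_map_def
  proof (intro conjI allI impI)
    show "f \<in> points M \<rightarrow> points N"
    proof
      fix x assume "x \<in> points M"
      then obtain U \<phi> V \<psi> where "(U, \<phi>) \<in> maximal_atlas M" "(V, \<psi>) \<in> maximal_atlas N" "x \<in> U" "f ` U \<subseteq> V"
        using f smooth_atE by metis
      then show "f x \<in> points N" using maximal_atlas_subset by blast
    qed
    fix T assume T: "openin (mtop N) T"
    show "openin (mtop M) {x \<in> points M. f x \<in> T}"
    proof (subst openin_subopen, intro ballI)
      fix x assume "x \<in> {x \<in> points M. f x \<in> T}"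
      then have x: "x \<in> points M" "f x \<in> T" by auto
      then obtain U \<phi> V \<psi> where *: "(U, \<phi>) \<in> maximal_atlas M" "(V, \<psi>) \<in> maximal_atlas N"
        "x \<in> U" "f ` U \<subseteq> V" "smooth_wrt \<phi> U (\<lambda>y. \<psi> (f y))"
        using f smooth_atE by metis
      have "openin (mtop M) {x \<in> U. f x \<in> T}"
        by (rule smooth_local_continuous[OF maximal_atlas_is_chart[OF *(1)] maximal_atlas_is_chart[OF *(2)] *(4,5) T])
      then show "\<exists>S. openin (mtop M) S \<and> x \<in> S \<and> S \<subseteq> {x \<in> points M. f x \<in> T}"
        using x *(3) maximal_atlas_subset[OF *(1)] by (intro exI[of _ "{x \<in> U. f x \<in> T}"]) auto
    qed
  qed
  moreover have "smooth_on (\<phi> ` {x\<in>U. f x \<in> V}) (\<psi> \<circ> f \<circ> inv_into U \<phi>)"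
    if U: "(U, \<phi>) \<in> charts M" and V: "(V, \<psi>) \<in> charts N" for U \<phi> V \<psi>
  proof -
    have U': "(U, \<phi>) \<in> maximal_atlas M" and V': "(V, \<psi>) \<in> maximal_atlas N"
      using U V charts_subset_maximal_atlas M N by auto
    let ?T = "{x \<in> U. f x \<in> V}"
    have "smooth_wrt \<phi> ?T (\<lambda>y. \<psi> (f y))"
    proof (rule smooth_wrt_nbhd[OF maximal_atlas_is_chart[OF U']])
      fix a assume "a \<in> ?T"
      then have a: "a \<in> U" "f a \<in> V" "smooth_at M N f a" using f maximal_atlas_subset[OF U'] by auto
      obtain S where "openin (mtop M) S" "a \<in> S" "S \<subseteq> U" "f ` S \<subseteq> V" "smooth_wrt \<phi> S (\<lambda>y. \<psi> (f y))"
        using smooth_at_charts[OF M N a(3) U' V' a(1,2)] by metis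
      then show "\<exists>S. openin (mtop M) S \<and> a \<in> S \<and> smooth_wrt \<phi> (?T \<inter> S) (\<lambda>y. \<psi> (f y))"
        by (meson inf_le2 smooth_wrt_subset)
    qed auto
    then have "smooth_on (\<phi> ` ?T) ((\<lambda>y. \<psi> (f y)) \<circ> inv_into U \<phi>)"
      using smooth_on_image_iff[OF is_chart_inj[OF maximal_atlas_is_chart[OF U']], of ?T "\<lambda>y. \<psi> (f y)"] by auto
    then show ?thesis by (simp add: o_def)
  qed
  ultimately show ?L unfolding smooth_map_def by auto
qed

lemma smooth_at_compose:
  assumes M: "smooth_manifold M" and N: "smooth_manifold N"
    and f: "smooth_at M N f x" and g: "smooth_at N Z g (f x)"
  shows "smooth_at M Z (\<lambda>x. g (f x)) x"
proof -
  obtain V \<psi> S \<omega> where *: "(V, \<psi>) \<in> maximal_atlas N" "(S, \<omega>) \<in> maximal_atlas Z"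
    "f x \<in> V" "g ` V \<subseteq> S" "smooth_wrt \<psi> V (\<lambda>y. \<omega> (g y))"
    using smooth_atE[OF g] by metis
  obtain U \<phi> where U: "(U, \<phi>) \<in> maximal_atlas M" "x \<in> U"
    using smooth_atE[OF f] by metis
  obtain U' where U': "x \<in> U'" "U' \<subseteq> U" "f ` U' \<subseteq> V" "smooth_wrt \<phi> U' (\<lambda>y. \<psi> (f y))"
    "(U', \<phi>) \<in> maximal_atlas M"
    using smooth_at_charts[OF M N f U(1) *(1) U(2) *(3)] by metis
  have "smooth_wrt \<phi> U' (\<lambda>y. \<omega> (g (f y)))"
    by (rule smooth_wrt_compose[OF U'(4) *(5) U'(3)])
  then show ?thesis
    using U' * by (intro smooth_atI[of U' \<phi> M S \<omega>]) auto
qed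

lemma smooth_at_cong:
  assumes M: "smooth_manifold M" and f: "smooth_at M N f x"
    and T: "openin (mtop M) T" "x \<in> T" "\<And>y. y \<in> T \<Longrightarrow> f y = g y"
  shows "smooth_at M N g x"
proof -
  obtain U \<phi> V \<psi> where *: "(U, \<phi>) \<in> maximal_atlas M" "(V, \<psi>) \<in> maximal_atlas N"
    "x \<in> U" "f ` U \<subseteq> V" "smooth_wrt \<phi> U (\<lambda>y. \<psi> (f y))"
    using smooth_atE[OF f] by metis
  have "(U \<inter> T, \<phi>) \<in> maximal_atlas M"
    by (intro maximal_atlas_restrict[OF M *(1)] openin_Int T(1) is_chart_openin[OF maximal_atlas_is_chart[OF *(1)]]) simp
  moreover have "smooth_wrt \<phi> (U \<inter> T) (\<lambda>y. \<psi> (g y))"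
    using smooth_wrt_cong[of "U \<inter> T" "\<lambda>y. \<psi> (f y)" "\<lambda>y. \<psi> (g y)" \<phi>] smooth_wrt_subset[OF *(5), of "U \<inter> T"] T(3) by auto
  moreover have "g ` (U \<inter> T) \<subseteq> V" using *(4) T(3) by auto
  ultimately show ?thesis
    using * T(2) by (intro smooth_atI[of "U \<inter> T" \<phi> M V \<psi>]) auto
qed

section \<open>Basic operations on smooth maps\<close>

lemma smooth_map_points: "smooth_map M N f \<Longrightarrow> x \<in> points M \<Longrightarrow> f x \<in> points N"
  unfolding smooth_map_def continuous_map_def by auto

lemma smooth_map_compose:
  assumes "smooth_manifold M" "smooth_manifold N" "smooth_manifold Z" "smooth_map M N f" "smooth_map N Z g"
  shows "smooth_map M Z (\<lambda>x. g (f x))"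
  using assms(4,5) smooth_map_points[OF assms(4)] smooth_at_compose[OF assms(1,2), of f _ Z g]
  by (simp add: smooth_map_iff assms(1-3))

lemma smooth_map_cong:
  assumes "smooth_manifold M" "smooth_manifold N" "smooth_map M N f" "\<And>x. x \<in> points M \<Longrightarrow> f x = g x"
  shows "smooth_map M N g"
  using assms smooth_at_cong[OF assms(1), of N f _ "points M" g]
  by (auto simp: smooth_map_iff)

lemma smooth_map_ident: "smooth_manifold M \<Longrightarrow> smooth_map M M (\<lambda>x. x)"
  by (auto simp: smooth_map_iff smooth_at_def elim!: maximal_atlas_cover intro: smooth_wrt_self)

lemma smooth_map_const:
  assumes "smooth_manifold M" "smooth_manifold N" "c \<in> points N"
  shows "smooth_map M N (\<lambda>x. c)"
  unfolding smooth_map_iff[OF assms(1,2)]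
proof
  fix x assume "x \<in> points M"
  then obtain U \<phi> where U: "(U, \<phi>) \<in> maximal_atlas M" "x \<in> U" using maximal_atlas_cover[OF assms(1)] by metis
  obtain V \<psi> where V: "(V, \<psi>) \<in> maximal_atlas N" "c \<in> V" using maximal_atlas_cover[OF assms(2,3)] by metis
  show "smooth_at M N (\<lambda>x. c) x"
    using U V by (intro smooth_atI[of U \<phi> M V \<psi>]) (auto intro: smooth_wrt_const)
qed

section \<open>Products, submanifolds and transport of structure\<close>

lemma openin_prod_topologyE:
  assumes "openin (prod_topology X Y) S" "(x, y) \<in> S"
  obtains U V where "openin X U" "openin Y V" "x \<in> U" "y \<in> V" "U \<times> V \<subseteq> S"
proof -
  have "\<exists>U V. openin X U \<and> openin Y V \<and> x \<in> U \<and> y \<in> V \<and> U \<times> V \<subseteq> S"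
    using assms(1)[unfolded openin_prod_topology_alt, rule_format, OF assms(2)] .
  then show thesis by (elim exE conjE) (rule that)
qed

lemma second_countable_prod_topology:
  assumes "second_countable X" "second_countable Y"
  shows "second_countable (prod_topology X Y)"
proof -
  obtain A where A: "countable A" "\<And>V. V \<in> A \<Longrightarrow> openin X V"
    "\<And>U x. openin X U \<Longrightarrow> x \<in> U \<Longrightarrow> \<exists>V\<in>A. x \<in> V \<and> V \<subseteq> U"
    using assms(1) unfolding second_countable_def by (metis (no_types, lifting))
  obtain B where B: "countable B" "\<And>V. V \<in> B \<Longrightarrow> openin Y V"
    "\<And>U x. openin Y U \<Longrightarrow> x \<in> U \<Longrightarrow> \<exists>V\<in>B. x \<in> V \<and> V \<subseteq> U"
    using assms(2) unfolding second_countable_def by (metis (no_types, lifting))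
  let ?C = "(\<lambda>(U, V). U \<times> V) ` (A \<times> B)"
  have "\<exists>V\<in>?C. z \<in> V \<and> V \<subseteq> S" if op: "openin (prod_topology X Y) S" and zS: "z \<in> S" for S z
  proof -
    obtain x y where z: "z = (x, y)" by (cases z)
    obtain U V where UV: "openin X U" "openin Y V" "x \<in> U" "y \<in> V" "U \<times> V \<subseteq> S"
      by (rule openin_prod_topologyE[OF op zS[unfolded z]])
    obtain U' V' where "U' \<in> A" "x \<in> U'" "U' \<subseteq> U" "V' \<in> B" "y \<in> V'" "V' \<subseteq> V"
      using A(3)[OF UV(1,3)] B(3)[OF UV(2,4)] by auto
    then show ?thesis using z UV(5) by (intro bexI[of _ "U' \<times> V'"]) auto
  qed
  moreover have "countable ?C" using A(1) B(1) by simp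
  moreover have "\<forall>V\<in>?C. openin (prod_topology X Y) V" using A(2) B(2) by (auto simp: openin_prod_Times_iff)
  ultimately show ?thesis
    unfolding second_countable_def by (intro exI[of _ ?C]) simp
qed

lemma is_chart_prod:
  assumes "is_chart X n (U, \<phi>)" "is_chart Y m (V, \<psi>)"
  shows "is_chart (prod_topology X Y) (n + m) (U \<times> V, map_prod \<phi> \<psi>)"
  unfolding is_chart_iff
proof (intro conjI allI impI)
  show "openin (prod_topology X Y) (U \<times> V)"
    using is_chart_openin[OF assms(1)] is_chart_openin[OF assms(2)] by (simp add: openin_prod_Times_iff)
  show "inj_on (map_prod \<phi> \<psi>) (U \<times> V)"
    using is_chart_inj[OF assms(1)] is_chart_inj[OF assms(2)] by (rule map_prod_inj_on)
  obtain W where W: "subspace W" "dim W = n" "openin (top_of_set W) (\<phi> ` U)"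
    using assms(1) unfolding is_chart_iff by blast
  obtain W' where W': "subspace W'" "dim W' = m" "openin (top_of_set W') (\<psi> ` V)"
    using assms(2) unfolding is_chart_iff by blast
  show "\<exists>W. subspace W \<and> dim W = n + m \<and> openin (top_of_set W) (map_prod \<phi> \<psi> ` (U \<times> V))"
    using W W' by (intro exI[of _ "W \<times> W'"]) (simp add: subspace_Times dim_Times openin_Times map_prod_surj_on[OF refl refl])
  fix T assume T: "T \<subseteq> U \<times> V"
  show "openin (prod_topology X Y) T \<longleftrightarrow> (\<exists>S. open S \<and> T = {x \<in> U \<times> V. map_prod \<phi> \<psi> x \<in> S})"
  proof (intro iffI; (elim exE conjE)?)
    assume op: "openin (prod_topology X Y) T"
    \<comment> \<open>All open boxes whose trace on the chart domain lies in \<open>T\<close> are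
      collected. Their union is the required open set, and no box has to be chosen for each
      point.\<close>
    define F where "F = {A \<times> B | A B. open A \<and> open B \<and> {x \<in> U. \<phi> x \<in> A} \<times> {y \<in> V. \<psi> y \<in> B} \<subseteq> T}"
    have "T \<subseteq> {x \<in> U \<times> V. map_prod \<phi> \<psi> x \<in> \<Union>F}"
    proof
      fix z assume z: "z \<in> T"
      obtain x y where xy: "z = (x, y)" by (cases z)
      obtain U' V' where UV: "openin X U'" "openin Y V'" "x \<in> U'" "y \<in> V'" "U' \<times> V' \<subseteq> T"
        by (rule openin_prod_topologyE[OF op z[unfolded xy]])
      obtain A where A: "open A" "U \<inter> U' = {x \<in> U. \<phi> x \<in> A}"
        using is_chart_openE[OF assms(1) openin_Int[OF is_chart_openin[OF assms(1)] UV(1)]] by auto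
      obtain B where B: "open B" "V \<inter> V' = {x \<in> V. \<psi> x \<in> B}"
        using is_chart_openE[OF assms(2) openin_Int[OF is_chart_openin[OF assms(2)] UV(2)]] by auto
      have "{x \<in> U. \<phi> x \<in> A} \<times> {y \<in> V. \<psi> y \<in> B} \<subseteq> T"
        unfolding A(2)[symmetric] B(2)[symmetric] using UV(5) by auto
      then have AB: "A \<times> B \<in> F"
        using A(1) B(1) unfolding F_def by (intro CollectI exI[of _ A] exI[of _ B] conjI) simp_all
      have mem: "x \<in> U" "y \<in> V" "\<phi> x \<in> A" "\<psi> y \<in> B" using A(2) B(2) UV(3,4) T z xy by auto
      then have "(\<phi> x, \<psi> y) \<in> \<Union>F" by (intro UnionI[OF AB]) simp
      then show "z \<in> {x \<in> U \<times> V. map_prod \<phi> \<psi> x \<in> \<Union>F}" using mem(1,2) unfolding xy by simp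
    qed
    moreover have "{x \<in> U \<times> V. map_prod \<phi> \<psi> x \<in> \<Union>F} \<subseteq> T" unfolding F_def by fastforce
    moreover have "open (\<Union>F)" unfolding F_def by (auto intro!: open_Union open_Times)
    ultimately show "\<exists>S. open S \<and> T = {x \<in> U \<times> V. map_prod \<phi> \<psi> x \<in> S}" by blast
  next
    fix S assume S: "open S" and Teq: "T = {x \<in> U \<times> V. map_prod \<phi> \<psi> x \<in> S}"
    show "openin (prod_topology X Y) T"
      unfolding openin_prod_topology_alt
    proof (intro allI impI)
      fix x y assume "(x, y) \<in> T"
      then have xy: "x \<in> U" "y \<in> V" "(\<phi> x, \<psi> y) \<in> S" unfolding Teq by auto
      obtain A B where AB: "open A" "open B" "\<phi> x \<in> A" "\<psi> y \<in> B" "A \<times> B \<subseteq> S"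
        using S xy(3) by (metis open_prod_elim mem_Sigma_iff)
      show "\<exists>U' V'. openin X U' \<and> openin Y V' \<and> x \<in> U' \<and> y \<in> V' \<and> U' \<times> V' \<subseteq> T"
        by (intro exI[of _ "{x \<in> U. \<phi> x \<in> A}"] exI[of _ "{y \<in> V. \<psi> y \<in> B}"] conjI
            is_chart_preimage[OF assms(1) AB(1)] is_chart_preimage[OF assms(2) AB(2)])
          (use xy AB Teq in auto)
    qed
  qed
qed

lemma prod_manifold_simps [simp]:
  "mtop (prod_manifold M N) = prod_topology (mtop M) (mtop N)"
  "mdim (prod_manifold M N) = mdim M + mdim N"
  by (simp_all add: prod_manifold_def)

lemma prod_manifold_charts:
  "(U, \<phi>) \<in> charts M \<Longrightarrow> (V, \<psi>) \<in> charts N \<Longrightarrow> (U \<times> V, map_prod \<phi> \<psi>) \<in> charts (prod_manifold M N)"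
  by (auto simp: prod_manifold_def)

lemma prod_manifold_chartsE:
  assumes "c \<in> charts (prod_manifold M N)"
  obtains U \<phi> V \<psi> where "(U, \<phi>) \<in> charts M" "(V, \<psi>) \<in> charts N" "c = (U \<times> V, map_prod \<phi> \<psi>)"
  using assms by (auto simp: prod_manifold_def)

lemma smooth_manifold_prod:
  assumes M: "smooth_manifold M" and N: "smooth_manifold N"
  shows "smooth_manifold (prod_manifold M N)"
  unfolding smooth_manifold_def prod_manifold_simps
proof (intro conjI ballI)
  show "Hausdorff_space (prod_topology (mtop M) (mtop N))"
    using M N by (simp add: smooth_manifold_def Hausdorff_space_prod_topology)
  show "second_countable (prod_topology (mtop M) (mtop N))"
    using M N by (simp add: smooth_manifold_def second_countable_prod_topology)
  show ch: "is_chart (prod_topology (mtop M) (mtop N)) (mdim M + mdim N) c"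
    if c: "c \<in> charts (prod_manifold M N)" for c
  proof -
    obtain U \<phi> V \<psi> where "(U, \<phi>) \<in> charts M" "(V, \<psi>) \<in> charts N" "c = (U \<times> V, map_prod \<phi> \<psi>)"
      using prod_manifold_chartsE[OF c] .
    then show ?thesis
      using is_chart_prod[OF charts_is_chart[OF M] charts_is_chart[OF N]] by simp
  qed
  show "\<Union> (fst ` charts (prod_manifold M N)) = topspace (prod_topology (mtop M) (mtop N))"
  proof (rule equalityI)
    show "\<Union> (fst ` charts (prod_manifold M N)) \<subseteq> topspace (prod_topology (mtop M) (mtop N))"
    proof (rule Union_least, elim imageE)
      fix X c assume c: "X = fst c" "c \<in> charts (prod_manifold M N)"
      have "is_chart (prod_topology (mtop M) (mtop N)) (mdim M + mdim N) (fst c, snd c)" using ch[OF c(2)] by simp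
      then show "X \<subseteq> topspace (prod_topology (mtop M) (mtop N))"
        using is_chart_openin openin_subset c(1) by metis
    qed
    show "topspace (prod_topology (mtop M) (mtop N)) \<subseteq> \<Union> (fst ` charts (prod_manifold M N))"
    proof
      fix z assume "z \<in> topspace (prod_topology (mtop M) (mtop N))"
      then obtain x y where z: "z = (x, y)" "x \<in> points M" "y \<in> points N" by auto
      obtain U \<phi> where U: "(U, \<phi>) \<in> charts M" "x \<in> U" using charts_cover[OF M z(2)] .
      obtain V \<psi> where V: "(V, \<psi>) \<in> charts N" "y \<in> V" using charts_cover[OF N z(3)] .
      show "z \<in> \<Union> (fst ` charts (prod_manifold M N))"
        using prod_manifold_charts[OF U(1) V(1)] U(2) V(2) z(1) by force
    qed
  qed
  fix c c' assume c: "c \<in> charts (prod_manifold M N)" and c': "c' \<in> charts (prod_manifold M N)"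
  obtain U \<phi> V \<psi> where 1: "(U, \<phi>) \<in> charts M" "(V, \<psi>) \<in> charts N" "c = (U \<times> V, map_prod \<phi> \<psi>)"
    using prod_manifold_chartsE[OF c] .
  obtain U' \<phi>' V' \<psi>' where 2: "(U', \<phi>') \<in> charts M" "(V', \<psi>') \<in> charts N" "c' = (U' \<times> V', map_prod \<phi>' \<psi>')"
    using prod_manifold_chartsE[OF c'] .
  have max: "(U, \<phi>) \<in> maximal_atlas M" "(U', \<phi>') \<in> maximal_atlas M"
    "(V, \<psi>) \<in> maximal_atlas N" "(V', \<psi>') \<in> maximal_atlas N"
    using 1 2 charts_subset_maximal_atlas[OF M] charts_subset_maximal_atlas[OF N] by auto
  have inj: "inj_on (map_prod \<phi> \<psi>) (U \<times> V)" "inj_on (map_prod \<phi>' \<psi>') (U' \<times> V')"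
    using ch[OF c] ch[OF c'] is_chart_inj unfolding 1 2 by auto
  have "smooth_wrt (map_prod \<phi> \<psi>) ((U \<times> V) \<inter> (U' \<times> V')) (map_prod \<phi>' \<psi>')"
    "smooth_wrt (map_prod \<phi>' \<psi>') ((U' \<times> V') \<inter> (U \<times> V)) (map_prod \<phi> \<psi>)"
    unfolding Times_Int_Times
    by (intro smooth_wrt_map_prod maximal_atlas_compat[OF M] maximal_atlas_compat[OF N] max)+
  then show "compatible c c'"
    unfolding 1 2 compatible_iff[OF inj] by (simp add: Int_commute)
qed

lemma smooth_at_Pair:
  assumes M: "smooth_manifold M" and N: "smooth_manifold N" "smooth_manifold N'"
    and f: "smooth_at M N f x" and g: "smooth_at M N' g x"
  shows "smooth_at M (prod_manifold N N') (\<lambda>x. (f x, g x)) x"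
proof -
  obtain U \<phi> S \<alpha> where U: "(U, \<phi>) \<in> maximal_atlas M" "x \<in> U" "(S, \<alpha>) \<in> maximal_atlas N" "f ` U \<subseteq> S"
    using smooth_atE[OF f] by metis
  then have "f x \<in> points N" using maximal_atlas_subset by blast
  then obtain V \<psi> where V: "(V, \<psi>) \<in> charts N" "f x \<in> V" using charts_cover[OF N(1)] by metis
  obtain T \<tau> S' \<alpha>' where T: "(T, \<tau>) \<in> maximal_atlas M" "x \<in> T" "(S', \<alpha>') \<in> maximal_atlas N'" "g ` T \<subseteq> S'"
    using smooth_atE[OF g] by metis
  then have "g x \<in> points N'" using maximal_atlas_subset by blast
  then obtain V' \<psi>' where V': "(V', \<psi>') \<in> charts N'" "g x \<in> V'" using charts_cover[OF N(2)] by metis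
  have max: "(V, \<psi>) \<in> maximal_atlas N" "(V', \<psi>') \<in> maximal_atlas N'"
    using V V' charts_subset_maximal_atlas N by auto
  obtain A where A: "openin (mtop M) A" "x \<in> A" "A \<subseteq> U" "f ` A \<subseteq> V" "smooth_wrt \<phi> A (\<lambda>y. \<psi> (f y))"
    using smooth_at_charts[OF M N(1) f U(1) max(1) U(2) V(2)] by metis
  obtain A' where A': "openin (mtop M) A'" "x \<in> A'" "A' \<subseteq> U" "g ` A' \<subseteq> V'" "smooth_wrt \<phi> A' (\<lambda>y. \<psi>' (g y))"
    using smooth_at_charts[OF M N(2) g U(1) max(2) U(2) V'(2)] by metis
  show ?thesis
  proof (rule smooth_atI)
    show "(A \<inter> A', \<phi>) \<in> maximal_atlas M"
      by (rule maximal_atlas_restrict[OF M U(1)]) (use A A' in auto)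
    show "(V \<times> V', map_prod \<psi> \<psi>') \<in> maximal_atlas (prod_manifold N N')"
      using prod_manifold_charts[OF V(1) V'(1)] charts_subset_maximal_atlas[OF smooth_manifold_prod[OF N]] by auto
    show "smooth_wrt \<phi> (A \<inter> A') (\<lambda>y. map_prod \<psi> \<psi>' (f y, g y))"
      unfolding map_prod_simp
      by (intro smooth_wrt_Pair smooth_wrt_subset[OF A(5)] smooth_wrt_subset[OF A'(5)]) auto
  qed (use A A' in auto)
qed

lemma smooth_map_Pair:
  assumes "smooth_manifold M" "smooth_manifold N" "smooth_manifold N'" "smooth_map M N f" "smooth_map M N' g"
  shows "smooth_map M (prod_manifold N N') (\<lambda>x. (f x, g x))"
  using assms(4,5) smooth_at_Pair[OF assms(1-3)]
  by (simp add: smooth_map_iff smooth_manifold_prod assms(1-3))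

lemma smooth_map_fst:
  assumes M: "smooth_manifold M" and N: "smooth_manifold N"
  shows "smooth_map (prod_manifold M N) M fst"
  unfolding smooth_map_iff[OF smooth_manifold_prod[OF M N] M]
proof
  fix z assume "z \<in> points (prod_manifold M N)"
  then obtain x y where z: "z = (x, y)" "x \<in> points M" "y \<in> points N" by auto
  obtain U \<phi> where U: "(U, \<phi>) \<in> charts M" "x \<in> U" using charts_cover[OF M z(2)] .
  obtain V \<psi> where V: "(V, \<psi>) \<in> charts N" "y \<in> V" using charts_cover[OF N z(3)] .
  show "smooth_at (prod_manifold M N) M fst z"
  proof (rule smooth_atI)
    show "(U \<times> V, map_prod \<phi> \<psi>) \<in> maximal_atlas (prod_manifold M N)" "(U, \<phi>) \<in> maximal_atlas M"
      using prod_manifold_charts[OF U(1) V(1)] U(1) charts_subset_maximal_atlas[OF smooth_manifold_prod[OF M N]]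
        charts_subset_maximal_atlas[OF M] by auto
    show "smooth_wrt (map_prod \<phi> \<psi>) (U \<times> V) (\<lambda>y. \<phi> (fst y))"
      using smooth_wrt_linear[OF bounded_linear_fst smooth_wrt_self[of "map_prod \<phi> \<psi>"]] by simp
  qed (use U V z in auto)
qed

lemma smooth_map_snd:
  assumes M: "smooth_manifold M" and N: "smooth_manifold N"
  shows "smooth_map (prod_manifold M N) N snd"
  unfolding smooth_map_iff[OF smooth_manifold_prod[OF M N] N]
proof
  fix z assume "z \<in> points (prod_manifold M N)"
  then obtain x y where z: "z = (x, y)" "x \<in> points M" "y \<in> points N" by auto
  obtain U \<phi> where U: "(U, \<phi>) \<in> charts M" "x \<in> U" using charts_cover[OF M z(2)] .
  obtain V \<psi> where V: "(V, \<psi>) \<in> charts N" "y \<in> V" using charts_cover[OF N z(3)] .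
  show "smooth_at (prod_manifold M N) N snd z"
  proof (rule smooth_atI)
    show "(U \<times> V, map_prod \<phi> \<psi>) \<in> maximal_atlas (prod_manifold M N)" "(V, \<psi>) \<in> maximal_atlas N"
      using prod_manifold_charts[OF U(1) V(1)] V(1) charts_subset_maximal_atlas[OF smooth_manifold_prod[OF M N]]
        charts_subset_maximal_atlas[OF N] by auto
    show "smooth_wrt (map_prod \<phi> \<psi>) (U \<times> V) (\<lambda>y. \<psi> (snd y))"
      using smooth_wrt_linear[OF bounded_linear_snd smooth_wrt_self[of "map_prod \<phi> \<psi>"]] by simp
  qed (use U V z in auto)
qed

section \<open>Embedded submanifolds\<close>

lemma submanifold_simps [simp]:
  "mtop (submanifold M S k) = subtopology (mtop M) S"
  "mdim (submanifold M S k) = k"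
  by (simp_all add: submanifold_def)

lemma submanifold_chartsE:
  assumes "c \<in> charts (submanifold M S k)"
  obtains U \<phi> W where "(U, \<phi>) \<in> maximal_atlas M" "c = (U \<inter> S, \<phi>)"
    "subspace W" "dim W = k" "W \<subseteq> span (\<phi> ` U)" "\<phi> ` (U \<inter> S) = \<phi> ` U \<inter> W"
  using assms unfolding submanifold_def by (auto split: prod.splits)

lemma embedded_submanifold_points:
  "embedded_submanifold M S k \<Longrightarrow> points (submanifold M S k) = S"
  by (auto simp: embedded_submanifold_def)

lemma submanifold_is_chart:
  assumes "is_chart X n (U, \<phi>)" "subspace W" "W \<subseteq> span (\<phi> ` U)" "\<phi> ` (U \<inter> S) = \<phi> ` U \<inter> W"
  shows "is_chart (subtopology X S) (dim W) (U \<inter> S, \<phi>)"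
  unfolding is_chart_iff
proof (intro conjI allI impI)
  show "openin (subtopology X S) (U \<inter> S)"
    using is_chart_openin[OF assms(1)] openin_subtopology by blast
  show "inj_on \<phi> (U \<inter> S)"
    using is_chart_inj[OF assms(1)] inj_on_subset by blast
  have "openin (top_of_set W) (\<phi> ` (U \<inter> S))"
  proof (cases "U = {}")
    case False
    obtain O' where O: "open O'" "\<phi> ` U = span (\<phi> ` U) \<inter> O'"
      using is_chart_subspace(2)[OF assms(1) False] unfolding openin_open by blast
    have "\<phi> ` (U \<inter> S) = W \<inter> O'" using assms(3,4) O(2) by blast
    then show ?thesis using O(1) by (simp add: openin_open_Int)
  qed simp
  then show "\<exists>W'. subspace W' \<and> dim W' = dim W \<and> openin (top_of_set W') (\<phi> ` (U \<inter> S))"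
    using assms(2) by blast
  fix T assume T: "T \<subseteq> U \<inter> S"
  show "openin (subtopology X S) T \<longleftrightarrow> (\<exists>V. open V \<and> T = {x \<in> U \<inter> S. \<phi> x \<in> V})"
  proof
    assume "openin (subtopology X S) T"
    then obtain T' where T': "openin X T'" "T = T' \<inter> S" unfolding openin_subtopology by blast
    obtain V where "open V" "U \<inter> T' = {x \<in> U. \<phi> x \<in> V}"
      using is_chart_openE[OF assms(1) openin_Int[OF is_chart_openin[OF assms(1)] T'(1)]] by auto
    then show "\<exists>V. open V \<and> T = {x \<in> U \<inter> S. \<phi> x \<in> V}"
      using T T'(2) by (intro exI[of _ V]) auto
  next
    assume "\<exists>V. open V \<and> T = {x \<in> U \<inter> S. \<phi> x \<in> V}"
    then obtain V where V: "open V" "T = {x \<in> U \<inter> S. \<phi> x \<in> V}" by blast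
    then show "openin (subtopology X S) T"
      unfolding openin_subtopology
      by (intro exI[of _ "{x \<in> U. \<phi> x \<in> V}"] conjI is_chart_preimage[OF assms(1)]) auto
  qed
qed

lemma smooth_manifold_submanifold:
  assumes M: "smooth_manifold M" and S: "embedded_submanifold M S k"
  shows "smooth_manifold (submanifold M S k)"
  unfolding smooth_manifold_def submanifold_simps
proof (intro conjI ballI)
  show "Hausdorff_space (subtopology (mtop M) S)" "second_countable (subtopology (mtop M) S)"
    using M by (simp_all add: smooth_manifold_def Hausdorff_space_subtopology second_countable_subtopology)
  show ch: "is_chart (subtopology (mtop M) S) k c" if "c \<in> charts (submanifold M S k)" for c
    using submanifold_chartsE[OF that] submanifold_is_chart maximal_atlas_is_chart by metis
  show "\<Union> (fst ` charts (submanifold M S k)) = topspace (subtopology (mtop M) S)"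
    using S by (auto simp: embedded_submanifold_def)
  fix c c' assume c: "c \<in> charts (submanifold M S k)" and c': "c' \<in> charts (submanifold M S k)"
  obtain U \<phi> where 1: "(U, \<phi>) \<in> maximal_atlas M" "c = (U \<inter> S, \<phi>)" using submanifold_chartsE[OF c] by metis
  obtain V \<psi> where 2: "(V, \<psi>) \<in> maximal_atlas M" "c' = (V \<inter> S, \<psi>)" using submanifold_chartsE[OF c'] by metis
  have inj: "inj_on \<phi> (U \<inter> S)" "inj_on \<psi> (V \<inter> S)"
    using ch[OF c] ch[OF c'] is_chart_inj unfolding 1 2 by auto
  have "smooth_wrt \<phi> (U \<inter> S \<inter> (V \<inter> S)) \<psi>" "smooth_wrt \<psi> (U \<inter> S \<inter> (V \<inter> S)) \<phi>"
    by (rule smooth_wrt_subset[OF maximal_atlas_compat[OF M 1(1) 2(1)]], force)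
       (rule smooth_wrt_subset[OF maximal_atlas_compat[OF M 2(1) 1(1)]], force)
  then show "compatible c c'"
    unfolding 1 2 compatible_iff[OF inj] by simp
qed

lemma smooth_map_submanifold_incl:
  assumes M: "smooth_manifold M" and S: "embedded_submanifold M S k"
  shows "smooth_map (submanifold M S k) M (\<lambda>x. x)"
  unfolding smooth_map_iff[OF smooth_manifold_submanifold[OF M S] M]
proof
  fix x assume "x \<in> points (submanifold M S k)"
  then obtain c where c: "c \<in> charts (submanifold M S k)" "x \<in> fst c"
    using charts_cover[OF smooth_manifold_submanifold[OF M S]] by (metis fst_conv)
  obtain U \<phi> where U: "(U, \<phi>) \<in> maximal_atlas M" "c = (U \<inter> S, \<phi>)" using submanifold_chartsE[OF c(1)] by metis
  show "smooth_at (submanifold M S k) M (\<lambda>x. x) x"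
    using U c charts_subset_maximal_atlas[OF smooth_manifold_submanifold[OF M S]]
    by (intro smooth_atI[of "U \<inter> S" \<phi> _ U \<phi>]) (auto intro: smooth_wrt_self)
qed

text \<open>Slice charts are restrictions of charts of \<open>M\<close>, so a coordinate expression
  of \<open>f\<close> as a map into \<open>M\<close> is at the same time one as a map into the
  submanifold.\<close>

lemma smooth_at_into_submanifold:
  assumes N: "smooth_manifold N" and M: "smooth_manifold M" and S: "embedded_submanifold M S k"
    and f: "smooth_at N M f x" and T: "openin (mtop N) T" "x \<in> T" "f ` T \<subseteq> S"
  shows "smooth_at N (submanifold M S k) f x"
proof -
  have "f x \<in> points (submanifold M S k)"
    using T embedded_submanifold_points[OF S] by auto
  then obtain c where c: "c \<in> charts (submanifold M S k)" "f x \<in> fst c"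
    using charts_cover[OF smooth_manifold_submanifold[OF M S]] by (metis fst_conv)
  obtain V \<psi> where V: "(V, \<psi>) \<in> maximal_atlas M" "c = (V \<inter> S, \<psi>)" using submanifold_chartsE[OF c(1)] by metis
  obtain U \<phi> where U: "(U, \<phi>) \<in> maximal_atlas N" "x \<in> U" using smooth_atE[OF f] by metis
  obtain U' where U': "openin (mtop N) U'" "x \<in> U'" "U' \<subseteq> U" "f ` U' \<subseteq> V" "smooth_wrt \<phi> U' (\<lambda>y. \<psi> (f y))"
    using smooth_at_charts[OF N M f U(1) V(1) U(2)] c(2) V(2) by (metis IntE fst_conv)
  show ?thesis
  proof (rule smooth_atI)
    show "(U' \<inter> T, \<phi>) \<in> maximal_atlas N"
      by (rule maximal_atlas_restrict[OF N U(1)]) (use U' T in auto)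
    show "(V \<inter> S, \<psi>) \<in> maximal_atlas (submanifold M S k)"
      using c(1) V(2) charts_subset_maximal_atlas[OF smooth_manifold_submanifold[OF M S]] by auto
    show "smooth_wrt \<phi> (U' \<inter> T) (\<lambda>y. \<psi> (f y))" by (rule smooth_wrt_subset[OF U'(5)]) auto
  qed (use U' T in auto)
qed

lemma smooth_map_into_submanifold:
  assumes N: "smooth_manifold N" and M: "smooth_manifold M" and S: "embedded_submanifold M S k"
    and f: "smooth_map N M f" "f ` points N \<subseteq> S"
  shows "smooth_map N (submanifold M S k) f"
  using f smooth_at_into_submanifold[OF N M S, of f _ "points N"]
  by (simp add: smooth_map_iff smooth_manifold_submanifold M N S)

lemma smooth_map_restrict:
  assumes "smooth_manifold M" "smooth_manifold N" "embedded_submanifold M S k" "smooth_map M N f"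
  shows "smooth_map (submanifold M S k) N f"
  using smooth_map_compose[OF smooth_manifold_submanifold[OF assms(1,3)] assms(1,2)
      smooth_map_submanifold_incl[OF assms(1,3)] assms(4)] .

text \<open>The structure on \<open>A\<close> that turns a bijection \<open>F\<close> onto
  \<open>N\<close> into a diffeomorphism. It supplies the orbit space of a groupoid action, whose
  points are sets, once the orbits are known to correspond to the points of the base.\<close>

definition transport_manifold :: "'b set \<Rightarrow> ('b \<Rightarrow> 'a) \<Rightarrow> ('a, 'e::euclidean_space) manifold \<Rightarrow> ('b, 'e) manifold" where
  "transport_manifold A F N = \<lparr>mtop = pullback_topology A F (mtop N), mdim = mdim N,
     charts = {(F -` U \<inter> A, \<phi> \<circ> F) | U \<phi>. (U, \<phi>) \<in> charts N}\<rparr>"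

text \<open>In the charts \<open>\<phi> \<circ> F\<close> and \<open>\<phi>\<close> the coordinate
  expression of \<open>F\<close> is the identity, and so is that of its inverse.\<close>

lemma transport_manifold:
  assumes N: "smooth_manifold N" and F: "bij_betw F A (points N)"
  shows "points (transport_manifold A F N) = A"
    and "smooth_manifold (transport_manifold A F N)"
    and "diffeomorphism (transport_manifold A F N) N F"
proof -
  let ?M = "transport_manifold A F N"
  let ?X = "pullback_topology A F (mtop N)"
  have mtop: "mtop ?M = ?X" and mdim: "mdim ?M = mdim N" by (simp_all add: transport_manifold_def)
  have inj: "inj_on F A" and FA: "F ` A = points N" using F by (auto simp: bij_betw_def)
  show pts: "points ?M = A"
    unfolding mtop topspace_pullback_topology using FA by auto
  have top: "topspace ?X = A" using pts mtop by simp
  have surj: "F ` (F -` V \<inter> A) = V" if "V \<subseteq> points N" for V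
    using that unfolding FA[symmetric] by blast
  have "homeomorphic_map ?X (mtop N) F"
    unfolding homeomorphic_map_def quotient_map_def top
  proof (intro conjI allI impI FA inj)
    fix V assume V: "V \<subseteq> points N"
    have eq: "{x \<in> A. F x \<in> V} = F -` V \<inter> A" by auto
    show "openin ?X {x \<in> A. F x \<in> V} \<longleftrightarrow> openin (mtop N) V"
      unfolding openin_pullback_topology eq
      by (metis V openin_subset surj)
  qed
  then have hom: "?X homeomorphic_space mtop N"
    using homeomorphic_map_imp_homeomorphic_space by blast
  have ch: "is_chart ?X (mdim N) (F -` U \<inter> A, \<phi> \<circ> F)" if U: "(U, \<phi>) \<in> charts N" for U \<phi>
    unfolding is_chart_iff
  proof (intro conjI allI impI)
    have c: "is_chart (mtop N) (mdim N) (U, \<phi>)" using charts_is_chart[OF N U] .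
    have sub: "U \<subseteq> points N" using is_chart_openin[OF c] openin_subset by blast
    show "openin ?X (F -` U \<inter> A)"
      unfolding openin_pullback_topology using is_chart_openin[OF c] by blast
    show "inj_on (\<phi> \<circ> F) (F -` U \<inter> A)"
      using is_chart_inj[OF c] inj by (auto simp: inj_on_def)
    have "(\<phi> \<circ> F) ` (F -` U \<inter> A) = \<phi> ` U" using surj[OF sub] by (metis image_comp)
    then show "\<exists>W. subspace W \<and> dim W = mdim N \<and> openin (top_of_set W) ((\<phi> \<circ> F) ` (F -` U \<inter> A))"
      using c unfolding is_chart_iff by simp
    fix T assume T: "T \<subseteq> F -` U \<inter> A"
    show "openin ?X T \<longleftrightarrow> (\<exists>V. open V \<and> T = {x \<in> F -` U \<inter> A. (\<phi> \<circ> F) x \<in> V})"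
    proof
      assume "openin ?X T"
      then obtain S where S: "openin (mtop N) S" "T = F -` S \<inter> A" unfolding openin_pullback_topology by blast
      obtain V where "open V" "U \<inter> S = {x \<in> U. \<phi> x \<in> V}"
        using is_chart_openE[OF c openin_Int[OF is_chart_openin[OF c] S(1)]] by auto
      then show "\<exists>V. open V \<and> T = {x \<in> F -` U \<inter> A. (\<phi> \<circ> F) x \<in> V}"
        using S(2) T by (intro exI[of _ V]) auto
    next
      assume "\<exists>V. open V \<and> T = {x \<in> F -` U \<inter> A. (\<phi> \<circ> F) x \<in> V}"
      then obtain V where V: "open V" "T = {x \<in> F -` U \<inter> A. (\<phi> \<circ> F) x \<in> V}" by blast
      have "T = F -` {x \<in> U. \<phi> x \<in> V} \<inter> A" using V(2) by auto
      then show "openin ?X T"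
        unfolding openin_pullback_topology using is_chart_preimage[OF c V(1)] by blast
    qed
  qed
  have chs: "charts ?M = {(F -` U \<inter> A, \<phi> \<circ> F) | U \<phi>. (U, \<phi>) \<in> charts N}"
    by (simp add: transport_manifold_def)
  show M: "smooth_manifold ?M"
    unfolding smooth_manifold_def mtop mdim
  proof (intro conjI ballI)
    show "Hausdorff_space ?X" "second_countable ?X"
      using N homeomorphic_Hausdorff_space[OF hom] homeomorphic_space_second_countability[OF hom]
      by (auto simp: smooth_manifold_def)
    show "is_chart ?X (mdim N) c" if "c \<in> charts ?M" for c
      using that ch unfolding chs by auto
    show "\<Union> (fst ` charts ?M) = topspace ?X"
    proof -
      have "\<Union> (fst ` charts ?M) = F -` (\<Union> (fst ` charts N)) \<inter> A" unfolding chs by force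
      also have "\<dots> = A" using N FA unfolding smooth_manifold_def by auto
      finally show ?thesis using top by simp
    qed
    fix c c' assume "c \<in> charts ?M" "c' \<in> charts ?M"
    then obtain U \<phi> V \<psi> where 1: "(U, \<phi>) \<in> charts N" "(V, \<psi>) \<in> charts N"
      "c = (F -` U \<inter> A, \<phi> \<circ> F)" "c' = (F -` V \<inter> A, \<psi> \<circ> F)" unfolding chs by auto
    have max: "(U, \<phi>) \<in> maximal_atlas N" "(V, \<psi>) \<in> maximal_atlas N"
      using 1 charts_subset_maximal_atlas[OF N] by auto
    let ?I = "F -` U \<inter> A \<inter> (F -` V \<inter> A)"
    have "smooth_wrt (\<phi> \<circ> F) ?I (\<lambda>x. \<psi> (F x))"
      by (rule smooth_wrt_compose[OF _ maximal_atlas_compat[OF N max], of "\<phi> \<circ> F" _ F])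
        (use smooth_wrt_self[of "\<phi> \<circ> F"] in \<open>auto simp: o_def\<close>)
    moreover have "smooth_wrt (\<psi> \<circ> F) ?I (\<lambda>x. \<phi> (F x))"
      by (rule smooth_wrt_compose[OF _ maximal_atlas_compat[OF N max(2,1)], of "\<psi> \<circ> F" _ F])
        (use smooth_wrt_self[of "\<psi> \<circ> F"] in \<open>auto simp: o_def\<close>)
    ultimately show "compatible c c'"
      using compatible_iff[OF is_chart_inj[OF ch[OF 1(1)]] is_chart_inj[OF ch[OF 1(2)]]] 1 by (simp add: o_def)
  qed
  have inv: "inv_into A F y \<in> A" "F (inv_into A F y) = y" if "y \<in> points N" for y
    using that FA by (auto intro: inv_into_into f_inv_into_f)
  show "diffeomorphism ?M N F"
    unfolding diffeomorphism_def pts smooth_map_iff[OF M N] smooth_map_iff[OF N M]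
  proof (intro conjI ballI F)
    fix x assume x: "x \<in> A"
    then obtain U \<phi> where U: "(U, \<phi>) \<in> charts N" "F x \<in> U" using charts_cover[OF N] FA by blast
    show "smooth_at ?M N F x"
    proof (rule smooth_atI)
      show "(F -` U \<inter> A, \<phi> \<circ> F) \<in> maximal_atlas ?M"
        using charts_subset_maximal_atlas[OF M] U chs by auto
      show "(U, \<phi>) \<in> maximal_atlas N" using charts_subset_maximal_atlas[OF N] U by auto
      show "smooth_wrt (\<phi> \<circ> F) (F -` U \<inter> A) (\<lambda>y. \<phi> (F y))"
        using smooth_wrt_self[of "\<phi> \<circ> F"] by (simp add: o_def)
    qed (use x U in auto)
  next
    fix y assume y: "y \<in> points N"
    then obtain U \<phi> where U: "(U, \<phi>) \<in> charts N" "y \<in> U" using charts_cover[OF N] by metis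
    have sub: "U \<subseteq> points N" using is_chart_openin[OF charts_is_chart[OF N U(1)]] openin_subset by blast
    show "smooth_at N ?M (inv_into A F) y"
    proof (rule smooth_atI)
      show "(F -` U \<inter> A, \<phi> \<circ> F) \<in> maximal_atlas ?M"
        using charts_subset_maximal_atlas[OF M] U chs by auto
      show "(U, \<phi>) \<in> maximal_atlas N" using charts_subset_maximal_atlas[OF N] U by auto
      show "smooth_wrt \<phi> U (\<lambda>y. (\<phi> \<circ> F) (inv_into A F y))"
        by (subst smooth_wrt_cong[of U _ \<phi>]) (use inv sub smooth_wrt_self[of \<phi> U] in auto)
    qed (use y U inv sub in auto)
  qed
qed

section \<open>Submersions and local sections\<close>

text \<open>For small \<open>t\<close> the line \<open>p + t w\<close> stays in \<open>S\<close>.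
  Along it both derivatives become derivatives of one function of a real variable at an interior
  point, where uniqueness holds.\<close>

lemma has_derivative_unique_on_subspace:
  assumes W: "subspace W" "openin (top_of_set W) S" "p \<in> S" "w \<in> W"
    and D: "(h has_derivative D) (at p within S)" and E: "(h has_derivative E) (at p within S)"
  shows "D w = E w"
proof -
  obtain O' where O: "open O'" "S = W \<inter> O'" using W(2) unfolding openin_open by blast
  have p: "p \<in> W" "p \<in> O'" using W(3) O(2) by auto
  define T where "T = {t::real. p + t *\<^sub>R w \<in> O'}"
  have "open T"
    using open_vimage[OF O(1), of "\<lambda>t::real. p + t *\<^sub>R w"] unfolding T_def vimage_def
    by (simp add: continuous_on_add continuous_on_scaleR)
  moreover have "0 \<in> T" using p by (simp add: T_def)
  ultimately have at: "at 0 within T = at 0" by (intro at_within_open)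
  have sub: "(\<lambda>t. p + t *\<^sub>R w) ` T \<subseteq> S"
    using W(1,4) p by (auto simp: T_def O(2) subspace_add subspace_scale)
  have lin: "((\<lambda>t. p + t *\<^sub>R w) has_derivative (\<lambda>t. t *\<^sub>R w)) (at 0 within T)"
    by (auto intro!: derivative_eq_intros)
  have *: "((\<lambda>t. h (p + t *\<^sub>R w)) has_derivative (\<lambda>t. F (t *\<^sub>R w))) (at 0)"
    if F: "(h has_derivative F) (at p within S)" for F
  proof -
    have "(h has_derivative F) (at (p + 0 *\<^sub>R w) within (\<lambda>t. p + t *\<^sub>R w) ` T)"
      using has_derivative_subset[OF F sub] by simp
    from has_derivative_in_compose[OF lin this] show ?thesis unfolding at .
  qed
  show ?thesis
    using fun_cong[OF has_derivative_unique[OF *[OF D] *[OF E]], of 1] by simp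
qed

lemma subspace_projection:
  fixes W :: "'a::euclidean_space set"
  assumes "subspace W"
  obtains P where "linear P" "range P \<subseteq> W" "\<And>w. w \<in> W \<Longrightarrow> P w = w"
proof -
  have "\<exists>g. range g \<subseteq> W \<and> linear g \<and> (\<forall>v\<in>W. g (id v) = v)"
    by (rule linear_exists_left_inverse_on[OF linear_id assms inj_on_id])
  then show thesis using that by auto
qed

text \<open>With a projection \<open>P\<close> onto \<open>W'\<close>, the functions
  \<open>h - c\<close> and \<open>P (h - c)\<close> agree on \<open>S\<close>. Their derivatives
  \<open>D\<close> and \<open>P D\<close> therefore agree on \<open>W\<close>, and the latter takes
  values in \<open>W'\<close>.\<close>

lemma has_derivative_into_subspace:
  fixes h :: "'a::euclidean_space \<Rightarrow> 'b::euclidean_space"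
  assumes W: "subspace W" "openin (top_of_set W) S" "p \<in> S"
    and D: "(h has_derivative D) (at p within S)"
    and W': "subspace W'" "\<And>x. x \<in> S \<Longrightarrow> h x - c \<in> W'"
  shows "D ` W \<subseteq> W'"
proof
  fix z assume "z \<in> D ` W"
  then obtain w where w: "w \<in> W" "z = D w" by auto
  obtain P where P: "linear P" "range P \<subseteq> W'" "\<And>w. w \<in> W' \<Longrightarrow> P w = w"
    using subspace_projection[OF W'(1)] by metis
  have hc: "((\<lambda>x. h x - c) has_derivative D) (at p within S)"
    using has_derivative_diff[OF D has_derivative_const[of c]] by simp
  have "((\<lambda>x. P (h x - c)) has_derivative (\<lambda>x. P (D x))) (at p within S)"
    by (rule bounded_linear.has_derivative[OF _ hc]) (use P(1) linear_conv_bounded_linear in blast)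
  then have "((\<lambda>x. h x - c) has_derivative (\<lambda>x. P (D x))) (at p within S)"
    by (rule has_derivative_transform[OF W(3), rotated]) (use W'(2) P(3) in auto)
  from has_derivative_unique_on_subspace[OF W w(1) hc this] show "z \<in> W'"
    using w(2) P(2) by auto
qed

lemma smooth_wrt_has_derivative:
  assumes "smooth_wrt \<phi> A h" "a \<in> A" "inj_on \<phi> U" "A \<subseteq> U"
  obtains D where "((h \<circ> inv_into U \<phi>) has_derivative D) (at (\<phi> a) within \<phi> ` A)"
proof -
  obtain V g where V: "open V" "\<phi> a \<in> V" "\<And>k. Ck_on k V g" "\<And>b. b \<in> A \<Longrightarrow> \<phi> b \<in> V \<Longrightarrow> g (\<phi> b) = h b"
    using smooth_wrtE[OF assms(1,2)] by metis
  have "(g has_derivative frechet_derivative g (at (\<phi> a))) (at (\<phi> a))"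
    by (rule Ck_on_Suc_has_derivative[OF V(3) V(2)])
  then have g: "(g has_derivative frechet_derivative g (at (\<phi> a))) (at (\<phi> a) within \<phi> ` A)"
    by (rule has_derivative_at_withinI)
  obtain e where e: "e > 0" "ball (\<phi> a) e \<subseteq> V" using V(1,2) openE by blast
  have "((h \<circ> inv_into U \<phi>) has_derivative frechet_derivative g (at (\<phi> a))) (at (\<phi> a) within \<phi> ` A)"
  proof (rule has_derivative_transform_within[OF g e(1)])
    show "\<phi> a \<in> \<phi> ` A" using assms(2) by simp
    fix x assume "x \<in> \<phi> ` A" "dist x (\<phi> a) < e"
    then obtain b where b: "b \<in> A" "x = \<phi> b" "\<phi> b \<in> V" using e(2) by (auto simp: dist_commute subset_iff)
    then show "g x = (h \<circ> inv_into U \<phi>) x" using V(4) assms(3,4) by (auto simp: subset_iff inv_into_f_f)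
  qed
  then show thesis by (rule that)
qed

text \<open>Shrinking a chart does not change its tangent space: both spans have the dimension of
  the manifold.\<close>

lemma is_chart_span_restrict:
  assumes "is_chart X n (U, \<phi>)" "openin X T" "T \<subseteq> U" "T \<noteq> {}"
  shows "span (\<phi> ` T) = span (\<phi> ` U)"
proof (rule subspace_dim_equal[OF subspace_span subspace_span])
  show "span (\<phi> ` T) \<subseteq> span (\<phi> ` U)" using assms(3) by (intro span_mono) auto
  show "dim (span (\<phi> ` U)) \<le> dim (span (\<phi> ` T))"
    using is_chart_subspace(1)[OF is_chart_restrict[OF assms(1-3)] assms(4)] is_chart_subspace(1)[OF assms(1)] assms(3,4)
    by fastforce
qed

text \<open>A smooth right inverse \<open>s\<close> forces the derivative to be onto, by the chain rule.\<close>

lemma derivative_onto: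
  assumes U: "is_chart X n (U, \<phi>)" and V: "is_chart Z m (V, \<psi>)"
    and F: "smooth_wrt \<phi> U F" "\<And>x. x \<in> U \<Longrightarrow> F x - c \<in> span (\<psi> ` V)"
    and s: "z0 \<in> V" "s ` V \<subseteq> U" "smooth_wrt \<psi> V (\<lambda>z. \<phi> (s z))" "\<And>z. z \<in> V \<Longrightarrow> F (s z) = \<psi> z - c'"
  obtains D where "((F \<circ> inv_into U \<phi>) has_derivative D) (at (\<phi> (s z0)) within \<phi> ` U)"
    "D ` span (\<phi> ` U) = span (\<psi> ` V)"
proof -
  have sz0: "s z0 \<in> U" using s by auto
  obtain D where D: "((F \<circ> inv_into U \<phi>) has_derivative D) (at (\<phi> (s z0)) within \<phi> ` U)"
    using smooth_wrt_has_derivative[OF F(1) sz0 is_chart_inj[OF U] order_refl] .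
  obtain E where E: "(((\<lambda>z. \<phi> (s z)) \<circ> inv_into V \<psi>) has_derivative E) (at (\<psi> z0) within \<psi> ` V)"
    using smooth_wrt_has_derivative[OF s(3,1) is_chart_inj[OF V] order_refl] .
  have Une: "U \<noteq> {}" and Vne: "V \<noteq> {}" using sz0 s(1) by auto
  note WU = is_chart_subspace(2)[OF U Une] and WV = is_chart_subspace(2)[OF V Vne]
  have invU: "inv_into U \<phi> (\<phi> x) = x" if "x \<in> U" for x using is_chart_inj[OF U] that by simp
  have invV: "inv_into V \<psi> (\<psi> x) = x" if "x \<in> V" for x using is_chart_inj[OF V] that by simp
  have "D ` span (\<phi> ` U) \<subseteq> span (\<psi> ` V)"
    by (rule has_derivative_into_subspace[OF subspace_span WU _ D subspace_span, of c])
       (use F(2) sz0 invU in auto)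
  moreover have "E ` span (\<psi> ` V) \<subseteq> span (\<phi> ` U)"
    by (rule has_derivative_into_subspace[OF subspace_span WV _ E subspace_span, of 0])
       (use s(1,2) invV in \<open>auto intro!: span_base\<close>)
  moreover have "D (E w) = w" if w: "w \<in> span (\<psi> ` V)" for w
  proof -
    have "((F \<circ> inv_into U \<phi>) has_derivative D)
      (at (((\<lambda>z. \<phi> (s z)) \<circ> inv_into V \<psi>) (\<psi> z0)) within ((\<lambda>z. \<phi> (s z)) \<circ> inv_into V \<psi>) ` \<psi> ` V)"
    proof -
      have "((\<lambda>z. \<phi> (s z)) \<circ> inv_into V \<psi>) (\<psi> z0) = \<phi> (s z0)" using invV s(1) by simp
      moreover have "((\<lambda>z. \<phi> (s z)) \<circ> inv_into V \<psi>) ` \<psi> ` V \<subseteq> \<phi> ` U" using invV s(2) by auto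
      ultimately show ?thesis using has_derivative_subset[OF D] by metis
    qed
    from has_derivative_in_compose[OF E this]
    have c: "((\<lambda>x. (F \<circ> inv_into U \<phi>) (((\<lambda>z. \<phi> (s z)) \<circ> inv_into V \<psi>) x)) has_derivative (\<lambda>x. D (E x)))
      (at (\<psi> z0) within \<psi> ` V)" .
    \<comment> \<open>Along \<open>s\<close> the map \<open>F\<close> is \<psi> up to the constant
      \<open>c'\<close>, which differentiation removes. The constant is there for fibre products,
      where \<open>F\<close> is a difference of two coordinate expressions and the second one is
      kept fixed.\<close>
    have 1: "((\<lambda>x. x - c') has_derivative (\<lambda>x. D (E x))) (at (\<psi> z0) within \<psi> ` V)"
    proof (rule has_derivative_transform[OF _ _ c])
      fix x assume "x \<in> \<psi> ` V"
      then obtain z where z: "z \<in> V" "x = \<psi> z" by auto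
      have "s z \<in> U" using z s(2) by auto
      then show "x - c' = (F \<circ> inv_into U \<phi>) (((\<lambda>z. \<phi> (s z)) \<circ> inv_into V \<psi>) x)"
        using z invU invV s(4) by simp
    qed (use s(1) in auto)
    have 2: "((\<lambda>x. x - c') has_derivative (\<lambda>x. x)) (at (\<psi> z0) within \<psi> ` V)"
      by (auto intro!: derivative_eq_intros)
    show ?thesis
      by (rule has_derivative_unique_on_subspace[OF subspace_span WV _ w 1 2]) (use s(1) in auto)
  qed
  ultimately have "D ` span (\<phi> ` U) = span (\<psi> ` V)"
    by (metis image_subset_iff subsetI subset_antisym image_eqI)
  with D show thesis by (rule that)
qed

text \<open>A map whose derivative \<open>A\<close> maps \<open>W\<close> onto \<open>A ` W\<close> becomes linear on \<open>W\<close> in the coordinates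
  \<open>\<theta> x = (x - p) + L (f x - f p - A (x - p))\<close>, where \<open>L\<close> is a right inverse of \<open>A\<close>. The projection
  \<open>P\<close> to \<open>W\<close> is inserted to obtain a local diffeomorphism of the whole space.\<close>

lemma straightening:
  fixes f :: "'e::euclidean_space \<Rightarrow> 'f::euclidean_space"
  assumes W: "subspace W" "p \<in> W" and O: "open O'" "p \<in> O'" and f: "\<And>k. Ck_on k O' f"
    and A: "(f has_derivative A) (at p)" and im: "\<And>x. x \<in> W \<inter> O' \<Longrightarrow> f x - f p \<in> A ` W"
  obtains N N' \<theta> \<theta>' L where "open N" "p \<in> N" "N \<inter> W \<subseteq> O'" "open N'" "homeomorphism N N' \<theta> \<theta>'"
    "\<And>k. Ck_on k N \<theta>" "\<And>k. Ck_on k N' \<theta>'" "\<theta> p = 0" "\<And>x. x \<in> N \<Longrightarrow> \<theta> x \<in> W \<longleftrightarrow> x \<in> W"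
    "\<And>x. x \<in> N \<inter> W \<Longrightarrow> A (\<theta> x) = f x - f p"
    "linear L" "range L \<subseteq> W" "\<And>z. z \<in> A ` W \<Longrightarrow> A (L z) = z"
proof -
  have linA: "linear A" using A has_derivative_linear by blast
  obtain P where P: "linear P" "range P \<subseteq> W" "\<And>w. w \<in> W \<Longrightarrow> P w = w"
    using subspace_projection[OF W(1)] by metis
  have "\<exists>L. range L \<subseteq> W \<and> linear L \<and> (\<forall>v\<in>A ` W. A (L v) = v)"
    by (rule linear_exists_right_inverse_on[OF linA W(1)])
  then obtain L where L: "linear L" "range L \<subseteq> W" "\<And>z. z \<in> A ` W \<Longrightarrow> A (L z) = z" by auto
  have bl: "bounded_linear A" "bounded_linear P" "bounded_linear L"
    using linA P(1) L(1) linear_conv_bounded_linear by auto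
  define \<theta> where "\<theta> x = (x - p) + L (f (P x) - f p - A (P (x - p)))" for x
  define O'' where "O'' = P -` O'"
  have O'': "open O''"
    unfolding O''_def using O(1) linear_continuous_on[OF bl(2), of UNIV] continuous_open_vimage
    by (metis continuous_on_eq_continuous_at open_UNIV iso_tuple_UNIV_I)
  have Pp: "P p = p" using P(3) W(2) by simp
  have pO: "p \<in> O''" using Pp O(2) by (simp add: O''_def)
  have id: "Ck_on k O'' (\<lambda>x. x)" for k by (rule Ck_on_bounded_linear[OF O'' bounded_linear_ident])
  have sm: "Ck_on k O'' \<theta>" for k
  proof -
    have fP: "Ck_on k O'' (\<lambda>x. f (P x))"
      by (rule Ck_on_compose[OF O'' O(1) _ Ck_on_bounded_linear[OF O'' bl(2)] f]) (auto simp: O''_def)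
    have xp: "Ck_on k O'' (\<lambda>x. x + - p)" by (rule Ck_on_add[OF O'' id Ck_on_const[OF O'']])
    have AP: "Ck_on k O'' (\<lambda>x. - A (P (x + - p)))"
      by (rule Ck_on_linear_compose[OF O'' bounded_linear_minus[OF bounded_linear_compose[OF bl(1,2)]] xp])
    have "Ck_on k O'' (\<lambda>x. (x + - p) + L ((f (P x) + - f p) + - A (P (x + - p))))"
      by (rule Ck_on_add[OF O'' xp Ck_on_linear_compose[OF O'' bl(3) Ck_on_add[OF O''
              Ck_on_add[OF O'' fP Ck_on_const[OF O'']] AP]]])
    then show ?thesis unfolding \<theta>_def by simp
  qed
  have fP': "((\<lambda>x. f (P x)) has_derivative (\<lambda>x. A (P x))) (at p)"
    by (rule has_derivative_compose[OF bounded_linear_imp_has_derivative[OF bl(2)]]) (use A Pp in simp)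
  have xp': "((\<lambda>x. x - p) has_derivative (\<lambda>x. x)) (at p)"
    by (auto intro!: derivative_eq_intros)
  \<comment> \<open>The first-order terms cancel in the argument of \<open>L\<close>, so the
    correction to \<open>x - p\<close> has derivative zero at \<open>p\<close> and
    \<open>\<theta>\<close> is tangent to the identity there.\<close>
  have "((\<lambda>x. f (P x) - f p - A (P (x - p))) has_derivative (\<lambda>x. A (P x) - 0 - A (P x))) (at p)"
    by (intro has_derivative_diff fP' has_derivative_const bounded_linear.has_derivative[OF bl(1)]
        bounded_linear.has_derivative[OF bl(2)] xp')
  from has_derivative_add[OF xp' bounded_linear.has_derivative[OF bl(3) this]]
  have der: "(\<theta> has_derivative (\<lambda>x. x)) (at p)"
    unfolding \<theta>_def using linear_0[OF L(1)] by simp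
  obtain N N' \<theta>' where N: "open N" "N \<subseteq> O''" "p \<in> N" "open N'" "homeomorphism N N' \<theta> \<theta>'" "\<And>k. Ck_on k N' \<theta>'"
    using smooth_inverse_function[OF O'' pO sm der] by metis
  show thesis
  proof (rule that[OF N(1,3) _ N(4,5) Ck_on_subset[OF sm N(2)] N(6) _ _ _ L])
    show "N \<inter> W \<subseteq> O'" using N(2) P(3) by (auto simp: O''_def)
    show "\<theta> p = 0" using Pp by (simp add: \<theta>_def linear_0[OF L(1)] linear_0[OF P(1)] linear_0[OF linA])
    \<comment> \<open>The difference of \<open>\<theta> x\<close> and \<open>x\<close> lies in
      \<open>W\<close>, since \<open>p\<close> and all values of \<open>L\<close> do; hence
      membership in \<open>W\<close> is preserved in both directions.\<close>
    show "\<theta> x \<in> W \<longleftrightarrow> x \<in> W" for x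
    proof -
      have *: "L z - p \<in> W" for z using L(2) W by (auto intro: subspace_diff)
      have "\<theta> x = x + (L (f (P x) - f p - A (P (x - p))) - p)" by (simp add: \<theta>_def)
      then show ?thesis using * W(1) by (metis add_diff_cancel_right' subspace_add subspace_diff)
    qed
    fix x assume x: "x \<in> N \<inter> W"
    then have PW: "P x = x" "P (x - p) = x - p" using P(3) W by (auto intro: subspace_diff)
    have xO: "x \<in> O'" using x N(2) PW(1) by (auto simp: O''_def)
    \<comment> \<open>On this vector \<open>A\<close> undoes \<open>L\<close>, so that
      \<open>A (\<theta> x) = A (x - p) + (f x - f p - A (x - p))\<close>, where the linear terms
      cancel.\<close>
    have "f x - f p - A (x - p) \<in> A ` W"
      by (rule subspace_diff[OF linear_subspace_image[OF linA W(1)] im imageI[OF subspace_diff[OF W(1)]]])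
         (use x xO W in auto)
    then show "A (\<theta> x) = f x - f p"
      unfolding \<theta>_def PW using L(3) linA by (simp add: linear_add)
  qed
qed

text \<open>The coordinate expression of \<open>F\<close> is extended to a smooth map on an open set
  of the ambient space and straightened there. As the straightening \<open>\<theta>\<close>
  preserves the model subspace, \<open>\<theta> \<circ> \<phi>\<close> is again a chart with the
  same span, and it is centred at \<open>x0\<close>.\<close>

lemma straightened_chart:
  assumes M: "smooth_manifold M" and U: "(U, \<phi>) \<in> maximal_atlas M" "x0 \<in> U"
    and F: "smooth_wrt \<phi> U F" "\<And>x. x \<in> U \<Longrightarrow> F x - F x0 \<in> D ` span (\<phi> ` U)"
    and D: "((F \<circ> inv_into U \<phi>) has_derivative D) (at (\<phi> x0) within \<phi> ` U)"
  obtains U' \<phi>' A L where "(U', \<phi>') \<in> maximal_atlas M" "x0 \<in> U'" "U' \<subseteq> U" "\<phi>' x0 = 0"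
    "span (\<phi>' ` U') = span (\<phi> ` U)" "linear A" "A ` span (\<phi> ` U) = D ` span (\<phi> ` U)"
    "\<And>x. x \<in> U' \<Longrightarrow> A (\<phi>' x) = F x - F x0"
    "linear L" "range L \<subseteq> span (\<phi> ` U)" "\<And>z. z \<in> D ` span (\<phi> ` U) \<Longrightarrow> A (L z) = z"
proof -
  note chU = maximal_atlas_is_chart[OF U(1)]
  have Une: "U \<noteq> {}" using U(2) by auto
  define W where "W = span (\<phi> ` U)"
  have W: "subspace W" "dim W = mdim M" "openin (top_of_set W) (\<phi> ` U)"
    using is_chart_subspace[OF chU Une] by (auto simp: W_def)
  obtain Q where Q: "open Q" "\<phi> ` U = W \<inter> Q" using W(3) unfolding openin_open by blast
  obtain V g where V: "open V" "\<phi> x0 \<in> V" "\<And>k. Ck_on k V g" "\<And>b. b \<in> U \<Longrightarrow> \<phi> b \<in> V \<Longrightarrow> g (\<phi> b) = F b"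
    using smooth_wrtE[OF F(1) U(2)] by metis
  define A where "A = frechet_derivative g (at (\<phi> x0))"
  have A: "(g has_derivative A) (at (\<phi> x0))"
    unfolding A_def by (rule Ck_on_Suc_has_derivative[OF V(3) V(2)])
  have inv: "inv_into U \<phi> (\<phi> x) = x" if "x \<in> U" for x using is_chart_inj[OF chU] that by simp
  have op: "openin (top_of_set W) (\<phi> ` U \<inter> V)" using W(3) V(1) by (rule openin_Int_open)
  \<comment> \<open>The ambient derivative \<open>A\<close> depends on the chosen extension
    \<open>g\<close>, but on the model subspace it is determined and equals
    \<open>D\<close>.\<close>
  have AD: "A w = D w" if "w \<in> W" for w
  proof (rule has_derivative_unique_on_subspace[OF W(1) op _ that])
    show "(g has_derivative A) (at (\<phi> x0) within \<phi> ` U \<inter> V)" using A has_derivative_at_withinI by blast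
    show "(g has_derivative D) (at (\<phi> x0) within \<phi> ` U \<inter> V)"
      by (rule has_derivative_transform[OF _ _ has_derivative_subset[OF D]]) (use V U(2) inv in auto)
  qed (use U(2) V(2) in auto)
  have AW: "A ` W = D ` W" using AD by simp
  have imp: "g x - g (\<phi> x0) \<in> A ` W" if "x \<in> W \<inter> (V \<inter> Q)" for x
  proof -
    have "x \<in> \<phi> ` U" using that unfolding Q(2) by simp
    then obtain y where y: "y \<in> U" "x = \<phi> y" by auto
    have "g x = F y" "g (\<phi> x0) = F x0" using that V(2,4) y U(2) by auto
    then show ?thesis using F(2)[OF y(1), folded W_def] unfolding AW by simp
  qed
  have p: "\<phi> x0 \<in> W" "\<phi> x0 \<in> V \<inter> Q" using U(2) Q(2) V(2) by auto
  have oVQ: "open (V \<inter> Q)" using V(1) Q(1) by auto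
  have gVQ: "Ck_on k (V \<inter> Q) g" for k by (rule Ck_on_subset[OF V(3)]) auto
  show thesis
  proof (rule straightening[OF W(1) p(1) oVQ p(2) gVQ A imp])
    fix N N' \<theta> \<theta>' L
    assume N: "open N" "\<phi> x0 \<in> N" "N \<inter> W \<subseteq> V \<inter> Q" "open N'" "homeomorphism N N' \<theta> \<theta>'"
      "\<And>k. Ck_on k N \<theta>" "\<And>k. Ck_on k N' \<theta>'" "\<theta> (\<phi> x0) = 0" "\<And>x. x \<in> N \<Longrightarrow> \<theta> x \<in> W \<longleftrightarrow> x \<in> W"
      "\<And>x. x \<in> N \<inter> W \<Longrightarrow> A (\<theta> x) = g x - g (\<phi> x0)"
      "linear L" "range L \<subseteq> W" "\<And>z. z \<in> A ` W \<Longrightarrow> A (L z) = z"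
    define U' where "U' = {x \<in> U. \<phi> x \<in> N}"
    have opU': "openin (mtop M) U'" unfolding U'_def by (rule is_chart_preimage[OF chU N(1)])
    have subU': "U' \<subseteq> U" by (auto simp: U'_def)
    have im: "\<phi> ` U' = N \<inter> W" using Q(2) N(3) unfolding U'_def by auto
    have hom: "\<theta> ` N = N'" "\<theta>' ` N' = N" "\<And>x. x \<in> N \<Longrightarrow> \<theta>' (\<theta> x) = x" "\<And>y. y \<in> N' \<Longrightarrow> \<theta> (\<theta>' y) = y"
      using N(5) by (auto simp: homeomorphism_def)
    \<comment> \<open>Since \<open>\<theta>\<close> neither enters nor leaves \<open>W\<close>, it
      maps \<open>N \<inter> W\<close> onto \<open>N' \<inter> W\<close>; this makes the image of
      the new chart relatively open in \<open>W\<close>.\<close>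
    have im': "(\<lambda>x. \<theta> (\<phi> x)) ` U' = W \<inter> N'"
    proof -
      have "(\<lambda>x. \<theta> (\<phi> x)) ` U' = \<theta> ` (N \<inter> W)" using im by (metis image_image)
      also have "\<dots> = W \<inter> N'"
      proof (intro equalityI subsetI)
        fix y assume "y \<in> \<theta> ` (N \<inter> W)"
        then show "y \<in> W \<inter> N'" using hom(1) N(9) by auto
      next
        fix y assume y: "y \<in> W \<inter> N'"
        then have "\<theta>' y \<in> N" "\<theta> (\<theta>' y) = y" using hom by auto
        then show "y \<in> \<theta> ` (N \<inter> W)" using N(9) y by (metis IntD1 IntI image_eqI)
      qed
      finally show ?thesis .
    qed
    have chU': "is_chart (mtop M) (mdim M) (U', \<phi>)" by (rule is_chart_restrict[OF chU opU' subU'])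
    have phiN: "\<phi> x \<in> N" if "x \<in> U'" for x using that by (simp add: U'_def)
    have ch': "is_chart (mtop M) (mdim M) (U', \<lambda>x. \<theta> (\<phi> x))"
      unfolding is_chart_iff
    proof (intro conjI allI impI opU')
      show "inj_on (\<lambda>x. \<theta> (\<phi> x)) U'"
      proof (rule inj_onI)
        fix x y assume xy: "x \<in> U'" "y \<in> U'" "\<theta> (\<phi> x) = \<theta> (\<phi> y)"
        have "\<phi> x = \<theta>' (\<theta> (\<phi> x))" by (rule hom(3)[OF phiN[OF xy(1)], symmetric])
        also have "\<dots> = \<phi> y" unfolding xy(3) by (rule hom(3)[OF phiN[OF xy(2)]])
        finally have "\<phi> x = \<phi> y" .
        then show "x = y" using inj_onD[OF is_chart_inj[OF chU'] _ xy(1,2)] by blast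
      qed
      show "\<exists>W. subspace W \<and> dim W = mdim M \<and> openin (top_of_set W) ((\<lambda>x. \<theta> (\<phi> x)) ` U')"
        unfolding im' using W N(4) by (auto intro: openin_open_Int)
      fix T assume T: "T \<subseteq> U'"
      show "openin (mtop M) T \<longleftrightarrow> (\<exists>V. open V \<and> T = {x \<in> U'. \<theta> (\<phi> x) \<in> V})"
        unfolding is_chart_openin_iff[OF chU' T]
      proof (intro iffI; elim exE conjE)
        fix S assume S: "open S" "T = {x \<in> U'. \<phi> x \<in> S}"
        have "open (N' \<inter> \<theta>' -` S)"
          using N(4,7) S(1) Ck_on_imp_continuous_on continuous_open_preimage by blast
        moreover have "T = {x \<in> U'. \<theta> (\<phi> x) \<in> N' \<inter> \<theta>' -` S}"
        proof -
          have "\<theta> (\<phi> x) \<in> N' \<inter> \<theta>' -` S \<longleftrightarrow> \<phi> x \<in> S" if "x \<in> U'" for x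
            using hom(1) hom(3)[OF phiN[OF that]] phiN[OF that] by (metis IntD2 IntI imageI vimageE vimageI)
          then show ?thesis unfolding S(2) by blast
        qed
        ultimately show "\<exists>V. open V \<and> T = {x \<in> U'. \<theta> (\<phi> x) \<in> V}" by blast
      next
        fix S assume S: "open S" "T = {x \<in> U'. \<theta> (\<phi> x) \<in> S}"
        have "open (N \<inter> \<theta> -` S)"
          using N(1,6) S(1) Ck_on_imp_continuous_on continuous_open_preimage by blast
        moreover have "T = {x \<in> U'. \<phi> x \<in> N \<inter> \<theta> -` S}"
          using S(2) phiN by auto
        ultimately show "\<exists>V. open V \<and> T = {x \<in> U'. \<phi> x \<in> V}" by blast
      qed
    qed
    have sm: "smooth_wrt \<phi> U' (\<lambda>x. \<theta> (\<phi> x))"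
      by (rule smooth_wrt_Ck[OF N(1,6)]) (use phiN in auto)
    have "smooth_wrt (\<lambda>x. \<theta> (\<phi> x)) U' (\<lambda>x. \<theta>' (\<theta> (\<phi> x)))"
      by (rule smooth_wrt_Ck[OF N(4,7)]) (use im' in auto)
    then have sm': "smooth_wrt (\<lambda>x. \<theta> (\<phi> x)) U' \<phi>"
      by (subst (asm) smooth_wrt_cong[of U' _ \<phi>]) (use hom(3) phiN in auto)
    have x0: "x0 \<in> U'" using U(2) N(2) by (simp add: U'_def)
    show thesis
    proof (rule that[of U' "\<lambda>x. \<theta> (\<phi> x)" A L])
      show "(U', \<lambda>x. \<theta> (\<phi> x)) \<in> maximal_atlas M"
        by (rule maximal_atlasI[OF M U(1) ch' subU' sm sm'])
      show "span ((\<lambda>x. \<theta> (\<phi> x)) ` U') = span (\<phi> ` U)"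
      proof (rule subspace_dim_equal[OF subspace_span subspace_span])
        show "span ((\<lambda>x. \<theta> (\<phi> x)) ` U') \<subseteq> span (\<phi> ` U)"
          unfolding im' W_def[symmetric] by (rule span_minimal[OF Int_lower1 W(1)])
        have "U' \<noteq> {}" using x0 by auto
        from is_chart_subspace(1)[OF ch' this]
        show "dim (span (\<phi> ` U)) \<le> dim (span ((\<lambda>x. \<theta> (\<phi> x)) ` U'))"
          using W(2) unfolding W_def by simp
      qed
      show "linear A" using A has_derivative_linear by blast
      show "A (\<theta> (\<phi> x)) = F x - F x0" if x: "x \<in> U'" for x
      proof -
        have "\<phi> x \<in> N \<inter> W" using im x by blast
        then show ?thesis using N(3,10) V(2,4) x subU' U(2) by auto
      qed
      show "range L \<subseteq> span (\<phi> ` U)" "\<And>z. z \<in> D ` span (\<phi> ` U) \<Longrightarrow> A (L z) = z"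
        using N(12,13) AW by (auto simp: W_def)
      show "A ` span (\<phi> ` U) = D ` span (\<phi> ` U)" using AW by (simp add: W_def)
    qed (use x0 subU' N(8,11) in auto)
  qed
qed

text \<open>The section passes through the prescribed point \<open>x\<close>, not merely over the
  value \<open>f x\<close>; this is what yields surjectivity of the derivative at \<open>x\<close>
  itself. Smoothness is imposed near \<open>f x\<close> only, and away from there \<sigma> may be
  arbitrary.\<close>

definition local_section ::
  "('a, 'e::euclidean_space) manifold \<Rightarrow> ('b, 'f::euclidean_space) manifold \<Rightarrow> ('a \<Rightarrow> 'b) \<Rightarrow> 'a \<Rightarrow> bool" where
  "local_section M N f x \<longleftrightarrow> (\<exists>\<sigma> T. openin (mtop N) T \<and> f x \<in> T \<and> smooth_at N M \<sigma> (f x) \<and>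
     \<sigma> (f x) = x \<and> (\<forall>y\<in>T. f (\<sigma> y) = y))"

lemma local_sectionE:
  assumes "local_section M N f x"
  obtains \<sigma> T where "openin (mtop N) T" "f x \<in> T" "smooth_at N M \<sigma> (f x)" "\<sigma> (f x) = x"
    "\<forall>y\<in>T. f (\<sigma> y) = y"
  using assms unfolding local_section_def by auto

lemma smooth_map_chart:
  assumes M: "smooth_manifold M" and N: "smooth_manifold N" and f: "smooth_map M N f"
    and U: "(U, \<phi>) \<in> maximal_atlas M" and V: "(V, \<psi>) \<in> maximal_atlas N"
  shows "({x \<in> U. f x \<in> V}, \<phi>) \<in> maximal_atlas M"
    and "smooth_wrt \<phi> {x \<in> U. f x \<in> V} (\<lambda>x. \<psi> (f x))"
proof -
  have "openin (mtop M) (U \<inter> {x \<in> points M. f x \<in> V})"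
    using f unfolding smooth_map_def
    by (intro openin_Int openin_continuous_map_preimage[of _ "mtop N"]
        is_chart_openin[OF maximal_atlas_is_chart[OF U]] is_chart_openin[OF maximal_atlas_is_chart[OF V]]) auto
  moreover have "U \<inter> {x \<in> points M. f x \<in> V} = {x \<in> U. f x \<in> V}" using maximal_atlas_subset[OF U] by auto
  ultimately show "({x \<in> U. f x \<in> V}, \<phi>) \<in> maximal_atlas M"
    by (intro maximal_atlas_restrict[OF M U]) auto
  show "smooth_wrt \<phi> {x \<in> U. f x \<in> V} (\<lambda>x. \<psi> (f x))"
  proof (rule smooth_wrt_nbhd[OF maximal_atlas_is_chart[OF U]])
    fix a assume "a \<in> {x \<in> U. f x \<in> V}"
    then have a: "a \<in> U" "f a \<in> V" by auto
    have sa: "smooth_at M N f a" using f maximal_atlas_subset[OF U] smooth_map_iff[OF M N] a(1) by blast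
    obtain S where S: "openin (mtop M) S" "a \<in> S" "smooth_wrt \<phi> S (\<lambda>y. \<psi> (f y))"
      using smooth_at_charts[OF M N sa U V a] by metis
    have "smooth_wrt \<phi> ({x \<in> U. f x \<in> V} \<inter> S) (\<lambda>y. \<psi> (f y))" by (rule smooth_wrt_subset[OF S(3)]) simp
    with S(1,2) show "\<exists>S. openin (mtop M) S \<and> a \<in> S \<and> smooth_wrt \<phi> ({x \<in> U. f x \<in> V} \<inter> S) (\<lambda>y. \<psi> (f y))"
      by (intro exI[of _ S]) simp
  qed auto
qed

text \<open>In straightened coordinates \<open>f\<close> is the linear map \<open>A\<close> up to a
  translation, and a linear right inverse \<open>L\<close> of \<open>A\<close> on the tangent space
  gives the section: it sends \<open>y\<close> to the point with coordinates
  \<open>L (\<psi> y - \<psi> (f x))\<close>.\<close>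

lemma submersion_local_section:
  assumes M: "smooth_manifold M" and N: "smooth_manifold N" and f: "submersion M N f" and x: "x \<in> points M"
  shows "local_section M N f x"
proof -
  have sm: "smooth_map M N f" using f by (simp add: submersion_def)
  obtain U \<phi> where U: "(U, \<phi>) \<in> charts M" "x \<in> U" using charts_cover[OF M x] .
  obtain V \<psi> where V: "(V, \<psi>) \<in> charts N" "f x \<in> V" using charts_cover[OF N smooth_map_points[OF sm x]] .
  have max: "(U, \<phi>) \<in> maximal_atlas M" "(V, \<psi>) \<in> maximal_atlas N"
    using U V charts_subset_maximal_atlas M N by auto
  let ?U = "{x \<in> U. f x \<in> V}"
  define F where "F y = \<psi> (f y)" for y
  have F: "(?U, \<phi>) \<in> maximal_atlas M" "smooth_wrt \<phi> ?U F"
    using smooth_map_chart[OF M N sm max] unfolding F_def by auto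
  note chU = maximal_atlas_is_chart[OF max(1)] and chV = maximal_atlas_is_chart[OF max(2)]
  have xU: "x \<in> ?U" using U V by auto
  have "\<exists>D. ((\<psi> \<circ> f \<circ> inv_into U \<phi>) has_derivative D) (at (\<phi> x) within \<phi> ` ?U) \<and>
             D ` span (\<phi> ` U) = span (\<psi> ` V)"
    using f U V unfolding submersion_def by fast
  then obtain D where D: "((\<psi> \<circ> f \<circ> inv_into U \<phi>) has_derivative D) (at (\<phi> x) within \<phi> ` ?U)"
    "D ` span (\<phi> ` U) = span (\<psi> ` V)" by (elim exE conjE)
  have sp: "span (\<phi> ` ?U) = span (\<phi> ` U)"
    by (rule is_chart_span_restrict[OF chU is_chart_openin[OF maximal_atlas_is_chart[OF F(1)]]]) (use xU in auto)
  have inv: "inv_into A \<phi> (\<phi> y) = y" if "y \<in> A" "A \<subseteq> U" for y A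
    using is_chart_inj[OF chU] that by (meson inv_into_f_f inj_on_subset)
  have D': "((F \<circ> inv_into ?U \<phi>) has_derivative D) (at (\<phi> x) within \<phi> ` ?U)"
  proof (rule has_derivative_transform[OF _ _ D(1)])
    show "\<phi> x \<in> \<phi> ` ?U" using xU by blast
    fix z assume "z \<in> \<phi> ` ?U"
    then obtain y where y: "y \<in> ?U" "z = \<phi> y" by (elim imageE)
    have "inv_into ?U \<phi> (\<phi> y) = y" "inv_into U \<phi> (\<phi> y) = y" by (rule inv; use y(1) in auto)+
    then show "(F \<circ> inv_into ?U \<phi>) z = (\<psi> \<circ> f \<circ> inv_into U \<phi>) z" using y(2) by (simp add: F_def)
  qed
  have Fsp: "F y - F x \<in> D ` span (\<phi> ` ?U)" if "y \<in> ?U" for y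
    unfolding sp D(2) F_def by (intro span_diff span_base imageI) (use that V(2) in auto)
  show ?thesis
  proof (rule straightened_chart[OF M F(1) xU F(2) Fsp D'])
    fix U' \<phi>' A L
    assume *: "(U', \<phi>') \<in> maximal_atlas M" "x \<in> U'" "U' \<subseteq> ?U" "\<phi>' x = 0"
      "span (\<phi>' ` U') = span (\<phi> ` ?U)" "linear A" "A ` span (\<phi> ` ?U) = D ` span (\<phi> ` ?U)"
      "\<And>y. y \<in> U' \<Longrightarrow> A (\<phi>' y) = F y - F x"
      "linear L" "range L \<subseteq> span (\<phi> ` ?U)" "\<And>z. z \<in> D ` span (\<phi> ` ?U) \<Longrightarrow> A (L z) = z"
    note ch' = maximal_atlas_is_chart[OF *(1)]
    have "U' \<noteq> {}" using *(2) by auto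
    from is_chart_subspace(2)[OF ch' this]
    obtain Q where Q: "open Q" "\<phi>' ` U' = span (\<phi>' ` U') \<inter> Q" unfolding openin_open by blast
    define l where "l y = L (\<psi> y - F x)" for y
    define \<sigma> where "\<sigma> y = inv_into U' \<phi>' (l y)" for y
    \<comment> \<open>Here the lift \<open>l y\<close> is the coordinate of a point of the chart.
      Its membership in the model subspace is automatic from the range of \<open>L\<close>, so only
      the open condition \<open>Q\<close> remains to be imposed.\<close>
    define T where "T = {y \<in> V. l y \<in> Q}"
    have bl: "bounded_linear L" using *(9) linear_conv_bounded_linear by blast
    have l: "smooth_wrt \<psi> V l"
      unfolding l_def by (intro smooth_wrt_linear[OF bl] smooth_wrt_diff smooth_wrt_self smooth_wrt_const)
    have T: "openin (mtop N) T" unfolding T_def by (rule smooth_wrt_preimage_open[OF chV l Q(1)])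
    have TV: "T \<subseteq> V" by (auto simp: T_def)
    have lT: "l y \<in> \<phi>' ` U'" if "y \<in> T" for y
    proof -
      have "l y \<in> span (\<phi>' ` U')" unfolding *(5) l_def using *(10) by auto
      moreover have "l y \<in> Q" using that by (simp add: T_def)
      ultimately show ?thesis by (subst Q(2)) (rule IntI)
    qed
    have \<sigma>: "\<sigma> y \<in> U'" "\<phi>' (\<sigma> y) = l y" if "y \<in> T" for y
      using lT[OF that] by (auto simp: \<sigma>_def inv_into_into f_inv_into_f)
    have l0: "l (f x) = 0" by (simp add: l_def F_def linear_0[OF *(9)])
    have "0 \<in> Q" using *(2,4) Q(2) by (metis IntD2 imageI)
    then have fxT: "f x \<in> T" using V(2) l0 by (simp add: T_def)
    have "\<sigma> (f x) = x"
      using is_chart_inj[OF ch'] \<sigma>[OF fxT] *(2,4) l0 by (metis inj_onD)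
    moreover have "f (\<sigma> y) = y" if y: "y \<in> T" for y
    proof -
      have "\<psi> y - F x \<in> span (\<psi> ` V)" unfolding F_def by (intro span_diff span_base imageI) (use y TV V(2) in auto)
      then have "A (l y) = \<psi> y - F x" unfolding l_def by (intro *(11)) (simp add: sp D(2))
      then have "\<psi> (f (\<sigma> y)) = \<psi> y" using *(8)[OF \<sigma>(1)[OF y]] \<sigma>(2)[OF y] by (simp add: F_def)
      moreover have "f (\<sigma> y) \<in> V" "y \<in> V" using \<sigma>(1)[OF y] *(3) y TV by auto
      ultimately show ?thesis using is_chart_inj[OF chV] by (auto dest: inj_onD)
    qed
    moreover have "smooth_at N M \<sigma> (f x)"
    proof (rule smooth_atI[OF maximal_atlas_restrict[OF N max(2) T TV] *(1) fxT])
      show "\<sigma> ` T \<subseteq> U'" using \<sigma> by auto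
      show "smooth_wrt \<psi> T (\<lambda>y. \<phi>' (\<sigma> y))"
        by (subst smooth_wrt_cong[of T _ l]) (use \<sigma> smooth_wrt_subset[OF l TV] in auto)
    qed
    ultimately show ?thesis
      unfolding local_section_def using T fxT by blast
  qed
qed

lemma local_section_charts:
  assumes M: "smooth_manifold M" and N: "smooth_manifold N"
    and f: "local_section M N f x"
    and U: "(U, \<phi>) \<in> maximal_atlas M" "x \<in> U" and V: "(V, \<psi>) \<in> maximal_atlas N" "f x \<in> V"
  obtains \<sigma> V' where "(V', \<psi>) \<in> maximal_atlas N" "V' \<subseteq> V" "f x \<in> V'" "\<sigma> (f x) = x" "\<sigma> ` V' \<subseteq> U"
    "smooth_wrt \<psi> V' (\<lambda>y. \<phi> (\<sigma> y))" "\<forall>y\<in>V'. f (\<sigma> y) = y"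
    "span (\<psi> ` V') = span (\<psi> ` V)"
proof -
  obtain \<sigma> T where *: "openin (mtop N) T" "f x \<in> T" "smooth_at N M \<sigma> (f x)" "\<sigma> (f x) = x"
    "\<forall>y\<in>T. f (\<sigma> y) = y" by (rule local_sectionE[OF f])
  have sU: "\<sigma> (f x) \<in> U" using *(4) U(2) by simp
  obtain V1 where V1: "openin (mtop N) V1" "f x \<in> V1" "V1 \<subseteq> V" "\<sigma> ` V1 \<subseteq> U" "smooth_wrt \<psi> V1 (\<lambda>y. \<phi> (\<sigma> y))"
    using smooth_at_charts[OF N M *(3) V(1) U(1) V(2) sU] by metis
  have op: "openin (mtop N) (V1 \<inter> T)" using V1(1) *(1) by auto
  show thesis
  proof (rule that[of "V1 \<inter> T" \<sigma>])
    show "(V1 \<inter> T, \<psi>) \<in> maximal_atlas N"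
      by (rule maximal_atlas_restrict[OF N V(1) op]) (use V1(3) in auto)
    show "smooth_wrt \<psi> (V1 \<inter> T) (\<lambda>y. \<phi> (\<sigma> y))" by (rule smooth_wrt_subset[OF V1(5)]) auto
    show "span (\<psi> ` (V1 \<inter> T)) = span (\<psi> ` V)"
      by (rule is_chart_span_restrict[OF maximal_atlas_is_chart[OF V(1)] op]) (use V1 *(2) in auto)
  qed (use V1 * in auto)
qed

text \<open>A section through \<open>x\<close>, read in the charts at hand, is the smooth right
  inverse that \<open>derivative_onto\<close> asks for. The charts have to be shrunk for this, which
  leaves the spans and hence the surjectivity statement unchanged.\<close>

lemma submersionI:
  assumes M: "smooth_manifold M" and N: "smooth_manifold N" and f: "smooth_map M N f"
    and sec: "\<And>x. x \<in> points M \<Longrightarrow> local_section M N f x"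
  shows "submersion M N f"
proof -
  have "\<exists>D. ((\<psi> \<circ> f \<circ> inv_into U \<phi>) has_derivative D) (at (\<phi> x) within \<phi> ` {y\<in>U. f y \<in> V}) \<and>
      D ` span (\<phi> ` U) = span (\<psi> ` V)"
    if U: "(U, \<phi>) \<in> charts M" and V: "(V, \<psi>) \<in> charts N" and x: "x \<in> U" "f x \<in> V" for U \<phi> V \<psi> x
  proof -
    let ?U = "{y \<in> U. f y \<in> V}"
    have max: "(U, \<phi>) \<in> maximal_atlas M" "(V, \<psi>) \<in> maximal_atlas N"
      using U V charts_subset_maximal_atlas M N by auto
    note sm = smooth_map_chart[OF M N f max]
    note chU = maximal_atlas_is_chart[OF sm(1)]
    have xM: "x \<in> points M" using x(1) maximal_atlas_subset[OF max(1)] by auto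
    have xU: "x \<in> ?U" using x by auto
    obtain \<sigma> V' where *: "(V', \<psi>) \<in> maximal_atlas N" "V' \<subseteq> V" "f x \<in> V'" "\<sigma> (f x) = x" "\<sigma> ` V' \<subseteq> ?U"
      "smooth_wrt \<psi> V' (\<lambda>y. \<phi> (\<sigma> y))" "\<forall>y\<in>V'. f (\<sigma> y) = y" "span (\<psi> ` V') = span (\<psi> ` V)"
      by (rule local_section_charts[OF M N sec[OF xM] sm(1) xU max(2) x(2)])
    have 1: "\<psi> (f y) - 0 \<in> span (\<psi> ` V')" if "y \<in> ?U" for y
      unfolding *(8) using that by (auto intro!: span_base)
    have 2: "\<psi> (f (\<sigma> z)) = \<psi> z - 0" if "z \<in> V'" for z using bspec[OF *(7) that] by simp
    obtain D where D': "(((\<lambda>y. \<psi> (f y)) \<circ> inv_into ?U \<phi>) has_derivative D) (at (\<phi> (\<sigma> (f x))) within \<phi> ` ?U)"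
      "D ` span (\<phi> ` ?U) = span (\<psi> ` V')"
      by (rule derivative_onto[OF chU maximal_atlas_is_chart[OF *(1)] sm(2) 1 *(3,5,6) 2])
    note D = D'[unfolded *(4,8)]
    have inj: "inj_on \<phi> U" using is_chart_inj[OF maximal_atlas_is_chart[OF max(1)]] .
    have "((\<psi> \<circ> f \<circ> inv_into U \<phi>) has_derivative D) (at (\<phi> x) within \<phi> ` ?U)"
    proof (rule has_derivative_transform[OF _ _ D(1)])
      show "\<phi> x \<in> \<phi> ` ?U" using xU by blast
      fix z assume "z \<in> \<phi> ` ?U"
      then obtain y where y: "y \<in> ?U" "z = \<phi> y" by (elim imageE)
      have "inv_into ?U \<phi> (\<phi> y) = y" by (rule inv_into_f_f[OF inj_on_subset[OF inj]]) (use y(1) in auto)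
      moreover have "inv_into U \<phi> (\<phi> y) = y" by (rule inv_into_f_f[OF inj]) (use y(1) in auto)
      ultimately show "(\<psi> \<circ> f \<circ> inv_into U \<phi>) z = ((\<lambda>y. \<psi> (f y)) \<circ> inv_into ?U \<phi>) z" using y(2) by simp
    qed
    moreover have "span (\<phi> ` ?U) = span (\<phi> ` U)"
      by (rule is_chart_span_restrict[OF maximal_atlas_is_chart[OF max(1)] is_chart_openin[OF chU]]) (use xU in auto)
    ultimately show ?thesis using D(2) by auto
  qed
  then show ?thesis
    unfolding submersion_def using f by blast
qed

lemma submersion_compose:
  assumes M: "smooth_manifold M" and N: "smooth_manifold N" and Z: "smooth_manifold Z"
    and f: "submersion M N f" and g: "submersion N Z g"
  shows "submersion M Z (\<lambda>x. g (f x))"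
proof (rule submersionI[OF M Z])
  have fg: "smooth_map M N f" "smooth_map N Z g" using f g by (auto simp: submersion_def)
  then show "smooth_map M Z (\<lambda>x. g (f x))" by (rule smooth_map_compose[OF M N Z])
  fix x assume x: "x \<in> points M"
  obtain \<sigma> T where 1: "openin (mtop N) T" "f x \<in> T" "smooth_at N M \<sigma> (f x)" "\<sigma> (f x) = x"
    "\<forall>y\<in>T. f (\<sigma> y) = y" by (rule local_sectionE[OF submersion_local_section[OF M N f x]])
  obtain \<sigma>' T' where 2: "openin (mtop Z) T'" "g (f x) \<in> T'" "smooth_at Z N \<sigma>' (g (f x))" "\<sigma>' (g (f x)) = f x"
    "\<forall>y\<in>T'. g (\<sigma>' y) = y"
    by (rule local_sectionE[OF submersion_local_section[OF N Z g smooth_map_points[OF fg(1) x]]])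
  \<comment> \<open>The section \<open>\<sigma>'\<close> must take values in \<open>T\<close>, where
    \<sigma> is a section of \<open>f\<close>; a chart inside \<open>T\<close> is the neighbourhood
    to which its domain will be adapted.\<close>
  obtain V \<psi> where V: "(V, \<psi>) \<in> maximal_atlas N" "f x \<in> V" "V \<subseteq> T"
  proof -
    obtain V \<psi> where "(V, \<psi>) \<in> maximal_atlas N" "f x \<in> V"
      using maximal_atlas_cover[OF N smooth_map_points[OF fg(1) x]] .
    then show thesis
      using that[of "V \<inter> T" \<psi>] maximal_atlas_restrict[OF N, of V \<psi> "V \<inter> T"] 1(1,2)
        is_chart_openin[OF maximal_atlas_is_chart[of "(V, \<psi>)" N]] by auto
  qed
  obtain U \<phi> where U: "(U, \<phi>) \<in> maximal_atlas Z" "g (f x) \<in> U" using smooth_atE[OF 2(3)] by metis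
  have "\<sigma>' (g (f x)) \<in> V" using 2(4) V(2) by simp
  then obtain S where S: "openin (mtop Z) S" "g (f x) \<in> S" "\<sigma>' ` S \<subseteq> V"
    using smooth_at_charts[OF Z N 2(3) U(1) V(1) U(2)] by metis
  have "smooth_at Z M (\<lambda>y. \<sigma> (\<sigma>' y)) (g (f x))"
    by (rule smooth_at_compose[OF Z N 2(3)]) (use 1(3) 2(4) in simp)
  then show "local_section M Z (\<lambda>x. g (f x)) x"
    unfolding local_section_def using 1 2 S V(3)
    by (intro exI[of _ "\<lambda>y. \<sigma> (\<sigma>' y)"] exI[of _ "S \<inter> T'"]) (auto simp: image_subset_iff subset_iff)
qed

text \<open>A section of the composite through a preimage \<open>x\<close> of \<open>y\<close>,
  followed by \<open>r\<close>, is a section of \<open>p\<close> through \<open>y\<close>. It is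
  applied to the retraction onto the level set \<open>B\<close>.\<close>

lemma submersion_cancel:
  assumes M: "smooth_manifold M" and N: "smooth_manifold N" and Z: "smooth_manifold Z"
    and r: "smooth_map M N r" "r ` points M = points N" and p: "smooth_map N Z p"
    and pr: "submersion M Z (\<lambda>x. p (r x))"
  shows "submersion N Z p"
proof (rule submersionI[OF N Z p])
  fix y assume "y \<in> points N"
  then obtain x where x: "x \<in> points M" "r x = y" using r(2) by (metis imageE)
  obtain \<sigma> T where 1: "openin (mtop Z) T" "p (r x) \<in> T" "smooth_at Z M \<sigma> (p (r x))" "\<sigma> (p (r x)) = x"
    "\<forall>y\<in>T. p (r (\<sigma> y)) = y" by (rule local_sectionE[OF submersion_local_section[OF M Z pr x(1)]])
  have "smooth_at Z N (\<lambda>y. r (\<sigma> y)) (p (r x))"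
    by (rule smooth_at_compose[OF Z M 1(3)]) (use 1(4) x(1) r(1) smooth_map_iff[OF M N] in auto)
  then show "local_section N Z p y"
    unfolding local_section_def using 1 x by (intro exI[of _ "\<lambda>y. r (\<sigma> y)"] exI[of _ T]) auto
qed

section \<open>Diffeomorphisms and projections as submersions\<close>

lemma diffeomorphism_submersion:
  assumes M: "smooth_manifold M" and N: "smooth_manifold N" and f: "diffeomorphism M N f"
  shows "submersion M N f"
proof (rule submersionI[OF M N])
  show "smooth_map M N f" using f by (simp add: diffeomorphism_def)
  fix x assume x: "x \<in> points M"
  have bij: "bij_betw f (points M) (points N)" and i: "smooth_map N M (inv_into (points M) f)"
    using f by (auto simp: diffeomorphism_def)
  have fx: "f x \<in> points N" using bij x bij_betwE by blast
  show "local_section M N f x"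
    unfolding local_section_def
  proof (intro exI conjI ballI)
    show "openin (mtop N) (points N)" by simp
    show "f x \<in> points N" by (rule fx)
    show "smooth_at N M (inv_into (points M) f) (f x)" using i fx smooth_map_iff[OF N M] by auto
    show "inv_into (points M) f (f x) = x" using bij x by (simp add: bij_betw_inv_into_left)
    show "f (inv_into (points M) f y) = y" if "y \<in> points N" for y using bij that by (simp add: bij_betw_inv_into_right)
  qed
qed

lemma submersion_snd:
  assumes M: "smooth_manifold M" and N: "smooth_manifold N"
  shows "submersion (prod_manifold M N) N snd"
proof (rule submersionI[OF smooth_manifold_prod[OF M N] N smooth_map_snd[OF M N]])
  fix z assume z: "z \<in> points (prod_manifold M N)"
  have "smooth_map N (prod_manifold M N) (\<lambda>y. (fst z, y))"
    by (intro smooth_map_Pair N M smooth_map_const smooth_map_ident) (use z in auto)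
  then have "smooth_at N (prod_manifold M N) (\<lambda>y. (fst z, y)) (snd z)"
    using z smooth_map_iff[OF N smooth_manifold_prod[OF M N]] by auto
  then show "local_section (prod_manifold M N) N snd z"
    unfolding local_section_def using z
    by (intro exI[of _ "\<lambda>y. (fst z, y)"] exI[of _ "points N"]) auto
qed

lemma submersion_fst:
  assumes M: "smooth_manifold M" and N: "smooth_manifold N"
  shows "submersion (prod_manifold M N) M fst"
proof (rule submersionI[OF smooth_manifold_prod[OF M N] M smooth_map_fst[OF M N]])
  fix z assume z: "z \<in> points (prod_manifold M N)"
  have "smooth_map M (prod_manifold M N) (\<lambda>x. (x, snd z))"
    by (intro smooth_map_Pair N M smooth_map_const smooth_map_ident) (use z in auto)
  then have "smooth_at M (prod_manifold M N) (\<lambda>x. (x, snd z)) (fst z)"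
    using z smooth_map_iff[OF M smooth_manifold_prod[OF M N]] by auto
  then show "local_section (prod_manifold M N) M fst z"
    unfolding local_section_def using z
    by (intro exI[of _ "\<lambda>x. (x, snd z)"] exI[of _ "points M"]) auto
qed

section \<open>Level sets and fibre products\<close>

lemma dim_kernel_on_subspace:
  fixes A :: "'a::euclidean_space \<Rightarrow> 'b::euclidean_space"
  assumes A: "linear A" and W: "subspace W" and L: "linear L" "range L \<subseteq> W" "\<And>z. z \<in> A ` W \<Longrightarrow> A (L z) = z"
  shows "dim {w \<in> W. A w = 0} = dim W - dim (A ` W)"
proof -
  let ?K = "{w \<in> W. A w = 0}"
  let ?R = "L ` A ` W"
  have K: "subspace ?K"
    using W by (auto simp: subspace_def linear_0[OF A] linear_add[OF A] linear_scale[OF A])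
  have AW: "subspace (A ` W)" by (rule linear_subspace_image[OF A W])
  have R: "subspace ?R" by (rule linear_subspace_image[OF L(1) AW])
  have "dim {x + y |x y. x \<in> ?K \<and> y \<in> ?R} + dim (?K \<inter> ?R) = dim ?K + dim ?R"
    by (rule dim_sums_Int[OF K R])
  moreover have "{x + y |x y. x \<in> ?K \<and> y \<in> ?R} = W"
  proof (intro equalityI subsetI)
    fix w assume "w \<in> {x + y |x y. x \<in> ?K \<and> y \<in> ?R}"
    then show "w \<in> W" using W L(2) by (auto intro!: subspace_add)
  next
    fix w assume w: "w \<in> W"
    have "w - L (A w) \<in> ?K"
      using w W L(2) L(3)[of "A w"] by (auto intro!: subspace_diff simp: linear_diff[OF A])
    moreover have "w = (w - L (A w)) + L (A w)" by simp
    ultimately show "w \<in> {x + y |x y. x \<in> ?K \<and> y \<in> ?R}" using w by blast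
  qed
  moreover have "?K \<inter> ?R = {0}"
  proof (rule equalityI; rule subsetI)
    fix v assume "v \<in> ?K \<inter> ?R"
    then obtain w where w: "w \<in> W" "v = L (A w)" "A v = 0" by auto
    then have "A w = 0" using L(3)[of "A w"] by auto
    then show "v \<in> {0}" using w(2) linear_0[OF L(1)] by simp
  next
    fix v assume "v \<in> {0::'a}"
    then show "v \<in> ?K \<inter> ?R" using subspace_0[OF K] subspace_0[OF R] by simp
  qed
  moreover have "dim ?R = dim (A ` W)"
  proof (rule dim_image_eq[OF L(1)])
    have "span (A ` W) = A ` W" using AW by (simp add: span_eq_iff)
    then show "inj_on L (span (A ` W))" using L(3) by (metis inj_on_inverseI)
  qed
  ultimately show ?thesis by simp
qed

text \<open>In the straightened chart centred at \<open>x0\<close>, the equation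
  \<open>F x = F x0\<close> says that the linear map \<open>A\<close> vanishes on the coordinates.
  Its kernel on the model subspace is therefore the subspace that defines a slice chart.\<close>

lemma regular_zero_set:
  assumes M: "smooth_manifold M" and U: "(U, \<phi>) \<in> maximal_atlas M" "x0 \<in> U"
    and F: "smooth_wrt \<phi> U F" "\<And>x. x \<in> U \<Longrightarrow> F x - F x0 \<in> D ` span (\<phi> ` U)"
    and D: "((F \<circ> inv_into U \<phi>) has_derivative D) (at (\<phi> x0) within \<phi> ` U)"
    and S: "\<And>x. x \<in> U \<Longrightarrow> x \<in> S \<longleftrightarrow> F x = F x0"
  shows "x0 \<in> \<Union> (fst ` charts (submanifold M S (mdim M - dim (D ` span (\<phi> ` U)))))"
proof -
  let ?W = "span (\<phi> ` U)"
  show ?thesis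
  proof (rule straightened_chart[OF M U F D])
    fix U' \<phi>' A L
    assume *: "(U', \<phi>') \<in> maximal_atlas M" "x0 \<in> U'" "U' \<subseteq> U" "\<phi>' x0 = 0"
      "span (\<phi>' ` U') = ?W" "linear A" "A ` ?W = D ` ?W"
      "\<And>y. y \<in> U' \<Longrightarrow> A (\<phi>' y) = F y - F x0"
      "linear L" "range L \<subseteq> ?W" "\<And>z. z \<in> D ` ?W \<Longrightarrow> A (L z) = z"
    let ?K = "{w \<in> ?W. A w = 0}"
    have "dim ?K = dim ?W - dim (A ` ?W)"
      by (rule dim_kernel_on_subspace[OF *(6) subspace_span *(9,10)]) (use *(7,11) in auto)
    moreover have "dim ?W = mdim M"
      by (rule is_chart_subspace(1)[OF maximal_atlas_is_chart[OF U(1)]]) (use U(2) in auto)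
    ultimately have dim: "dim ?K = mdim M - dim (D ` ?W)" using *(7) by simp
    have "subspace ?K"
      by (auto simp: subspace_def linear_0[OF *(6)] linear_add[OF *(6)] linear_scale[OF *(6)] span_0 span_add span_scale)
    moreover have "\<phi>' ` (U' \<inter> S) = \<phi>' ` U' \<inter> ?K"
    proof -
      have "x \<in> S \<longleftrightarrow> \<phi>' x \<in> ?K" if x: "x \<in> U'" for x
      proof -
        have "\<phi>' x \<in> ?W" using *(5) x span_base[of "\<phi>' x" "\<phi>' ` U'"] by auto
        then show ?thesis using S[of x] *(3,8) x by auto
      qed
      then show ?thesis by auto
    qed
    moreover have "?K \<subseteq> span (\<phi>' ` U')" using *(5) by auto
    ultimately have "(U' \<inter> S, \<phi>') \<in> charts (submanifold M S (mdim M - dim (D ` ?W)))"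
      unfolding submanifold_def using *(1) dim by auto
    moreover have "x0 \<in> U' \<inter> S" using *(2) S U(2) by auto
    ultimately show ?thesis by force
  qed
qed

lemma embedded_submanifoldI:
  assumes "S \<subseteq> points M" "\<And>x. x \<in> S \<Longrightarrow> x \<in> \<Union> (fst ` charts (submanifold M S k))"
  shows "embedded_submanifold M S k"
proof -
  have "fst c \<subseteq> S" if "c \<in> charts (submanifold M S k)" for c
    using submanifold_chartsE[OF that] by (metis fst_conv inf_le2)
  then show ?thesis unfolding embedded_submanifold_def using assms by blast
qed

text \<open>Near a point of the level set the equation is read in a chart \<psi> of
  \<open>N\<close>. The derivative of \<open>\<psi> \<circ> f\<close> is onto the model space of
  \<open>N\<close>, so the codimension is \<open>mdim N\<close>. A value \<open>c\<close> that is
  not attained gives the empty set, with nothing to check.\<close>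

lemma embedded_level_set:
  assumes M: "smooth_manifold M" and N: "smooth_manifold N" and f: "submersion M N f"
  shows "embedded_submanifold M {x \<in> points M. f x = c} (mdim M - mdim N)"
proof (rule embedded_submanifoldI)
  let ?S = "{x \<in> points M. f x = c}"
  fix x assume "x \<in> ?S"
  then have x: "x \<in> points M" "f x = c" by auto
  have sm: "smooth_map M N f" using f by (simp add: submersion_def)
  obtain U \<phi> where U: "(U, \<phi>) \<in> maximal_atlas M" "x \<in> U" using maximal_atlas_cover[OF M x(1)] .
  obtain V \<psi> where V: "(V, \<psi>) \<in> maximal_atlas N" "f x \<in> V"
    using maximal_atlas_cover[OF N smooth_map_points[OF sm x(1)]] .
  note chV = maximal_atlas_is_chart[OF V(1)]
  let ?U = "{y \<in> U. f y \<in> V}"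
  note s = smooth_map_chart[OF M N sm U(1) V(1)]
  have xU: "x \<in> ?U" using U V by auto
  obtain \<sigma> V' where *: "(V', \<psi>) \<in> maximal_atlas N" "V' \<subseteq> V" "f x \<in> V'" "\<sigma> (f x) = x" "\<sigma> ` V' \<subseteq> ?U"
    "smooth_wrt \<psi> V' (\<lambda>y. \<phi> (\<sigma> y))" "\<forall>y\<in>V'. f (\<sigma> y) = y" "span (\<psi> ` V') = span (\<psi> ` V)"
    by (rule local_section_charts[OF M N submersion_local_section[OF M N f x(1)] s(1) xU V])
  have 1: "\<psi> (f y) - 0 \<in> span (\<psi> ` V')" if "y \<in> ?U" for y
    unfolding *(8) using that by (auto intro!: span_base)
  have 2: "\<psi> (f (\<sigma> z)) = \<psi> z - 0" if "z \<in> V'" for z using bspec[OF *(7) that] by simp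
  obtain D where D': "(((\<lambda>y. \<psi> (f y)) \<circ> inv_into ?U \<phi>) has_derivative D) (at (\<phi> (\<sigma> (f x))) within \<phi> ` ?U)"
    "D ` span (\<phi> ` ?U) = span (\<psi> ` V')"
    by (rule derivative_onto[OF maximal_atlas_is_chart[OF s(1)] maximal_atlas_is_chart[OF *(1)] s(2) 1 *(3,5,6) 2])
  note D = D'[unfolded *(4,8)]
  have Vne: "V \<noteq> {}" using V(2) by auto
  have 3: "\<psi> (f y) - \<psi> (f x) \<in> D ` span (\<phi> ` ?U)" if "y \<in> ?U" for y
    unfolding D(2) by (intro span_diff span_base imageI) (use that V(2) in auto)
  have 4: "y \<in> ?S \<longleftrightarrow> \<psi> (f y) = \<psi> (f x)" if "y \<in> ?U" for y
    using that maximal_atlas_subset[OF U(1)] is_chart_inj[OF chV] V(2) x(2) by (auto dest: inj_onD)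
  have dim: "dim (D ` span (\<phi> ` ?U)) = mdim N"
    unfolding D(2) by (rule is_chart_subspace(1)[OF chV Vne])
  show "x \<in> \<Union> (fst ` charts (submanifold M ?S (mdim M - mdim N)))"
    using regular_zero_set[OF M s(1) xU s(2) 3 D(1), of ?S] 4 unfolding dim by blast
qed auto

text \<open>Comparing \<open>f x\<close> and \<open>g y\<close> in one chart \<psi> turns the
  condition into the vanishing of a difference \<open>F\<close> with values in a linear space. Its
  derivative is onto because of \<open>f\<close> alone: a section of \<open>f\<close>, with the
  second component kept at \<open>y\<close>, is a right inverse of \<open>F\<close> up to a
  constant.\<close>

lemma embedded_fibre_product:
  assumes M: "smooth_manifold M" and N: "smooth_manifold N" and Z: "smooth_manifold Z"
    and f: "submersion M Z f" and g: "smooth_map N Z g"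
  shows "embedded_submanifold (prod_manifold M N) {(x, y). x \<in> points M \<and> y \<in> points N \<and> f x = g y}
    (mdim M + mdim N - mdim Z)"
proof (rule embedded_submanifoldI)
  let ?P = "prod_manifold M N"
  let ?S = "{(x, y). x \<in> points M \<and> y \<in> points N \<and> f x = g y}"
  note P = smooth_manifold_prod[OF M N]
  show "?S \<subseteq> points ?P" by auto
  fix p assume "p \<in> ?S"
  then obtain x y where p: "p = (x, y)" "x \<in> points M" "y \<in> points N" "f x = g y" by auto
  have sm: "smooth_map M Z f" using f by (simp add: submersion_def)
  obtain U \<phi> where U: "(U, \<phi>) \<in> charts M" "x \<in> U" using charts_cover[OF M p(2)] .
  obtain T \<tau> where T: "(T, \<tau>) \<in> charts N" "y \<in> T" using charts_cover[OF N p(3)] .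
  obtain V \<psi> where V: "(V, \<psi>) \<in> maximal_atlas Z" "f x \<in> V"
    using maximal_atlas_cover[OF Z smooth_map_points[OF sm p(2)]] .
  have max: "(U, \<phi>) \<in> maximal_atlas M" "(T, \<tau>) \<in> maximal_atlas N"
    using U T charts_subset_maximal_atlas M N by auto
  note chV = maximal_atlas_is_chart[OF V(1)]
  let ?U = "{x \<in> U. f x \<in> V}"
  let ?T = "{y \<in> T. g y \<in> V}"
  let ?\<phi> = "map_prod \<phi> \<tau>"
  define F where "F q = \<psi> (f (fst q)) - \<psi> (g (snd q))" for q
  note s = smooth_map_chart[OF M Z sm max(1) V(1)] and t = smooth_map_chart[OF N Z g max(2) V(1)]
  have chart: "(?U \<times> ?T, ?\<phi>) \<in> maximal_atlas ?P"
  proof (rule maximal_atlas_restrict[OF P])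
    show "(U \<times> T, ?\<phi>) \<in> maximal_atlas ?P"
      using prod_manifold_charts[OF U(1) T(1)] charts_subset_maximal_atlas[OF P] by auto
    show "openin (mtop ?P) (?U \<times> ?T)"
      using is_chart_openin[OF maximal_atlas_is_chart[OF s(1)]] is_chart_openin[OF maximal_atlas_is_chart[OF t(1)]]
      by (simp add: openin_prod_Times_iff)
  qed auto
  note ch = maximal_atlas_is_chart[OF chart]
  have xU: "x \<in> ?U" and yT: "y \<in> ?T" using U T V p by auto
  have F: "smooth_wrt ?\<phi> (?U \<times> ?T) F"
  proof -
    have "smooth_wrt ?\<phi> (?U \<times> ?T) (map_prod (\<lambda>x. \<psi> (f x)) (\<lambda>y. \<psi> (g y)))"
      by (rule smooth_wrt_map_prod[OF s(2) t(2)])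
    from smooth_wrt_diff[OF smooth_wrt_linear[OF bounded_linear_fst this] smooth_wrt_linear[OF bounded_linear_snd this]]
    show ?thesis unfolding F_def by simp
  qed
  obtain \<sigma> V' where *: "(V', \<psi>) \<in> maximal_atlas Z" "V' \<subseteq> V" "f x \<in> V'" "\<sigma> (f x) = x" "\<sigma> ` V' \<subseteq> ?U"
    "smooth_wrt \<psi> V' (\<lambda>y. \<phi> (\<sigma> y))" "\<forall>y\<in>V'. f (\<sigma> y) = y" "span (\<psi> ` V') = span (\<psi> ` V)"
    by (rule local_section_charts[OF M Z submersion_local_section[OF M Z f p(2)] s(1) xU V])
  have 1: "F q - 0 \<in> span (\<psi> ` V')" if "q \<in> ?U \<times> ?T" for q
    unfolding *(8) F_def diff_zero by (intro span_diff span_base imageI) (use that in auto)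
  \<comment> \<open>The constant \<open>\<psi> (g y)\<close> is the translation allowed in
    \<open>derivative_onto\<close>.\<close>
  have 2: "F (\<sigma> z, y) = \<psi> z - \<psi> (g y)" if "z \<in> V'" for z using bspec[OF *(7) that] by (simp add: F_def)
  have 3: "(\<lambda>z. (\<sigma> z, y)) ` V' \<subseteq> ?U \<times> ?T" using *(5) yT by blast
  have 4: "smooth_wrt \<psi> V' (\<lambda>z. ?\<phi> (\<sigma> z, y))"
    unfolding map_prod_simp by (rule smooth_wrt_Pair[OF *(6) smooth_wrt_const])
  obtain D where D': "((F \<circ> inv_into (?U \<times> ?T) ?\<phi>) has_derivative D) (at (?\<phi> (\<sigma> (f x), y)) within ?\<phi> ` (?U \<times> ?T))"
    "D ` span (?\<phi> ` (?U \<times> ?T)) = span (\<psi> ` V')"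
    by (rule derivative_onto[OF ch maximal_atlas_is_chart[OF *(1)] F 1 *(3) 3 4 2])
  note D = D'[unfolded *(4,8), folded p(1)]
  have Fp: "F p = 0" using p by (simp add: F_def)
  have Vne: "V \<noteq> {}" using V(2) by auto
  have 5: "F q - F p \<in> D ` span (?\<phi> ` (?U \<times> ?T))" if "q \<in> ?U \<times> ?T" for q
    unfolding D(2) Fp using 1[OF that] *(8) by simp
  have 6: "q \<in> ?S \<longleftrightarrow> F q = F p" if "q \<in> ?U \<times> ?T" for q
  proof -
    obtain a b where q: "q = (a, b)" "a \<in> ?U" "b \<in> ?T" using \<open>q \<in> ?U \<times> ?T\<close> by (elim SigmaE)
    then have "a \<in> points M" "b \<in> points N" "f a \<in> V" "g b \<in> V"
      using maximal_atlas_subset[OF max(1)] maximal_atlas_subset[OF max(2)] by auto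
    then show ?thesis
      unfolding Fp unfolding q(1) F_def using is_chart_inj[OF chV] by (auto dest: inj_onD)
  qed
  have dim: "dim (D ` span (?\<phi> ` (?U \<times> ?T))) = mdim Z"
    unfolding D(2) by (rule is_chart_subspace(1)[OF chV Vne])
  have pU: "p \<in> ?U \<times> ?T" using xU yT p(1) by simp
  have "p \<in> \<Union> (fst ` charts (submanifold ?P ?S (mdim ?P - mdim Z)))"
    using regular_zero_set[OF P chart pU F 5 D(1), of ?S] 6 unfolding dim by blast
  then show "p \<in> \<Union> (fst ` charts (submanifold ?P ?S (mdim M + mdim N - mdim Z)))" by simp
qed

section \<open>Lie groups, Lie groupoids and principal bundles\<close>

lemma submersion_cong:
  assumes M: "smooth_manifold M" and N: "smooth_manifold N" and f: "submersion M N f"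
    and eq: "\<And>x. x \<in> points M \<Longrightarrow> f x = g x"
  shows "submersion M N g"
proof (rule submersionI[OF M N])
  show "smooth_map M N g"
    by (rule smooth_map_cong[OF M N _ eq]) (use f in \<open>simp_all add: submersion_def\<close>)
  fix x assume x: "x \<in> points M"
  obtain \<sigma> T where *: "openin (mtop N) T" "f x \<in> T" "smooth_at N M \<sigma> (f x)" "\<sigma> (f x) = x"
    "\<forall>y\<in>T. f (\<sigma> y) = y" by (rule local_sectionE[OF submersion_local_section[OF M N f x]])
  \<comment> \<open>The maps agree only on the points of \<open>M\<close>, and \<sigma> may leave
    \<open>M\<close> away from \<open>f x\<close>; the section is restricted to a chart domain on
    which it certainly takes values in \<open>M\<close>.\<close>
  obtain V \<psi> U \<phi> where V: "(V, \<psi>) \<in> maximal_atlas N" "(U, \<phi>) \<in> maximal_atlas M" "f x \<in> V" "\<sigma> ` V \<subseteq> U"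
    using smooth_atE[OF *(3)] by metis
  have "g (\<sigma> y) = y" if "y \<in> T \<inter> V" for y
  proof -
    have "\<sigma> y \<in> points M" using that V(4) maximal_atlas_subset[OF V(2)] by blast
    from eq[OF this] show ?thesis using that *(5) by simp
  qed
  then show "local_section M N g x"
    unfolding local_section_def using * V(3) eq[OF x] is_chart_openin[OF maximal_atlas_is_chart[OF V(1)]]
    by (intro exI[of _ \<sigma>] exI[of _ "T \<inter> V"]) auto
qed

lemma diffeomorphism_inv_into:
  assumes M: "smooth_manifold M" and N: "smooth_manifold N" and f: "diffeomorphism M N f"
  shows "diffeomorphism N M (inv_into (points M) f)"
proof -
  let ?g = "inv_into (points M) f"
  have bij: "bij_betw f (points M) (points N)" and sm: "smooth_map M N f" "smooth_map N M ?g"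
    using f by (auto simp: diffeomorphism_def)
  have gbij: "bij_betw ?g (points N) (points M)" by (rule bij_betw_inv_into[OF bij])
  have "f x = inv_into (points N) ?g x" if x: "x \<in> points M" for x
  proof -
    have "f x \<in> points N" using bij x bij_betwE by blast
    then have "inv_into (points N) ?g (?g (f x)) = f x" using gbij by (simp add: bij_betw_inv_into_left)
    then show ?thesis using bij x by (simp add: bij_betw_inv_into_left)
  qed
  from smooth_map_cong[OF M N sm(1) this] show ?thesis
    unfolding diffeomorphism_def using gbij sm(2) by simp
qed

section \<open>Smooth maps built from Lie group operations\<close>

lemma lie_groupD:
  assumes "lie_group G"
  shows "group G" "smooth_manifold (man G)" "points (man G) = carrier G"
    "smooth_map (prod_manifold (man G) (man G)) (man G) (\<lambda>(x, y). x \<otimes>\<^bsub>G\<^esub> y)"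
    "smooth_map (man G) (man G) (\<lambda>x. inv\<^bsub>G\<^esub> x)"
  using assms by (simp_all add: lie_group_def)

lemma smooth_map_compose2:
  assumes M: "smooth_manifold M" "smooth_manifold N" "smooth_manifold N'" "smooth_manifold Z"
    and F: "smooth_map (prod_manifold N N') Z (\<lambda>(x, y). F x y)"
    and f: "smooth_map M N f" "smooth_map M N' g"
  shows "smooth_map M Z (\<lambda>x. F (f x) (g x))"
  using smooth_map_compose[OF M(1) smooth_manifold_prod[OF M(2,3)] M(4) smooth_map_Pair[OF M(1-3) f] F]
  by simp

lemma smooth_map_mult:
  assumes "lie_group G" "smooth_manifold M" "smooth_map M (man G) f" "smooth_map M (man G) g"
  shows "smooth_map M (man G) (\<lambda>x. f x \<otimes>\<^bsub>G\<^esub> g x)"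
  using smooth_map_compose2[OF assms(2) lie_groupD(2,2,2,4)[OF assms(1)] assms(3,4)] .

lemma smooth_map_inv:
  assumes "lie_group G" "smooth_manifold M" "smooth_map M (man G) f"
  shows "smooth_map M (man G) (\<lambda>x. inv\<^bsub>G\<^esub> (f x))"
  using smooth_map_compose[OF assms(2) lie_groupD(2,2)[OF assms(1)] assms(3) lie_groupD(5)[OF assms(1)]] .

lemma group_orbit_act:
  assumes act: "lie_group_action K M act" and a: "a \<in> carrier K" and x: "x \<in> points M"
  shows "group_orbit K act (act a x) = group_orbit K act x"
proof -
  have K: "group K" and mult: "\<And>g g'. g \<in> carrier K \<Longrightarrow> g' \<in> carrier K \<Longrightarrow> act (g \<otimes>\<^bsub>K\<^esub> g') x = act g (act g' x)"
    using act x by (auto simp: lie_group_action_def lie_group_def)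
  interpret group K by (rule K)
  show ?thesis
    unfolding group_orbit_def
  proof (intro equalityI subsetI)
    fix z assume "z \<in> (\<lambda>g. act g (act a x)) ` carrier K"
    then obtain g where "g \<in> carrier K" "z = act g (act a x)" by (elim imageE)
    then show "z \<in> (\<lambda>g. act g x) ` carrier K"
      using a mult[of g a] by (intro image_eqI[of _ _ "g \<otimes>\<^bsub>K\<^esub> a"]) auto
  next
    fix z assume "z \<in> (\<lambda>g. act g x) ` carrier K"
    then obtain g where g: "g \<in> carrier K" "z = act g x" by (elim imageE)
    have "g \<otimes>\<^bsub>K\<^esub> inv\<^bsub>K\<^esub> a \<otimes>\<^bsub>K\<^esub> a = g" using g(1) a by (simp add: m_assoc)
    then show "z \<in> (\<lambda>g. act g (act a x)) ` carrier K"
      using a g mult[of "g \<otimes>\<^bsub>K\<^esub> inv\<^bsub>K\<^esub> a" a] by (intro image_eqI[of _ _ "g \<otimes>\<^bsub>K\<^esub> inv\<^bsub>K\<^esub> a"]) auto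
  qed
qed

section \<open>Lie groupoids and the Lie 2-group of a crossed module\<close>

lemma lie_groupoid_smooth_manifold:
  assumes "lie_groupoid \<Gamma>"
  shows "smooth_manifold (obj \<Gamma>)" "smooth_manifold (arr \<Gamma>)"
  using assms by (simp_all add: lie_groupoid_def)

lemma lie_groupoid_embedded:
  assumes "lie_groupoid \<Gamma>"
  shows "embedded_submanifold (prod_manifold (arr \<Gamma>) (arr \<Gamma>))
    {(x, y). x \<in> points (arr \<Gamma>) \<and> y \<in> points (arr \<Gamma>) \<and> src \<Gamma> x = tgt \<Gamma> y}
    (mdim (arr \<Gamma>) + mdim (arr \<Gamma>) - mdim (obj \<Gamma>))"
  using assms by (intro embedded_fibre_product) (auto simp: lie_groupoid_def surj_submersion_def submersion_def)

text \<open>Composition is smooth on the submanifold of composable pairs. Two smooth maps with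
  matching ends form a smooth map into it, since smoothness into an embedded submanifold can be
  tested in the product.\<close>

lemma smooth_map_cmp:
  assumes \<Gamma>: "lie_groupoid \<Gamma>" and M: "smooth_manifold M"
    and a: "smooth_map M (arr \<Gamma>) a" and b: "smooth_map M (arr \<Gamma>) b"
    and comp: "\<And>x. x \<in> points M \<Longrightarrow> src \<Gamma> (a x) = tgt \<Gamma> (b x)"
  shows "smooth_map M (arr \<Gamma>) (\<lambda>x. cmp \<Gamma> (a x) (b x))"
proof -
  note A = lie_groupoid_smooth_manifold(2)[OF \<Gamma>]
  note P = smooth_manifold_prod[OF A A] and E = lie_groupoid_embedded[OF \<Gamma>]
  have 1: "smooth_map M (composable_arrows \<Gamma>) (\<lambda>x. (a x, b x))"
    unfolding composable_arrows_def fibre_product_def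
    by (rule smooth_map_into_submanifold[OF M P E smooth_map_Pair[OF M A A a b]])
       (use comp smooth_map_points[OF a] smooth_map_points[OF b] in auto)
  have 2: "smooth_map (composable_arrows \<Gamma>) (arr \<Gamma>) (\<lambda>(a, b). cmp \<Gamma> a b)"
    using \<Gamma> by (simp add: lie_groupoid_def)
  have 3: "smooth_manifold (composable_arrows \<Gamma>)"
    unfolding composable_arrows_def fibre_product_def by (rule smooth_manifold_submanifold[OF P E])
  show ?thesis
    using smooth_map_compose[OF M 3 A 1 2] by simp
qed

lemma crossed_moduleD:
  assumes "crossed_module H G C d"
  shows "lie_group H" "lie_group G" "smooth_map (man H) (man G) d" "d \<in> hom H G"
    "smooth_map (prod_manifold (man G) (man H)) (man H) (\<lambda>(g, h). C g h)"
  using assms by (simp_all add: crossed_module_def lie_group_action_def)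

lemma lie_groupoid_two_group:
  assumes "crossed_module H G C d"
  shows "lie_groupoid (two_group H G d)"
proof -
  note cm = crossed_moduleD[OF assms]
  interpret H: group H using lie_groupD(1)[OF cm(1)] .
  interpret G: group G using lie_groupD(1)[OF cm(2)] .
  interpret d: group_hom H G d
    using cm(4) H.group_axioms G.group_axioms by (simp add: group_hom_def group_hom_axioms_def)
  note MH = lie_groupD(2,3)[OF cm(1)] and MG = lie_groupD(2,3)[OF cm(2)]
  let ?A = "prod_manifold (man H) (man G)"
  note A = smooth_manifold_prod[OF MH(1) MG(1)]
  note f = smooth_map_fst[OF MH(1) MG(1)] and s = smooth_map_snd[OF MH(1) MG(1)]
  note df = smooth_map_compose[OF A MH(1) MG(1) f cm(3)]
  have pts: "points ?A = carrier H \<times> carrier G" using MH(2) MG(2) by simp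
  have src: "(\<lambda>(h, g). g) = (snd :: 'a \<times> 'c \<Rightarrow> 'c)" by auto
  have tgt: "smooth_map ?A (man G) (\<lambda>x. d (fst x) \<otimes>\<^bsub>G\<^esub> snd x)"
    by (rule smooth_map_mult[OF cm(2) A df s])
  have s_src: "surj_submersion ?A (man G) (\<lambda>(h, g). g)"
    unfolding src surj_submersion_def using submersion_snd[OF MH(1) MG(1)] pts MG(2) by force
  have "submersion ?A (man G) (\<lambda>x. d (fst x) \<otimes>\<^bsub>G\<^esub> snd x)"
  proof (rule submersionI[OF A MG(1) tgt])
    fix x assume x: "x \<in> points ?A"
    then obtain h g where hg: "x = (h, g)" "h \<in> carrier H" "g \<in> carrier G" using pts by auto
    \<comment> \<open>A section of the target map that keeps \<open>h\<close> fixed and solves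
      \<open>d h \<otimes> g' = y\<close> for \<open>g'\<close>.\<close>
    let ?\<sigma> = "\<lambda>y. (h, inv\<^bsub>G\<^esub> (d h) \<otimes>\<^bsub>G\<^esub> y)"
    have "smooth_map (man G) ?A ?\<sigma>"
      by (intro smooth_map_Pair smooth_map_mult smooth_map_const smooth_map_ident MH(1) MG(1) cm(2))
         (use hg MH(2) MG(2) in auto)
    then have "smooth_at (man G) ?A ?\<sigma> (d h \<otimes>\<^bsub>G\<^esub> g)"
      using hg MG(2) by (simp add: smooth_map_iff[OF MG(1) A])
    then show "local_section ?A (man G) (\<lambda>x. d (fst x) \<otimes>\<^bsub>G\<^esub> snd x) x"
      unfolding local_section_def using hg MG(2)
      by (intro exI[of _ ?\<sigma>] exI[of _ "carrier G"]) (auto simp: G.m_assoc[symmetric] openin_topspace[of "mtop (man G)", unfolded MG(2)])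
  qed
  moreover have "(\<lambda>x. d (fst x) \<otimes>\<^bsub>G\<^esub> snd x) ` points ?A = points (man G)"
  proof (intro equalityI subsetI)
    fix g assume "g \<in> points (man G)"
    then show "g \<in> (\<lambda>x. d (fst x) \<otimes>\<^bsub>G\<^esub> snd x) ` points ?A"
      unfolding pts MG(2) by (intro image_eqI[of _ _ "(\<one>\<^bsub>H\<^esub>, g)"]) auto
  qed (auto simp: MH(2) MG(2))
  ultimately have s_tgt: "surj_submersion ?A (man G) (\<lambda>(h, g). d h \<otimes>\<^bsub>G\<^esub> g)"
    by (simp add: surj_submersion_def case_prod_beta')
  have tgt': "smooth_map ?A (man G) (\<lambda>(h, g). d h \<otimes>\<^bsub>G\<^esub> g)" using tgt by (simp add: case_prod_beta')
  note AA = smooth_manifold_prod[OF A A] and fA = smooth_map_fst[OF A A] and sA = smooth_map_snd[OF A A]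
  \<comment> \<open>The formula makes sense for arbitrary pairs of arrows, composable or not; the
    required smoothness is obtained by restriction to the composable ones.\<close>
  have cmp: "smooth_map (prod_manifold ?A ?A) ?A (\<lambda>z. (fst (fst z) \<otimes>\<^bsub>H\<^esub> fst (snd z), snd (snd z)))"
    by (intro smooth_map_Pair[OF AA MH(1) MG(1)] smooth_map_mult[OF cm(1) AA]
        smooth_map_compose[OF AA A MH(1) fA f] smooth_map_compose[OF AA A MH(1) sA f]
        smooth_map_compose[OF AA A MG(1) sA s])
  have E: "embedded_submanifold (prod_manifold ?A ?A)
      {(x, y). x \<in> points ?A \<and> y \<in> points ?A \<and> (\<lambda>(h, g). g) x = (\<lambda>(h, g). d h \<otimes>\<^bsub>G\<^esub> g) y}
      (mdim ?A + mdim ?A - mdim (man G))"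
    by (rule embedded_fibre_product[OF A A MG(1) _ tgt']) (use s_src in \<open>simp add: surj_submersion_def\<close>)
  have "smooth_map (composable_arrows (two_group H G d)) ?A
      (\<lambda>z. (fst (fst z) \<otimes>\<^bsub>H\<^esub> fst (snd z), snd (snd z)))"
    using smooth_map_restrict[OF AA A E cmp]
    by (simp add: composable_arrows_def fibre_product_def two_group_def)
  then have cmp': "smooth_map (composable_arrows (two_group H G d)) ?A
      (\<lambda>(a, b). (\<lambda>(h\<^sub>2, g\<^sub>2) (h\<^sub>1, g\<^sub>1). (h\<^sub>2 \<otimes>\<^bsub>H\<^esub> h\<^sub>1, g\<^sub>1)) a b)"
    by (simp add: case_prod_beta')
  have "smooth_map (man G) ?A (\<lambda>g. (\<one>\<^bsub>H\<^esub>, g))"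
    by (intro smooth_map_Pair smooth_map_const smooth_map_ident MH(1) MG(1)) (simp add: MH(2))
  moreover have "smooth_map ?A ?A (\<lambda>x. (inv\<^bsub>H\<^esub> (fst x), d (fst x) \<otimes>\<^bsub>G\<^esub> snd x))"
    by (intro smooth_map_Pair[OF A MH(1) MG(1)] smooth_map_inv[OF cm(1) A f] tgt)
  then have "smooth_map ?A ?A (\<lambda>(h, g). (inv\<^bsub>H\<^esub> h, d h \<otimes>\<^bsub>G\<^esub> g))" by (simp add: case_prod_beta')
  ultimately show ?thesis
    unfolding lie_groupoid_def
    using MG(1) A s_src s_tgt cmp'
    by (simp add: two_group_def MH(2) MG(2) H.m_assoc G.m_assoc[symmetric])
qed

text \<open>Invariance and transitivity say that the orbits are exactly the fibres of
  \<open>Pr\<close>. The orbit set is thus in bijection with \<open>N\<close> and takes its smooth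
  structure from there; the orbit map becomes \<open>Pr\<close> followed by a diffeomorphism, hence
  a submersion.\<close>

lemma principal_groupoid_bundleI:
  fixes N :: "('n, 'en::euclidean_space) manifold"
  assumes act: "groupoid_action \<Gamma> B \<rho> star" and N: "smooth_manifold N" and Pr: "surj_submersion B N Pr"
    and inv: "\<And>\<gamma> b. \<gamma> \<in> points (arr \<Gamma>) \<Longrightarrow> b \<in> points B \<Longrightarrow> src \<Gamma> \<gamma> = \<rho> b \<Longrightarrow>
      star \<gamma> b \<in> points B \<and> Pr (star \<gamma> b) = Pr b"
    and trans: "\<And>b b'. b \<in> points B \<Longrightarrow> b' \<in> points B \<Longrightarrow> Pr b = Pr b' \<Longrightarrow>
      \<exists>\<gamma>\<in>points (arr \<Gamma>). src \<Gamma> \<gamma> = \<rho> b \<and> b' = star \<gamma> b"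
  shows "principal_groupoid_bundle \<Gamma> B \<rho> star N Pr"
proof -
  let ?o = "groupoid_orbit \<Gamma> \<rho> star"
  have B: "smooth_manifold B" using act by (simp add: groupoid_action_def)
  have sm: "submersion B N Pr" "Pr ` points B = points N" using Pr by (auto simp: surj_submersion_def)
  have orb: "?o b = {b' \<in> points B. Pr b' = Pr b}" if b: "b \<in> points B" for b
  proof (intro equalityI subsetI)
    fix b' assume "b' \<in> ?o b"
    then show "b' \<in> {b' \<in> points B. Pr b' = Pr b}" using inv[OF _ b] by (auto simp: groupoid_orbit_def)
  next
    fix b' assume "b' \<in> {b' \<in> points B. Pr b' = Pr b}"
    then show "b' \<in> ?o b" using trans[OF b, of b'] by (auto simp: groupoid_orbit_def)
  qed
  \<comment> \<open>Any representative serves, because \<open>Pr\<close> is constant on each orbit;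
    on orbits this is the induced bijection to \<open>N\<close>.\<close>
  define F where "F O' = Pr (SOME b. b \<in> O')" for O'
  have F: "F (?o b) = Pr b" if b: "b \<in> points B" for b
  proof -
    have "b \<in> ?o b" using b orb[OF b] by simp
    then have "(SOME b'. b' \<in> ?o b) \<in> ?o b" by (rule someI)
    then show ?thesis unfolding F_def orb[OF b] by simp
  qed
  let ?A = "?o ` points B"
  have bij: "bij_betw F ?A (points N)"
    unfolding bij_betw_def
  proof
    show "inj_on F ?A" using F orb by (auto simp: inj_on_def)
    show "F ` ?A = points N" using F sm(2) by (simp add: image_image)
  qed
  let ?Q = "transport_manifold ?A F N"
  note Q = transport_manifold[OF N bij]
  note inv_diff = diffeomorphism_inv_into[OF Q(2) N Q(3)]
  have "submersion B ?Q (\<lambda>b. inv_into (points ?Q) F (Pr b))"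
    by (rule submersion_compose[OF B N Q(2) sm(1) diffeomorphism_submersion[OF N Q(2) inv_diff]])
  moreover have "inv_into (points ?Q) F (Pr b) = ?o b" if b: "b \<in> points B" for b
    unfolding Q(1) using bij_betw_inv_into_left[OF bij, of "?o b"] F[OF b] b by simp
  ultimately have "submersion B ?Q ?o" by (rule submersion_cong[OF B Q(2)])
  then have "quotient_manifold B ?o ?Q"
    unfolding quotient_manifold_def surj_submersion_def using Q by simp
  then show ?thesis
    unfolding principal_groupoid_bundle_def using act N Pr inv F Q(3) by blast
qed

section \<open>The bundle gerbe of a trivial base bundle groupoid\<close>

locale trivial_base_bundle_groupoid =
  fixes H :: "('h, 'eh::euclidean_space) lie_grp"
    and G :: "('g, 'eg::euclidean_space) lie_grp"
    and C :: "'g \<Rightarrow> 'h \<Rightarrow> 'h"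
    and d :: "'h \<Rightarrow> 'g"
    and Y :: "('y, 'ey::euclidean_space, 'c, 'ec::euclidean_space) groupoid"
    and P :: "('p, 'ep::euclidean_space, 'a, 'ea::euclidean_space) groupoid"
    and act1 :: "'h \<times> 'g \<Rightarrow> 'a \<Rightarrow> 'a"
    and act0 :: "'g \<Rightarrow> 'p \<Rightarrow> 'p"
    and \<pi> :: "'a \<Rightarrow> 'c"
    and \<pi>\<^sub>0 :: "'p \<Rightarrow> 'y"
    and \<tau> :: "'p \<Rightarrow> 'g \<times> 'y"
  assumes principal: "principal_bundle_groupoid H G C d P act1 act0 Y \<pi> \<pi>\<^sub>0"
    and triv: "trivialization G (obj P) act0 (obj Y) \<pi>\<^sub>0 \<tau>"
begin

definition "pr p = fst (\<tau> p)"
definition "sG \<xi> = pr (src P \<xi>)"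
definition "B = {\<xi> \<in> points (arr P). sG \<xi> = \<one>\<^bsub>G\<^esub>}"
definition "BM = submanifold (arr P) B (mdim (arr P) - mdim (man G))"
definition "\<rho> b = inv\<^bsub>G\<^esub> (pr (tgt P b))"
definition "retr \<xi> = act1 (\<one>\<^bsub>H\<^esub>, inv\<^bsub>G\<^esub> (sG \<xi>)) \<xi>"
definition star :: "'h \<times> 'g \<Rightarrow> 'a \<Rightarrow> 'a" where
  "star = (\<lambda>(h, g) b. act1 (C (inv\<^bsub>G\<^esub> (\<rho> b)) (inv\<^bsub>H\<^esub> h), \<one>\<^bsub>G\<^esub>) b)"
definition "gcmp b\<^sub>2 b\<^sub>1 = cmp P (act1 (\<one>\<^bsub>H\<^esub>, inv\<^bsub>G\<^esub> (\<rho> b\<^sub>1)) b\<^sub>2) b\<^sub>1"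
text \<open>The unit arrow of \<open>P\<close> at the object over \<open>y\<close> whose
  \<open>G\<close>-component is \<open>e\<close>, so that its source lies at the level defining
  \<open>B\<close>.\<close>

definition "gunit y = unit_arr P (inv_into (points (obj P)) \<tau> (\<one>\<^bsub>G\<^esub>, y))"
text \<open>The inverse arrow in \<open>P\<close> starts at the target of \<open>b\<close>, whose
  \<open>G\<close>-component is the inverse of \<open>\<rho> b\<close>; translation by
  \<open>\<rho> b\<close> brings its source back to \<open>e\<close>.\<close>

definition "ginv b = act1 (\<one>\<^bsub>H\<^esub>, \<rho> b) (inv_arr P b)"

abbreviation "A \<equiv> points (arr P)"
abbreviation "Ob \<equiv> points (obj P)"

section \<open>Laws of the crossed module, of the groupoid and of the actions\<close>

lemma cm: "crossed_module H G C d" and Y: "lie_groupoid Y" and P: "lie_groupoid P"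
  and lact1: "lie_group_action (semidirect H G C) (arr P) act1"
  and lact0: "lie_group_action G (obj P) act0"
  and mor: "lie_groupoid_morphism (prod_groupoid (two_group H G d) P) P
      (\<lambda>(a, \<xi>). act1 a \<xi>) (\<lambda>(g, p). act0 g p)"
  using principal by (simp_all add: principal_bundle_groupoid_def lie_2group_action_def)

lemmas lgH = crossed_moduleD(1)[OF cm] and lgG = crossed_moduleD(2)[OF cm]
lemmas MH = lie_groupD(2,3)[OF lgH] and MG = lie_groupD(2,3)[OF lgG]
lemmas MOb = lie_groupoid_smooth_manifold(1)[OF P] and MA = lie_groupoid_smooth_manifold(2)[OF P]
lemmas MY0 = lie_groupoid_smooth_manifold(1)[OF Y] and MY1 = lie_groupoid_smooth_manifold(2)[OF Y]

sublocale H: group H using lie_groupD(1)[OF lgH] .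
sublocale G: group G using lie_groupD(1)[OF lgG] .
sublocale d: group_hom H G d
  using crossed_moduleD(4)[OF cm] H.group_axioms G.group_axioms by (simp add: group_hom_def group_hom_axioms_def)

lemma C_iso: "g \<in> carrier G \<Longrightarrow> C g \<in> iso H H"
  and d_C: "g \<in> carrier G \<Longrightarrow> h \<in> carrier H \<Longrightarrow> d (C g h) = g \<otimes>\<^bsub>G\<^esub> d h \<otimes>\<^bsub>G\<^esub> inv\<^bsub>G\<^esub> g"
  and C_d: "h \<in> carrier H \<Longrightarrow> h' \<in> carrier H \<Longrightarrow> C (d h) h' = h \<otimes>\<^bsub>H\<^esub> h' \<otimes>\<^bsub>H\<^esub> inv\<^bsub>H\<^esub> h"
  and C_one: "h \<in> carrier H \<Longrightarrow> C \<one>\<^bsub>G\<^esub> h = h"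
  and C_comp: "g \<in> carrier G \<Longrightarrow> g' \<in> carrier G \<Longrightarrow> h \<in> carrier H \<Longrightarrow> C (g \<otimes>\<^bsub>G\<^esub> g') h = C g (C g' h)"
  using cm MH(2) by (simp_all add: crossed_module_def lie_group_action_def)

lemma C_hom: "g \<in> carrier G \<Longrightarrow> group_hom H H (C g)"
  using C_iso[of g] H.group_axioms by (simp add: group_hom_def group_hom_axioms_def iso_def)

lemma C_closed [simp]: "g \<in> carrier G \<Longrightarrow> h \<in> carrier H \<Longrightarrow> C g h \<in> carrier H"
  by (rule group_hom.hom_closed[OF C_hom])

lemma C_mult: "g \<in> carrier G \<Longrightarrow> h \<in> carrier H \<Longrightarrow> h' \<in> carrier H \<Longrightarrow> C g (h \<otimes>\<^bsub>H\<^esub> h') = C g h \<otimes>\<^bsub>H\<^esub> C g h'"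
  by (rule group_hom.hom_mult[OF C_hom])

lemma C_H_one [simp]: "g \<in> carrier G \<Longrightarrow> C g \<one>\<^bsub>H\<^esub> = \<one>\<^bsub>H\<^esub>"
  by (rule group_hom.hom_one[OF C_hom])

lemma C_inv: "g \<in> carrier G \<Longrightarrow> h \<in> carrier H \<Longrightarrow> C g (inv\<^bsub>H\<^esub> h) = inv\<^bsub>H\<^esub> (C g h)"
  by (rule group_hom.hom_inv[OF C_hom])

lemma act1_closed [simp]: "h \<in> carrier H \<Longrightarrow> g \<in> carrier G \<Longrightarrow> \<xi> \<in> A \<Longrightarrow> act1 (h, g) \<xi> \<in> A"
  and act1_one [simp]: "\<xi> \<in> A \<Longrightarrow> act1 (\<one>\<^bsub>H\<^esub>, \<one>\<^bsub>G\<^esub>) \<xi> = \<xi>"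
  and act1_mult: "h \<in> carrier H \<Longrightarrow> g \<in> carrier G \<Longrightarrow> h' \<in> carrier H \<Longrightarrow> g' \<in> carrier G \<Longrightarrow> \<xi> \<in> A \<Longrightarrow>
      act1 (h, g) (act1 (h', g') \<xi>) = act1 (h \<otimes>\<^bsub>H\<^esub> C g h', g \<otimes>\<^bsub>G\<^esub> g') \<xi>"
proof -
  have man: "man (semidirect H G C) = prod_manifold (man H) (man G)" by (simp add: semidirect_def)
  have sm: "smooth_map (prod_manifold (man (semidirect H G C)) (arr P)) (arr P) (\<lambda>(a, \<xi>). act1 a \<xi>)"
    using lact1 by (simp add: lie_group_action_def)
  show "h \<in> carrier H \<Longrightarrow> g \<in> carrier G \<Longrightarrow> \<xi> \<in> A \<Longrightarrow> act1 (h, g) \<xi> \<in> A"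
    using smooth_map_points[OF sm, of "((h, g), \<xi>)"] by (simp add: man MH(2) MG(2))
  show "\<xi> \<in> A \<Longrightarrow> act1 (\<one>\<^bsub>H\<^esub>, \<one>\<^bsub>G\<^esub>) \<xi> = \<xi>"
    using lact1 by (simp add: lie_group_action_def semidirect_def)
  show "h \<in> carrier H \<Longrightarrow> g \<in> carrier G \<Longrightarrow> h' \<in> carrier H \<Longrightarrow> g' \<in> carrier G \<Longrightarrow> \<xi> \<in> A \<Longrightarrow>
      act1 (h, g) (act1 (h', g') \<xi>) = act1 (h \<otimes>\<^bsub>H\<^esub> C g h', g \<otimes>\<^bsub>G\<^esub> g') \<xi>"
    using lact1 by (simp add: lie_group_action_def semidirect_def)
qed

lemma smooth_act1:
  assumes M: "smooth_manifold M" and "smooth_map M (man H) h" "smooth_map M (man G) g" "smooth_map M (arr P) \<xi>"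
  shows "smooth_map M (arr P) (\<lambda>x. act1 (h x, g x) (\<xi> x))"
proof -
  have "smooth_map (prod_manifold (prod_manifold (man H) (man G)) (arr P)) (arr P) (\<lambda>(a, \<xi>). act1 a \<xi>)"
    using lact1 by (simp add: lie_group_action_def semidirect_def)
  from smooth_map_compose2[OF M smooth_manifold_prod[OF MH(1) MG(1)] MA MA this
      smooth_map_Pair[OF M MH(1) MG(1) assms(2,3)] assms(4)]
  show ?thesis .
qed

lemma smooth_C:
  assumes M: "smooth_manifold M" and "smooth_map M (man G) g" "smooth_map M (man H) h"
  shows "smooth_map M (man H) (\<lambda>x. C (g x) (h x))"
  by (rule smooth_map_compose2[OF M MG(1) MH(1) MH(1) crossed_moduleD(5)[OF cm] assms(2,3)])

lemma act0_closed [simp]: "g \<in> carrier G \<Longrightarrow> p \<in> Ob \<Longrightarrow> act0 g p \<in> Ob"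
  using smooth_map_points[of "prod_manifold (man G) (obj P)" "obj P" "\<lambda>(g, p). act0 g p" "(g, p)"] lact0 MG(2)
  by (simp add: lie_group_action_def)

lemma src_closed [simp]: "\<xi> \<in> A \<Longrightarrow> src P \<xi> \<in> Ob" and tgt_closed [simp]: "\<xi> \<in> A \<Longrightarrow> tgt P \<xi> \<in> Ob"
  using P smooth_map_points[of "arr P" "obj P"] by (auto simp: lie_groupoid_def surj_submersion_def submersion_def)

lemma cmp_closed [simp]: "\<xi> \<in> A \<Longrightarrow> \<eta> \<in> A \<Longrightarrow> src P \<xi> = tgt P \<eta> \<Longrightarrow> cmp P \<xi> \<eta> \<in> A"
proof -
  assume *: "\<xi> \<in> A" "\<eta> \<in> A" "src P \<xi> = tgt P \<eta>"
  have "smooth_map (composable_arrows P) (arr P) (\<lambda>(a, b). cmp P a b)" using P by (simp add: lie_groupoid_def)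
  from smooth_map_points[OF this, of "(\<xi>, \<eta>)"] show ?thesis
    using * by (simp add: composable_arrows_def fibre_product_def)
qed

lemma unit_closed [simp]: "p \<in> Ob \<Longrightarrow> unit_arr P p \<in> A" and inv_closed [simp]: "\<xi> \<in> A \<Longrightarrow> inv_arr P \<xi> \<in> A"
  using P smooth_map_points[of "obj P" "arr P"] smooth_map_points[of "arr P" "arr P"] by (auto simp: lie_groupoid_def)

lemma src_cmp [simp]: "\<xi> \<in> A \<Longrightarrow> \<eta> \<in> A \<Longrightarrow> src P \<xi> = tgt P \<eta> \<Longrightarrow> src P (cmp P \<xi> \<eta>) = src P \<eta>"
  and tgt_cmp [simp]: "\<xi> \<in> A \<Longrightarrow> \<eta> \<in> A \<Longrightarrow> src P \<xi> = tgt P \<eta> \<Longrightarrow> tgt P (cmp P \<xi> \<eta>) = tgt P \<xi>"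
  and cmp_assoc: "\<xi> \<in> A \<Longrightarrow> \<eta> \<in> A \<Longrightarrow> \<zeta> \<in> A \<Longrightarrow> src P \<xi> = tgt P \<eta> \<Longrightarrow> src P \<eta> = tgt P \<zeta> \<Longrightarrow>
    cmp P (cmp P \<xi> \<eta>) \<zeta> = cmp P \<xi> (cmp P \<eta> \<zeta>)"
  and src_unit [simp]: "p \<in> Ob \<Longrightarrow> src P (unit_arr P p) = p" and tgt_unit [simp]: "p \<in> Ob \<Longrightarrow> tgt P (unit_arr P p) = p"
  and cmp_unit_right: "\<xi> \<in> A \<Longrightarrow> cmp P \<xi> (unit_arr P (src P \<xi>)) = \<xi>"
  and cmp_unit_left: "\<xi> \<in> A \<Longrightarrow> cmp P (unit_arr P (tgt P \<xi>)) \<xi> = \<xi>"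
  and src_inv [simp]: "\<xi> \<in> A \<Longrightarrow> src P (inv_arr P \<xi>) = tgt P \<xi>"
  and tgt_inv [simp]: "\<xi> \<in> A \<Longrightarrow> tgt P (inv_arr P \<xi>) = src P \<xi>"
  and cmp_inv_left: "\<xi> \<in> A \<Longrightarrow> cmp P (inv_arr P \<xi>) \<xi> = unit_arr P (src P \<xi>)"
  and cmp_inv_right: "\<xi> \<in> A \<Longrightarrow> cmp P \<xi> (inv_arr P \<xi>) = unit_arr P (tgt P \<xi>)"
  using P by (simp_all add: lie_groupoid_def)

lemma src_act [simp]: "h \<in> carrier H \<Longrightarrow> g \<in> carrier G \<Longrightarrow> \<xi> \<in> A \<Longrightarrow> src P (act1 (h, g) \<xi>) = act0 g (src P \<xi>)"
  and tgt_act [simp]: "h \<in> carrier H \<Longrightarrow> g \<in> carrier G \<Longrightarrow> \<xi> \<in> A \<Longrightarrow>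
    tgt P (act1 (h, g) \<xi>) = act0 (d h \<otimes>\<^bsub>G\<^esub> g) (tgt P \<xi>)"
  and act_unit: "g \<in> carrier G \<Longrightarrow> p \<in> Ob \<Longrightarrow> act1 (\<one>\<^bsub>H\<^esub>, g) (unit_arr P p) = unit_arr P (act0 g p)"
  using mor by (simp_all add: lie_groupoid_morphism_def prod_groupoid_def two_group_def MH(2) MG(2))

text \<open>The interchange law, which is functoriality of the action map on the product groupoid.
  The element acting on \<xi> has second component \<open>d h\<^sub>1 \<otimes> g\<close> because
  its source in the 2-group must be the target of \<open>(h\<^sub>1, g)\<close>.\<close>

lemma act_cmp: "h\<^sub>2 \<in> carrier H \<Longrightarrow> h\<^sub>1 \<in> carrier H \<Longrightarrow> g \<in> carrier G \<Longrightarrow> \<xi> \<in> A \<Longrightarrow> \<eta> \<in> A \<Longrightarrow> src P \<xi> = tgt P \<eta> \<Longrightarrow>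
    act1 (h\<^sub>2 \<otimes>\<^bsub>H\<^esub> h\<^sub>1, g) (cmp P \<xi> \<eta>) = cmp P (act1 (h\<^sub>2, d h\<^sub>1 \<otimes>\<^bsub>G\<^esub> g) \<xi>) (act1 (h\<^sub>1, g) \<eta>)"
proof -
  assume *: "h\<^sub>2 \<in> carrier H" "h\<^sub>1 \<in> carrier H" "g \<in> carrier G" "\<xi> \<in> A" "\<eta> \<in> A" "src P \<xi> = tgt P \<eta>"
  let ?\<Gamma> = "prod_groupoid (two_group H G d) P"
  have "\<forall>a\<in>points (arr ?\<Gamma>). \<forall>b\<in>points (arr ?\<Gamma>). src ?\<Gamma> a = tgt ?\<Gamma> b \<longrightarrow>
    (\<lambda>(a, \<xi>). act1 a \<xi>) (cmp ?\<Gamma> a b) = cmp P ((\<lambda>(a, \<xi>). act1 a \<xi>) a) ((\<lambda>(a, \<xi>). act1 a \<xi>) b)"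
    using mor unfolding lie_groupoid_morphism_def by blast
  from bspec[OF bspec[OF this, of "((h\<^sub>2, d h\<^sub>1 \<otimes>\<^bsub>G\<^esub> g), \<xi>)"], of "((h\<^sub>1, g), \<eta>)"] show ?thesis
    using * by (simp add: prod_groupoid_def two_group_def MH(2) MG(2))
qed

section \<open>Coordinates on the objects\<close>

lemma \<tau>_diff: "diffeomorphism (obj P) (prod_manifold (man G) (obj Y)) \<tau>"
  and snd_\<tau> [simp]: "p \<in> Ob \<Longrightarrow> snd (\<tau> p) = \<pi>\<^sub>0 p"
  and \<tau>_act: "g \<in> carrier G \<Longrightarrow> p \<in> Ob \<Longrightarrow> \<tau> (act0 g p) = (g \<otimes>\<^bsub>G\<^esub> fst (\<tau> p), snd (\<tau> p))"
  using triv by (simp_all add: trivialization_def)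

lemma \<tau>_bij: "bij_betw \<tau> Ob (carrier G \<times> points (obj Y))"
  using \<tau>_diff by (simp add: diffeomorphism_def MG(2))

lemma \<tau>_smooth: "smooth_map (obj P) (prod_manifold (man G) (obj Y)) \<tau>"
  and \<tau>_inv_smooth: "smooth_map (prod_manifold (man G) (obj Y)) (obj P) (inv_into Ob \<tau>)"
  using \<tau>_diff by (simp_all add: diffeomorphism_def)

lemma pr_closed [simp]: "p \<in> Ob \<Longrightarrow> pr p \<in> carrier G"
  and \<pi>\<^sub>0_closed [simp]: "p \<in> Ob \<Longrightarrow> \<pi>\<^sub>0 p \<in> points (obj Y)"
proof -
  assume p: "p \<in> Ob"
  then have *: "\<tau> p \<in> carrier G \<times> points (obj Y)" using \<tau>_bij bij_betwE by blast
  then show "pr p \<in> carrier G" by (auto simp: pr_def)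
  show "\<pi>\<^sub>0 p \<in> points (obj Y)" using * snd_\<tau>[OF p] by (metis mem_Times_iff)
qed

lemma pr_act [simp]: "g \<in> carrier G \<Longrightarrow> p \<in> Ob \<Longrightarrow> pr (act0 g p) = g \<otimes>\<^bsub>G\<^esub> pr p"
  by (simp add: pr_def \<tau>_act)

lemma \<pi>\<^sub>0_act [simp]: "g \<in> carrier G \<Longrightarrow> p \<in> Ob \<Longrightarrow> \<pi>\<^sub>0 (act0 g p) = \<pi>\<^sub>0 p"
  using \<tau>_act[of g p] snd_\<tau>[of "act0 g p"] snd_\<tau>[of p] by simp

text \<open>The identification with \<open>G \<times> Y\<close> is used only through these two
  coordinates; equalities between ends of arrows, such as those making a product composable, are
  checked by comparing them.\<close>

lemma Ob_eqI: "p \<in> Ob \<Longrightarrow> q \<in> Ob \<Longrightarrow> pr p = pr q \<Longrightarrow> \<pi>\<^sub>0 p = \<pi>\<^sub>0 q \<Longrightarrow> p = q"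
  using bij_betw_imp_inj_on[OF \<tau>_bij] snd_\<tau> unfolding pr_def by (metis inj_onD prod_eqI)

lemma \<tau>_inv:
  assumes "g \<in> carrier G" "y \<in> points (obj Y)"
  shows "inv_into Ob \<tau> (g, y) \<in> Ob" "pr (inv_into Ob \<tau> (g, y)) = g" "\<pi>\<^sub>0 (inv_into Ob \<tau> (g, y)) = y"
proof -
  have *: "\<tau> (inv_into Ob \<tau> (g, y)) = (g, y)" using bij_betw_inv_into_right[OF \<tau>_bij] assms by simp
  show 1: "inv_into Ob \<tau> (g, y) \<in> Ob" using bij_betw_inv_into[OF \<tau>_bij] assms bij_betwE by blast
  show "pr (inv_into Ob \<tau> (g, y)) = g" using * by (simp add: pr_def)
  show "\<pi>\<^sub>0 (inv_into Ob \<tau> (g, y)) = y" using * snd_\<tau>[OF 1] by simp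
qed

lemma sG_closed [simp]: "\<xi> \<in> A \<Longrightarrow> sG \<xi> \<in> carrier G"
  by (simp add: sG_def)

lemma sG_act [simp]: "h \<in> carrier H \<Longrightarrow> g \<in> carrier G \<Longrightarrow> \<xi> \<in> A \<Longrightarrow> sG (act1 (h, g) \<xi>) = g \<otimes>\<^bsub>G\<^esub> sG \<xi>"
  by (simp add: sG_def)

lemma \<rho>_closed [simp]: "\<xi> \<in> A \<Longrightarrow> \<rho> \<xi> \<in> carrier G"
  by (simp add: \<rho>_def)

lemma pr_tgt: "\<xi> \<in> A \<Longrightarrow> pr (tgt P \<xi>) = inv\<^bsub>G\<^esub> (\<rho> \<xi>)"
  by (simp add: \<rho>_def)

lemma \<rho>_act: "h \<in> carrier H \<Longrightarrow> g \<in> carrier G \<Longrightarrow> \<xi> \<in> A \<Longrightarrow>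
    \<rho> (act1 (h, g) \<xi>) = inv\<^bsub>G\<^esub> (d h \<otimes>\<^bsub>G\<^esub> g \<otimes>\<^bsub>G\<^esub> inv\<^bsub>G\<^esub> (\<rho> \<xi>))"
  by (simp add: \<rho>_def)

subsection \<open>The projection of the bundle groupoid\<close>

text \<open>All claims are read off from the factorisation of \<open>\<pi>\<close> into the orbit
  map and an isomorphism from the quotient groupoid to \<open>Y\<close>. The fibres of
  \<open>\<pi>\<close> are single orbits because that isomorphism is injective.\<close>

lemma
  shows \<pi>_submersion: "submersion (arr P) (arr Y) \<pi>"
    and \<pi>_surj: "\<pi> ` A = points (arr Y)"
    and \<pi>_act [simp]: "\<And>h g \<xi>. h \<in> carrier H \<Longrightarrow> g \<in> carrier G \<Longrightarrow> \<xi> \<in> A \<Longrightarrow> \<pi> (act1 (h, g) \<xi>) = \<pi> \<xi>"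
    and \<pi>_fibre: "\<And>\<xi> \<xi>'. \<xi> \<in> A \<Longrightarrow> \<xi>' \<in> A \<Longrightarrow> \<pi> \<xi> = \<pi> \<xi>' \<Longrightarrow>
      \<exists>h\<in>carrier H. \<exists>g\<in>carrier G. \<xi>' = act1 (h, g) \<xi>"
    and src_\<pi> [simp]: "\<And>\<xi>. \<xi> \<in> A \<Longrightarrow> src Y (\<pi> \<xi>) = \<pi>\<^sub>0 (src P \<xi>)"
    and tgt_\<pi> [simp]: "\<And>\<xi>. \<xi> \<in> A \<Longrightarrow> tgt Y (\<pi> \<xi>) = \<pi>\<^sub>0 (tgt P \<xi>)"
    and \<pi>_unit: "\<And>p. p \<in> Ob \<Longrightarrow> \<pi> (unit_arr P p) = unit_arr Y (\<pi>\<^sub>0 p)"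
    and \<pi>_cmp: "\<And>\<xi> \<eta>. \<xi> \<in> A \<Longrightarrow> \<eta> \<in> A \<Longrightarrow> src P \<xi> = tgt P \<eta> \<Longrightarrow> \<pi> (cmp P \<xi> \<eta>) = cmp Y (\<pi> \<xi>) (\<pi> \<eta>)"
proof -
  let ?K = "semidirect H G C"
  let ?q = "group_orbit ?K act1" and ?o = "group_orbit G act0"
  have "\<exists>(Q :: ('p set, 'ey, 'a set, 'ec) groupoid) F f.
        quotient_groupoid H G C P act1 act0 Q \<and> lie_groupoid_iso Q Y F f \<and>
        (\<forall>\<xi>\<in>A. \<pi> \<xi> = F (?q \<xi>)) \<and> (\<forall>p\<in>Ob. \<pi>\<^sub>0 p = f (?o p))"
    using principal unfolding principal_bundle_groupoid_def by blast
  then obtain Q :: "('p set, 'ey, 'a set, 'ec) groupoid" and F f where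
    Q: "quotient_groupoid H G C P act1 act0 Q" and iso: "lie_groupoid_iso Q Y F f"
    and F: "\<And>\<xi>. \<xi> \<in> A \<Longrightarrow> \<pi> \<xi> = F (?q \<xi>)" and f: "\<And>p. p \<in> Ob \<Longrightarrow> \<pi>\<^sub>0 p = f (?o p)"
    by (elim exE conjE) simp
  have MQ: "smooth_manifold (arr Q)" and q: "submersion (arr P) (arr Q) ?q" "?q ` A = points (arr Q)"
    and qm: "lie_groupoid_morphism P Q ?q ?o"
    using Q by (auto simp: quotient_groupoid_def quotient_manifold_def surj_submersion_def)
  have Fd: "diffeomorphism (arr Q) (arr Y) F" and Fm: "lie_groupoid_morphism Q Y F f"
    using iso by (auto simp: lie_groupoid_iso_def)
  have Fb: "bij_betw F (points (arr Q)) (points (arr Y))" using Fd by (simp add: diffeomorphism_def)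
  show "submersion (arr P) (arr Y) \<pi>"
    by (rule submersion_cong[OF MA MY1 submersion_compose[OF MA MQ MY1 q(1) diffeomorphism_submersion[OF MQ MY1 Fd]]])
       (simp add: F)
  have "\<pi> ` A = F ` ?q ` A" using F by (simp add: image_image)
  then show "\<pi> ` A = points (arr Y)" using q(2) Fb by (simp add: bij_betw_def)
  show "\<pi> (act1 (h, g) \<xi>) = \<pi> \<xi>" if "h \<in> carrier H" "g \<in> carrier G" "\<xi> \<in> A" for h g \<xi>
    using group_orbit_act[OF lact1, of "(h, g)" \<xi>] that F by (simp add: semidirect_def)
  show "\<exists>h\<in>carrier H. \<exists>g\<in>carrier G. \<xi>' = act1 (h, g) \<xi>" if \<xi>: "\<xi> \<in> A" "\<xi>' \<in> A" "\<pi> \<xi> = \<pi> \<xi>'" for \<xi> \<xi>'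
  proof -
    have "?q \<xi> \<in> points (arr Q)" "?q \<xi>' \<in> points (arr Q)" using q(2) \<xi> by auto
    then have "?q \<xi> = ?q \<xi>'" using \<xi> F bij_betw_imp_inj_on[OF Fb] by (auto dest: inj_onD)
    moreover have "\<xi>' \<in> ?q \<xi>'"
      unfolding group_orbit_def using \<xi>(2)
      by (intro image_eqI[of _ _ "(\<one>\<^bsub>H\<^esub>, \<one>\<^bsub>G\<^esub>)"]) (simp_all add: semidirect_def)
    ultimately have "\<xi>' \<in> ?q \<xi>" by simp
    then show ?thesis unfolding group_orbit_def by (auto simp: semidirect_def)
  qed
  have qp: "?q \<xi> \<in> points (arr Q)" if "\<xi> \<in> A" for \<xi> using q(2) that by auto
  have q0p: "?o p \<in> points (obj Q)" if "p \<in> Ob" for p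
    using smooth_map_points[of "obj P" "obj Q" ?o p] that qm by (simp add: lie_groupoid_morphism_def)
  show s: "src Y (\<pi> \<xi>) = \<pi>\<^sub>0 (src P \<xi>)" "tgt Y (\<pi> \<xi>) = \<pi>\<^sub>0 (tgt P \<xi>)" if "\<xi> \<in> A" for \<xi>
    using qm Fm qp[OF that] that F f by (simp_all add: lie_groupoid_morphism_def)
  show "\<pi> (unit_arr P p) = unit_arr Y (\<pi>\<^sub>0 p)" if "p \<in> Ob" for p
    using qm Fm q0p[OF that] that F f by (simp add: lie_groupoid_morphism_def)
  show "\<pi> (cmp P \<xi> \<eta>) = cmp Y (\<pi> \<xi>) (\<pi> \<eta>)" if "\<xi> \<in> A" "\<eta> \<in> A" "src P \<xi> = tgt P \<eta>" for \<xi> \<eta>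
    using qm Fm qp[OF that(1)] qp[OF that(2)] that F by (simp add: lie_groupoid_morphism_def)
qed

lemma \<pi>_smooth: "smooth_map (arr P) (arr Y) \<pi>"
  using \<pi>_submersion by (simp add: submersion_def)

subsection \<open>The submanifold \<open>B\<close>\<close>

lemma B_A: "b \<in> B \<Longrightarrow> b \<in> A" and sG_B: "b \<in> B \<Longrightarrow> sG b = \<one>\<^bsub>G\<^esub>"
  by (auto simp: B_def)

lemma src_smooth: "smooth_map (arr P) (obj P) (src P)" and tgt_smooth: "smooth_map (arr P) (obj P) (tgt P)"
  using P by (auto simp: lie_groupoid_def surj_submersion_def submersion_def)

lemma pr_smooth: "smooth_map (obj P) (man G) pr"
  using smooth_map_compose[OF MOb smooth_manifold_prod[OF MG(1) MY0] MG(1) \<tau>_smooth smooth_map_fst[OF MG(1) MY0]]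
  by (simp add: pr_def[abs_def])

lemma sG_smooth: "smooth_map (arr P) (man G) sG"
  using smooth_map_compose[OF MA MOb MG(1) src_smooth pr_smooth] by (simp add: sG_def[abs_def])

lemma \<rho>_smooth_A: "smooth_map (arr P) (man G) \<rho>"
  using smooth_map_inv[OF lgG MA smooth_map_compose[OF MA MOb MG(1) tgt_smooth pr_smooth]]
  by (simp add: \<rho>_def[abs_def])

lemma sG_submersion: "submersion (arr P) (man G) sG"
proof -
  note GY = smooth_manifold_prod[OF MG(1) MY0]
  have "submersion (obj P) (man G) (\<lambda>p. fst (\<tau> p))"
    by (rule submersion_compose[OF MOb GY MG(1) diffeomorphism_submersion[OF MOb GY \<tau>_diff] submersion_fst[OF MG(1) MY0]])
  moreover have "submersion (arr P) (obj P) (src P)"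
    using P by (simp add: lie_groupoid_def surj_submersion_def)
  ultimately show ?thesis
    using submersion_compose[OF MA MOb MG(1)] unfolding sG_def[abs_def] pr_def by blast
qed

lemma B_embedded: "embedded_submanifold (arr P) B (mdim (arr P) - mdim (man G))"
  unfolding B_def by (rule embedded_level_set[OF MA MG(1) sG_submersion])

lemma points_BM [simp]: "points BM = B"
  unfolding BM_def by (rule embedded_submanifold_points[OF B_embedded])

lemma MB: "smooth_manifold BM"
  unfolding BM_def by (rule smooth_manifold_submanifold[OF MA B_embedded])

lemma incl_smooth: "smooth_map BM (arr P) (\<lambda>b. b)"
  unfolding BM_def by (rule smooth_map_submanifold_incl[OF MA B_embedded])

lemma smooth_into_BM:
  assumes "smooth_manifold M" "smooth_map M (arr P) f" "\<And>x. x \<in> points M \<Longrightarrow> f x \<in> B"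
  shows "smooth_map M BM f"
  unfolding BM_def by (rule smooth_map_into_submanifold[OF assms(1) MA B_embedded assms(2)]) (use assms(3) in auto)

lemma const_H: "smooth_manifold M \<Longrightarrow> smooth_map M (man H) (\<lambda>_. \<one>\<^bsub>H\<^esub>)"
  and const_G: "smooth_manifold M \<Longrightarrow> smooth_map M (man G) (\<lambda>_. \<one>\<^bsub>G\<^esub>)"
  by (auto intro!: smooth_map_const MH(1) MG(1) simp: MH(2) MG(2))

lemma retr_A [simp]: "\<xi> \<in> A \<Longrightarrow> retr \<xi> \<in> A"
  by (simp add: retr_def)

lemma retr_B [simp]: "\<xi> \<in> A \<Longrightarrow> retr \<xi> \<in> B"
  unfolding B_def by (simp add: retr_def)

lemma \<pi>_retr [simp]: "\<xi> \<in> A \<Longrightarrow> \<pi> (retr \<xi>) = \<pi> \<xi>"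
  by (simp add: retr_def)

lemma retr_id: "b \<in> B \<Longrightarrow> retr b = b"
  by (simp add: retr_def sG_B B_A)

lemma retr_smooth: "smooth_map (arr P) BM retr"
proof (rule smooth_into_BM[OF MA _ retr_B])
  show "smooth_map (arr P) (arr P) retr"
    unfolding retr_def[abs_def]
    by (rule smooth_act1[OF MA const_H[OF MA] smooth_map_inv[OF lgG MA sG_smooth] smooth_map_ident[OF MA]])
qed

text \<open>The inverse is \<open>(g, b) \<mapsto> act1 (e, g) b\<close>, smooth because the action
  is. At \<open>g = e\<close> it reduces to the inclusion of \<open>B\<close>, so the projection
  defined through the inverse is simply \<open>\<pi>\<close> on \<open>B\<close>.\<close>

lemma splitting:
  shows "diffeomorphism (arr P) (prod_manifold (man G) BM) (\<lambda>\<xi>. (sG \<xi>, retr \<xi>))"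
    and "b \<in> B \<Longrightarrow> inv_into A (\<lambda>\<xi>. (sG \<xi>, retr \<xi>)) (\<one>\<^bsub>G\<^esub>, b) = b"
proof -
  let ?\<phi> = "\<lambda>\<xi>. (sG \<xi>, retr \<xi>)" and ?\<psi> = "\<lambda>x. act1 (\<one>\<^bsub>H\<^esub>, fst x) (snd x)"
  note GB = smooth_manifold_prod[OF MG(1) MB]
  have 1: "?\<psi> (?\<phi> \<xi>) = \<xi>" if "\<xi> \<in> A" for \<xi>
    using that by (simp add: retr_def act1_mult)
  have 2: "?\<phi> (?\<psi> x) = x" "?\<psi> x \<in> A" if "x \<in> carrier G \<times> B" for x
  proof -
    obtain g b where "x = (g, b)" by (cases x)
    with that have x: "x = (g, b)" "g \<in> carrier G" "b \<in> B" by auto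
    then show "?\<psi> x \<in> A" by (simp add: B_A)
    show "?\<phi> (?\<psi> x) = x"
      using x by (simp add: retr_def act1_mult B_A sG_B)
  qed
  have bij: "bij_betw ?\<phi> A (carrier G \<times> B)"
    by (rule bij_betw_byWitness[of _ ?\<psi>]) (use 1 2 in auto)
  have inv: "?\<psi> x = inv_into A ?\<phi> x" if "x \<in> carrier G \<times> B" for x
  proof -
    have "inv_into A ?\<phi> (?\<phi> (?\<psi> x)) = ?\<psi> x" by (rule bij_betw_inv_into_left[OF bij 2(2)[OF that]])
    then show ?thesis using 2(1)[OF that] by simp
  qed
  have "smooth_map (prod_manifold (man G) BM) (arr P) ?\<psi>"
    by (rule smooth_act1[OF GB const_H[OF GB] smooth_map_fst[OF MG(1) MB]
          smooth_map_compose[OF GB MB MA smooth_map_snd[OF MG(1) MB] incl_smooth]])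
  then have "smooth_map (prod_manifold (man G) BM) (arr P) (inv_into A ?\<phi>)"
    by (rule smooth_map_cong[OF GB MA]) (use inv MG(2) in auto)
  then show "diffeomorphism (arr P) (prod_manifold (man G) BM) ?\<phi>"
    unfolding diffeomorphism_def
    using bij smooth_map_Pair[OF MA MG(1) MB sG_smooth retr_smooth] by (simp add: MG(2))
  show "b \<in> B \<Longrightarrow> inv_into A ?\<phi> (\<one>\<^bsub>G\<^esub>, b) = b"
    using inv[of "(\<one>\<^bsub>G\<^esub>, b)"] by (simp add: B_A)
qed

lemma \<pi>_BM_submersion: "submersion BM (arr Y) \<pi>"
proof (rule submersion_cancel[OF MA MB MY1 retr_smooth])
  show "retr ` A = points BM"
    using retr_id B_A by (auto intro!: image_eqI[of _ retr])
  show "smooth_map BM (arr Y) \<pi>" by (rule smooth_map_compose[OF MB MA MY1 incl_smooth \<pi>_smooth])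
  show "submersion (arr P) (arr Y) (\<lambda>\<xi>. \<pi> (retr \<xi>))"
    by (rule submersion_cong[OF MA MY1 \<pi>_submersion]) simp
qed

lemma \<pi>_BM_surj: "\<pi> ` B = points (arr Y)"
proof -
  have "\<pi> ` A = \<pi> ` B"
  proof (intro equalityI subsetI)
    fix y assume "y \<in> \<pi> ` A"
    then obtain \<xi> where "\<xi> \<in> A" "y = \<pi> \<xi>" by (elim imageE)
    then show "y \<in> \<pi> ` B" by (intro image_eqI[of _ _ "retr \<xi>"]) auto
  qed (use B_A in auto)
  then show ?thesis using \<pi>_surj by simp
qed

lemma \<rho>_smooth: "smooth_map BM (man G) \<rho>"
  by (rule smooth_map_compose[OF MB MA MG(1) incl_smooth \<rho>_smooth_A])

subsection \<open>The action of the Lie 2-group\<close>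

lemma star_B:
  assumes h: "h \<in> carrier H" and b: "b \<in> B"
  shows "star (h, g) b \<in> B" "\<rho> (star (h, g) b) = d h \<otimes>\<^bsub>G\<^esub> \<rho> b" "\<pi> (star (h, g) b) = \<pi> b"
proof -
  note bA = B_A[OF b]
  show "star (h, g) b \<in> B" unfolding B_def using h bA sG_B[OF b] by (simp add: star_def)
  show "\<pi> (star (h, g) b) = \<pi> b" using h bA by (simp add: star_def)
  have "\<rho> (star (h, g) b) = inv\<^bsub>G\<^esub> (inv\<^bsub>G\<^esub> (\<rho> b) \<otimes>\<^bsub>G\<^esub> d (inv\<^bsub>H\<^esub> h) \<otimes>\<^bsub>G\<^esub> \<rho> b \<otimes>\<^bsub>G\<^esub> inv\<^bsub>G\<^esub> (\<rho> b))"
    using h bA by (simp add: star_def \<rho>_act d_C)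
  also have "\<dots> = inv\<^bsub>G\<^esub> (inv\<^bsub>G\<^esub> (\<rho> b) \<otimes>\<^bsub>G\<^esub> inv\<^bsub>G\<^esub> (d h))" using h bA by (simp add: G.m_assoc)
  also have "\<dots> = d h \<otimes>\<^bsub>G\<^esub> \<rho> b" using h bA by (simp add: G.inv_mult_group)
  finally show "\<rho> (star (h, g) b) = d h \<otimes>\<^bsub>G\<^esub> \<rho> b" .
qed

lemma star_one: "b \<in> B \<Longrightarrow> star (\<one>\<^bsub>H\<^esub>, g) b = b"
  by (simp add: star_def B_A)

text \<open>The second arrow acts at the shifted anchor \<open>d h \<otimes> \<rho> b\<close>. This
  inserts a twist by \<open>C (d (inv h))\<close>, that is, conjugation by the inverse of
  \<open>h\<close>, and it is this conjugation that puts the two inverses into the order of the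
  inverse of \<open>h' \<otimes> h\<close>.\<close>

lemma star_star:
  assumes h: "h \<in> carrier H" "h' \<in> carrier H" and b: "b \<in> B"
  shows "star (h', g') (star (h, g) b) = star (h' \<otimes>\<^bsub>H\<^esub> h, g'') b"
proof -
  note bA = B_A[OF b]
  let ?r = "inv\<^bsub>G\<^esub> (\<rho> b)"
  have "star (h', g') (star (h, g) b) =
    act1 (C (inv\<^bsub>G\<^esub> (d h \<otimes>\<^bsub>G\<^esub> \<rho> b)) (inv\<^bsub>H\<^esub> h') \<otimes>\<^bsub>H\<^esub> C ?r (inv\<^bsub>H\<^esub> h), \<one>\<^bsub>G\<^esub>) b"
  proof -
    have "\<rho> (act1 (C ?r (inv\<^bsub>H\<^esub> h), \<one>\<^bsub>G\<^esub>) b) = d h \<otimes>\<^bsub>G\<^esub> \<rho> b"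
      using star_B(2)[OF h(1) b, of g] by (simp add: star_def)
    then show ?thesis using h bA by (simp add: star_def act1_mult C_one)
  qed
  also have "C (inv\<^bsub>G\<^esub> (d h \<otimes>\<^bsub>G\<^esub> \<rho> b)) (inv\<^bsub>H\<^esub> h') = C ?r (C (d (inv\<^bsub>H\<^esub> h)) (inv\<^bsub>H\<^esub> h'))"
    using h bA by (simp add: G.inv_mult_group C_comp)
  also have "C (d (inv\<^bsub>H\<^esub> h)) (inv\<^bsub>H\<^esub> h') = inv\<^bsub>H\<^esub> h \<otimes>\<^bsub>H\<^esub> inv\<^bsub>H\<^esub> h' \<otimes>\<^bsub>H\<^esub> h"
    using h C_d[of "inv\<^bsub>H\<^esub> h" "inv\<^bsub>H\<^esub> h'"] by simp
  also have "C ?r (inv\<^bsub>H\<^esub> h \<otimes>\<^bsub>H\<^esub> inv\<^bsub>H\<^esub> h' \<otimes>\<^bsub>H\<^esub> h) \<otimes>\<^bsub>H\<^esub> C ?r (inv\<^bsub>H\<^esub> h) =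
      C ?r (inv\<^bsub>H\<^esub> h \<otimes>\<^bsub>H\<^esub> inv\<^bsub>H\<^esub> h' \<otimes>\<^bsub>H\<^esub> h \<otimes>\<^bsub>H\<^esub> inv\<^bsub>H\<^esub> h)"
    using h bA C_mult[of ?r "inv\<^bsub>H\<^esub> h \<otimes>\<^bsub>H\<^esub> inv\<^bsub>H\<^esub> h' \<otimes>\<^bsub>H\<^esub> h" "inv\<^bsub>H\<^esub> h"] by simp
  also have "inv\<^bsub>H\<^esub> h \<otimes>\<^bsub>H\<^esub> inv\<^bsub>H\<^esub> h' \<otimes>\<^bsub>H\<^esub> h \<otimes>\<^bsub>H\<^esub> inv\<^bsub>H\<^esub> h = inv\<^bsub>H\<^esub> (h' \<otimes>\<^bsub>H\<^esub> h)"
    using h by (simp add: H.m_assoc H.inv_mult_group)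
  finally show ?thesis by (simp add: star_def)
qed

lemma two_group_simps:
  "obj (two_group H G d) = man G" "arr (two_group H G d) = prod_manifold (man H) (man G)"
  "src (two_group H G d) = snd" "tgt (two_group H G d) = (\<lambda>(h, g). d h \<otimes>\<^bsub>G\<^esub> g)"
  "cmp (two_group H G d) = (\<lambda>(h\<^sub>2, g\<^sub>2) (h\<^sub>1, g\<^sub>1). (h\<^sub>2 \<otimes>\<^bsub>H\<^esub> h\<^sub>1, g\<^sub>1))"
  "unit_arr (two_group H G d) = (\<lambda>g. (\<one>\<^bsub>H\<^esub>, g))"
  by (auto simp: two_group_def)

lemma star_action: "groupoid_action (two_group H G d) BM \<rho> star"
proof -
  let ?A = "prod_manifold (man H) (man G)"
  let ?S = "{(\<gamma>, b). \<gamma> \<in> points ?A \<and> b \<in> points BM \<and> snd \<gamma> = \<rho> b}"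
  let ?n = "mdim ?A + mdim BM - mdim (man G)"
  note A = smooth_manifold_prod[OF MH(1) MG(1)]
  note AB = smooth_manifold_prod[OF A MB]
  have E: "embedded_submanifold (prod_manifold ?A BM) ?S ?n"
    by (rule embedded_fibre_product[OF A MB MG(1) submersion_snd[OF MH(1) MG(1)] \<rho>_smooth])
  note sA = smooth_map_compose[OF AB MB MA smooth_map_snd[OF A MB] incl_smooth]
  have "smooth_map (prod_manifold ?A BM) (arr P)
     (\<lambda>z. act1 (C (inv\<^bsub>G\<^esub> (\<rho> (snd z))) (inv\<^bsub>H\<^esub> (fst (fst z))), \<one>\<^bsub>G\<^esub>) (snd z))"
    by (intro smooth_act1[OF AB] smooth_C[OF AB] const_G[OF AB] smooth_map_inv[OF lgG AB] smooth_map_inv[OF lgH AB] sA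
        smooth_map_compose[OF AB MB MG(1) smooth_map_snd[OF A MB] \<rho>_smooth]
        smooth_map_compose[OF AB A MH(1) smooth_map_fst[OF A MB] smooth_map_fst[OF MH(1) MG(1)]])
  moreover have "(\<lambda>z. act1 (C (inv\<^bsub>G\<^esub> (\<rho> (snd z))) (inv\<^bsub>H\<^esub> (fst (fst z))), \<one>\<^bsub>G\<^esub>) (snd z)) = (\<lambda>(\<gamma>, b). star \<gamma> b)"
    by (auto simp: star_def)
  ultimately have "smooth_map (prod_manifold ?A BM) (arr P) (\<lambda>(\<gamma>, b). star \<gamma> b)" by simp
  from smooth_map_restrict[OF AB MA E this]
  have "smooth_map (submanifold (prod_manifold ?A BM) ?S ?n) BM (\<lambda>(\<gamma>, b). star \<gamma> b)"
    by (rule smooth_into_BM[OF smooth_manifold_submanifold[OF AB E]])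
       (auto simp: embedded_submanifold_points[OF E] MH(2) MG(2) star_B(1))
  then show ?thesis
    unfolding groupoid_action_def fibre_product_def two_group_simps
    using lie_groupoid_two_group[OF cm] MB \<rho>_smooth
    by (auto simp: MH(2) MG(2) star_B(2) star_one star_star)
qed

lemma star_transitive:
  assumes b: "b \<in> B" "b' \<in> B" "\<pi> b = \<pi> b'"
  shows "\<exists>h\<in>carrier H. b' = star (h, \<rho> b) b"
proof -
  note bA = B_A[OF b(1)]
  obtain h g where hg: "h \<in> carrier H" "g \<in> carrier G" "b' = act1 (h, g) b"
    using \<pi>_fibre[OF bA B_A[OF b(2)] b(3)] by blast
  have "g = \<one>\<^bsub>G\<^esub>" using sG_B[OF b(2)] sG_B[OF b(1)] hg bA by simp
  \<comment> \<open>The witness solves \<open>C r (inv x) = h\<close> for \<open>x\<close>, with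
    \<open>r\<close> the inverse of \<open>\<rho> b\<close>.\<close>
  moreover have "star (inv\<^bsub>H\<^esub> (C (\<rho> b) h), \<rho> b) b = act1 (h, \<one>\<^bsub>G\<^esub>) b"
    using hg bA by (simp add: star_def C_comp[symmetric] C_one)
  ultimately show ?thesis
    using hg bA by (intro bexI[of _ "inv\<^bsub>H\<^esub> (C (\<rho> b) h)"]) simp_all
qed

subsection \<open>The product of the gerbe\<close>

text \<open>Composability is tested in \<open>Y\<close>: sources of elements of \<open>B\<close>
  have \<open>G\<close>-component \<open>e\<close>, while targets are unrestricted, so two elements
  composable in the gerbe need not be composable in \<open>P\<close>.\<close>

definition "gcomp b\<^sub>2 b\<^sub>1 \<longleftrightarrow> b\<^sub>2 \<in> B \<and> b\<^sub>1 \<in> B \<and> src Y (\<pi> b\<^sub>2) = tgt Y (\<pi> b\<^sub>1)"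

text \<open>Translating \<open>b\<^sub>2\<close> by \<open>\<rho>(b\<^sub>1)\<^sup>-\<^sup>1\<close> moves its source from \<open>{e} \<times> Y\<close> to the target of \<open>b\<^sub>1\<close>.\<close>

lemma gcomp_src:
  assumes "gcomp b\<^sub>2 b\<^sub>1"
  shows "src P (act1 (\<one>\<^bsub>H\<^esub>, inv\<^bsub>G\<^esub> (\<rho> b\<^sub>1)) b\<^sub>2) = tgt P b\<^sub>1"
proof -
  have b: "b\<^sub>2 \<in> B" "b\<^sub>1 \<in> B" "src Y (\<pi> b\<^sub>2) = tgt Y (\<pi> b\<^sub>1)" using assms by (auto simp: gcomp_def)
  note bA = B_A[OF b(1)] B_A[OF b(2)]
  show ?thesis
    by (rule Ob_eqI) (use b bA sG_B[OF b(1)] in \<open>simp_all add: pr_tgt sG_def\<close>)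
qed

lemma gcmp:
  assumes c: "gcomp b\<^sub>2 b\<^sub>1"
  shows "gcmp b\<^sub>2 b\<^sub>1 \<in> B" "\<rho> (gcmp b\<^sub>2 b\<^sub>1) = \<rho> b\<^sub>2 \<otimes>\<^bsub>G\<^esub> \<rho> b\<^sub>1" "\<pi> (gcmp b\<^sub>2 b\<^sub>1) = cmp Y (\<pi> b\<^sub>2) (\<pi> b\<^sub>1)"
    "src P (gcmp b\<^sub>2 b\<^sub>1) = src P b\<^sub>1" "\<pi>\<^sub>0 (tgt P (gcmp b\<^sub>2 b\<^sub>1)) = \<pi>\<^sub>0 (tgt P b\<^sub>2)"
proof -
  have b: "b\<^sub>2 \<in> B" "b\<^sub>1 \<in> B" using c by (auto simp: gcomp_def)
  note bA = B_A[OF b(1)] B_A[OF b(2)]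
  note s = gcomp_src[OF c]
  let ?b = "act1 (\<one>\<^bsub>H\<^esub>, inv\<^bsub>G\<^esub> (\<rho> b\<^sub>1)) b\<^sub>2"
  have bb: "?b \<in> A" using bA by simp
  show src: "src P (gcmp b\<^sub>2 b\<^sub>1) = src P b\<^sub>1" unfolding gcmp_def by (rule src_cmp[OF bb bA(2) s])
  have tgt: "tgt P (gcmp b\<^sub>2 b\<^sub>1) = act0 (inv\<^bsub>G\<^esub> (\<rho> b\<^sub>1)) (tgt P b\<^sub>2)"
    unfolding gcmp_def tgt_cmp[OF bb bA(2) s] using bA by simp
  have A: "gcmp b\<^sub>2 b\<^sub>1 \<in> A" unfolding gcmp_def by (rule cmp_closed[OF bb bA(2) s])
  show "gcmp b\<^sub>2 b\<^sub>1 \<in> B" using A src sG_B[OF b(2)] by (simp add: B_def sG_def)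
  show "\<rho> (gcmp b\<^sub>2 b\<^sub>1) = \<rho> b\<^sub>2 \<otimes>\<^bsub>G\<^esub> \<rho> b\<^sub>1"
    using bA by (simp add: \<rho>_def[of "gcmp b\<^sub>2 b\<^sub>1"] tgt pr_tgt G.inv_mult_group)
  show "\<pi> (gcmp b\<^sub>2 b\<^sub>1) = cmp Y (\<pi> b\<^sub>2) (\<pi> b\<^sub>1)"
    unfolding gcmp_def \<pi>_cmp[OF bb bA(2) s] using bA by simp
  show "\<pi>\<^sub>0 (tgt P (gcmp b\<^sub>2 b\<^sub>1)) = \<pi>\<^sub>0 (tgt P b\<^sub>2)" unfolding tgt using bA by simp
qed

lemma act_cmp_one:
  assumes "g \<in> carrier G" "\<xi> \<in> A" "\<eta> \<in> A" "src P \<xi> = tgt P \<eta>"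
  shows "act1 (\<one>\<^bsub>H\<^esub>, g) (cmp P \<xi> \<eta>) = cmp P (act1 (\<one>\<^bsub>H\<^esub>, g) \<xi>) (act1 (\<one>\<^bsub>H\<^esub>, g) \<eta>)"
  using act_cmp[of "\<one>\<^bsub>H\<^esub>" "\<one>\<^bsub>H\<^esub>" g \<xi> \<eta>] assms by simp

text \<open>Translation commutes with composition in \<open>P\<close>, and \<open>\<rho>\<close> is
  multiplicative, so the two successive translations of \<open>a\<close> on one side make up the
  single translation on the other.\<close>

lemma gcmp_assoc:
  assumes ab: "gcomp a b" and bc: "gcomp b c"
  shows "gcmp (gcmp a b) c = gcmp a (gcmp b c)"
proof -
  have B: "a \<in> B" "b \<in> B" "c \<in> B" using ab bc by (auto simp: gcomp_def)
  note A = B_A[OF B(1)] B_A[OF B(2)] B_A[OF B(3)]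
  let ?x = "act1 (\<one>\<^bsub>H\<^esub>, inv\<^bsub>G\<^esub> (\<rho> b)) a"
  let ?g = "inv\<^bsub>G\<^esub> (\<rho> c)"
  have x: "?x \<in> A" using A by simp
  have gx: "act1 (\<one>\<^bsub>H\<^esub>, ?g) ?x = act1 (\<one>\<^bsub>H\<^esub>, inv\<^bsub>G\<^esub> (\<rho> (gcmp b c))) a"
    using A by (simp add: act1_mult gcmp(2)[OF bc] G.inv_mult_group)
  have "gcmp (gcmp a b) c = cmp P (cmp P (act1 (\<one>\<^bsub>H\<^esub>, ?g) ?x) (act1 (\<one>\<^bsub>H\<^esub>, ?g) b)) c"
    unfolding gcmp_def using act_cmp_one[of ?g ?x b] A x gcomp_src[OF ab] by simp
  also have "\<dots> = cmp P (act1 (\<one>\<^bsub>H\<^esub>, ?g) ?x) (cmp P (act1 (\<one>\<^bsub>H\<^esub>, ?g) b) c)"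
    using A x gcomp_src[OF ab] gcomp_src[OF bc] by (intro cmp_assoc) auto
  finally show ?thesis unfolding gx by (simp add: gcmp_def)
qed

lemma gunit:
  assumes y: "y \<in> points (obj Y)"
  shows "gunit y \<in> B" "\<rho> (gunit y) = \<one>\<^bsub>G\<^esub>" "\<pi> (gunit y) = unit_arr Y y"
    "src P (gunit y) = inv_into Ob \<tau> (\<one>\<^bsub>G\<^esub>, y)"
proof -
  note p = \<tau>_inv[OF G.one_closed y]
  show "gunit y \<in> B" using p by (simp add: gunit_def B_def sG_def)
  show "\<rho> (gunit y) = \<one>\<^bsub>G\<^esub>" using p by (simp add: gunit_def \<rho>_def)
  show "\<pi> (gunit y) = unit_arr Y y" using p by (simp add: gunit_def \<pi>_unit)
  show "src P (gunit y) = inv_into Ob \<tau> (\<one>\<^bsub>G\<^esub>, y)" using p by (simp add: gunit_def)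
qed

lemma src_B:
  assumes b: "b \<in> B"
  shows "src P b = inv_into Ob \<tau> (\<one>\<^bsub>G\<^esub>, src Y (\<pi> b))"
proof (rule Ob_eqI)
  note bA = B_A[OF b]
  have "src Y (\<pi> b) \<in> points (obj Y)" using bA by simp
  note p = \<tau>_inv[OF G.one_closed this]
  show "src P b \<in> Ob" "inv_into Ob \<tau> (\<one>\<^bsub>G\<^esub>, src Y (\<pi> b)) \<in> Ob" using bA p by auto
  show "pr (src P b) = pr (inv_into Ob \<tau> (\<one>\<^bsub>G\<^esub>, src Y (\<pi> b)))" using sG_B[OF b] p by (simp add: sG_def)
  show "\<pi>\<^sub>0 (src P b) = \<pi>\<^sub>0 (inv_into Ob \<tau> (\<one>\<^bsub>G\<^esub>, src Y (\<pi> b)))" using p bA by simp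
qed

lemma gcmp_unit:
  assumes b: "b \<in> B"
  shows "gcmp b (gunit (src Y (\<pi> b))) = b" "gcmp (gunit (tgt Y (\<pi> b))) b = b"
proof -
  note bA = B_A[OF b]
  have y: "src Y (\<pi> b) \<in> points (obj Y)" "tgt Y (\<pi> b) \<in> points (obj Y)" using bA by auto
  have "gunit (src Y (\<pi> b)) = unit_arr P (src P b)" unfolding gunit_def src_B[OF b] ..
  then show "gcmp b (gunit (src Y (\<pi> b))) = b"
    using gunit(2)[OF y(1)] bA by (simp add: gcmp_def cmp_unit_right)
  note p = \<tau>_inv[OF G.one_closed y(2)]
  \<comment> \<open>For the left unit the translation by the inverse of \<open>\<rho> b\<close>
    matters: it moves the object at level \<open>e\<close> over the target in \<open>Y\<close> to
    the actual target of \<open>b\<close> in \<open>P\<close>.\<close>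
  have "act0 (inv\<^bsub>G\<^esub> (\<rho> b)) (inv_into Ob \<tau> (\<one>\<^bsub>G\<^esub>, tgt Y (\<pi> b))) = tgt P b"
    by (rule Ob_eqI) (use p bA in \<open>simp_all add: pr_tgt\<close>)
  then have "act1 (\<one>\<^bsub>H\<^esub>, inv\<^bsub>G\<^esub> (\<rho> b)) (gunit (tgt Y (\<pi> b))) = unit_arr P (tgt P b)"
    unfolding gunit_def using p bA by (simp add: act_unit)
  then show "gcmp (gunit (tgt Y (\<pi> b))) b = b"
    using bA by (simp add: gcmp_def cmp_unit_left)
qed

lemma ginv:
  assumes b: "b \<in> B"
  shows "ginv b \<in> B" "\<rho> (ginv b) = inv\<^bsub>G\<^esub> (\<rho> b)" "src Y (\<pi> (ginv b)) = tgt Y (\<pi> b)" "tgt Y (\<pi> (ginv b)) = src Y (\<pi> b)"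
    "gcmp (ginv b) b = gunit (src Y (\<pi> b))" "gcmp b (ginv b) = gunit (tgt Y (\<pi> b))"
proof -
  note bA = B_A[OF b]
  have iA: "inv_arr P b \<in> A" using bA by simp
  have gA: "ginv b \<in> A" unfolding ginv_def using bA by simp
  have sG: "sG (inv_arr P b) = inv\<^bsub>G\<^esub> (\<rho> b)" using bA by (simp add: sG_def pr_tgt)
  show gB: "ginv b \<in> B" unfolding B_def using gA sG bA by (simp add: ginv_def)
  have prs: "pr (src P b) = \<one>\<^bsub>G\<^esub>" using sG_B[OF b] by (simp add: sG_def)
  show r: "\<rho> (ginv b) = inv\<^bsub>G\<^esub> (\<rho> b)"
    using bA prs by (simp add: ginv_def \<rho>_act \<rho>_def[of "inv_arr P b"])
  show "src Y (\<pi> (ginv b)) = tgt Y (\<pi> b)" "tgt Y (\<pi> (ginv b)) = src Y (\<pi> b)"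
    using bA by (simp_all add: ginv_def)
  \<comment> \<open>The translation in the product undoes the one in \<open>ginv\<close>, leaving
    the inverse law of \<open>P\<close>.\<close>
  have "act1 (\<one>\<^bsub>H\<^esub>, inv\<^bsub>G\<^esub> (\<rho> b)) (ginv b) = inv_arr P b"
    unfolding ginv_def using bA by (simp add: act1_mult)
  then have "gcmp (ginv b) b = unit_arr P (src P b)"
    using bA by (simp add: gcmp_def cmp_inv_left)
  then show "gcmp (ginv b) b = gunit (src Y (\<pi> b))" unfolding gunit_def src_B[OF b] .
  \<comment> \<open>As \<open>\<rho> (ginv b)\<close> is the inverse of \<open>\<rho> b\<close>,
    both factors are now translated by \<open>\<rho> b\<close>, which can be pulled out of the
    composition.\<close>
  have "gcmp b (ginv b) = cmp P (act1 (\<one>\<^bsub>H\<^esub>, \<rho> b) b) (act1 (\<one>\<^bsub>H\<^esub>, \<rho> b) (inv_arr P b))"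
    unfolding gcmp_def r using bA by (simp add: ginv_def)
  also have "\<dots> = act1 (\<one>\<^bsub>H\<^esub>, \<rho> b) (cmp P b (inv_arr P b))"
    using act_cmp_one[of "\<rho> b" b "inv_arr P b"] bA by simp
  also have "\<dots> = unit_arr P (act0 (\<rho> b) (tgt P b))"
    using bA by (simp add: cmp_inv_right act_unit)
  also have "act0 (\<rho> b) (tgt P b) = inv_into Ob \<tau> (\<one>\<^bsub>G\<^esub>, tgt Y (\<pi> b))"
  proof (rule Ob_eqI)
    have "tgt Y (\<pi> b) \<in> points (obj Y)" using bA by simp
    note p = \<tau>_inv[OF G.one_closed this]
    show "inv_into Ob \<tau> (\<one>\<^bsub>G\<^esub>, tgt Y (\<pi> b)) \<in> Ob" "act0 (\<rho> b) (tgt P b) \<in> Ob" using p bA by auto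
    show "pr (act0 (\<rho> b) (tgt P b)) = pr (inv_into Ob \<tau> (\<one>\<^bsub>G\<^esub>, tgt Y (\<pi> b)))"
      using p bA by (simp add: pr_tgt)
    show "\<pi>\<^sub>0 (act0 (\<rho> b) (tgt P b)) = \<pi>\<^sub>0 (inv_into Ob \<tau> (\<one>\<^bsub>G\<^esub>, tgt Y (\<pi> b)))"
      using p bA by simp
  qed
  finally show "gcmp b (ginv b) = gunit (tgt Y (\<pi> b))" unfolding gunit_def .
qed

text \<open>With \<open>k\<^sub>1\<close>, \<open>k\<^sub>2\<close> the elements by which the two
  arrows act, the left side is brought into the shape of the interchange law, which merges the
  actions into one by \<open>x k\<^sub>1\<close>. The Peiffer identity rewrites this product as
  \<open>k\<^sub>1 C(r\<^sub>1) k\<^sub>2\<close>, free of the shifted anchor.\<close>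

lemma gcmp_star:
  assumes c: "gcomp b\<^sub>2 b\<^sub>1" and h: "h\<^sub>2 \<in> carrier H" "h\<^sub>1 \<in> carrier H"
  shows "gcmp (star (h\<^sub>2, g\<^sub>2) b\<^sub>2) (star (h\<^sub>1, g\<^sub>1) b\<^sub>1) = star (h\<^sub>2 \<otimes>\<^bsub>H\<^esub> C (\<rho> b\<^sub>2) h\<^sub>1, g) (gcmp b\<^sub>2 b\<^sub>1)"
proof -
  have b: "b\<^sub>2 \<in> B" "b\<^sub>1 \<in> B" using c by (auto simp: gcomp_def)
  note A = B_A[OF b(1)] B_A[OF b(2)]
  let ?r1 = "inv\<^bsub>G\<^esub> (\<rho> b\<^sub>1)" and ?r2 = "inv\<^bsub>G\<^esub> (\<rho> b\<^sub>2)"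
  let ?k1 = "C ?r1 (inv\<^bsub>H\<^esub> h\<^sub>1)" and ?k2 = "C ?r2 (inv\<^bsub>H\<^esub> h\<^sub>2)"
  let ?x = "C (inv\<^bsub>G\<^esub> (d h\<^sub>1 \<otimes>\<^bsub>G\<^esub> \<rho> b\<^sub>1)) ?k2"
  have k: "?k1 \<in> carrier H" "?k2 \<in> carrier H" "?x \<in> carrier H" using h A by auto
  \<comment> \<open>The translation prescribed by the shifted anchor is the old translation followed
    by \<open>d\<close> of \<open>?k1\<close>, precisely the second component that the interchange
    law requires of the left factor.\<close>
  have dk1: "d ?k1 \<otimes>\<^bsub>G\<^esub> ?r1 = inv\<^bsub>G\<^esub> (d h\<^sub>1 \<otimes>\<^bsub>G\<^esub> \<rho> b\<^sub>1)"
    using h A by (simp add: d_C G.m_assoc G.inv_mult_group)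
  \<comment> \<open>The Peiffer identity, applied to \<open>?k1\<close> and the translated
    \<open>?k2\<close>.\<close>
  have x: "?x = ?k1 \<otimes>\<^bsub>H\<^esub> C ?r1 ?k2 \<otimes>\<^bsub>H\<^esub> inv\<^bsub>H\<^esub> ?k1"
    unfolding dk1[symmetric] using k h A C_d[of ?k1 "C ?r1 ?k2"] by (simp add: C_comp)
  let ?\<xi> = "act1 (\<one>\<^bsub>H\<^esub>, ?r1) b\<^sub>2"
  have \<xi>: "?\<xi> \<in> A" using A by simp
  have "gcmp (star (h\<^sub>2, g\<^sub>2) b\<^sub>2) (star (h\<^sub>1, g\<^sub>1) b\<^sub>1) =
      cmp P (act1 (\<one>\<^bsub>H\<^esub>, inv\<^bsub>G\<^esub> (d h\<^sub>1 \<otimes>\<^bsub>G\<^esub> \<rho> b\<^sub>1)) (act1 (?k2, \<one>\<^bsub>G\<^esub>) b\<^sub>2)) (act1 (?k1, \<one>\<^bsub>G\<^esub>) b\<^sub>1)"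
    unfolding gcmp_def star_B(2)[OF h(2) b(2)] by (simp add: star_def)
  also have "act1 (\<one>\<^bsub>H\<^esub>, inv\<^bsub>G\<^esub> (d h\<^sub>1 \<otimes>\<^bsub>G\<^esub> \<rho> b\<^sub>1)) (act1 (?k2, \<one>\<^bsub>G\<^esub>) b\<^sub>2) = act1 (?x, d ?k1) ?\<xi>"
    using k h A by (simp add: act1_mult dk1)
  also have "cmp P (act1 (?x, d ?k1) ?\<xi>) (act1 (?k1, \<one>\<^bsub>G\<^esub>) b\<^sub>1) = act1 (?x \<otimes>\<^bsub>H\<^esub> ?k1, \<one>\<^bsub>G\<^esub>) (gcmp b\<^sub>2 b\<^sub>1)"
    unfolding gcmp_def using act_cmp[of ?x ?k1 "\<one>\<^bsub>G\<^esub>" ?\<xi> b\<^sub>1] k \<xi> A gcomp_src[OF c] by simp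
  also have "?x \<otimes>\<^bsub>H\<^esub> ?k1 = ?k1 \<otimes>\<^bsub>H\<^esub> C ?r1 ?k2"
    unfolding x using k A by (simp add: H.m_assoc)
  \<comment> \<open>On the right, inverting the product reverses its factors, and the twist by
    \<open>\<rho> b\<^sub>2\<close> cancels against the part of the anchor coming from
    \<open>b\<^sub>2\<close>.\<close>
  also have "\<dots> = C (inv\<^bsub>G\<^esub> (\<rho> (gcmp b\<^sub>2 b\<^sub>1))) (inv\<^bsub>H\<^esub> (h\<^sub>2 \<otimes>\<^bsub>H\<^esub> C (\<rho> b\<^sub>2) h\<^sub>1))"
    unfolding gcmp(2)[OF c] using h A
    by (simp add: G.inv_mult_group H.inv_mult_group C_comp C_mult C_inv[symmetric] C_comp[of ?r2 "\<rho> b\<^sub>2", symmetric] C_one)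
  finally show ?thesis by (simp add: star_def)
qed

lemma gcmp_smooth:
  assumes M: "smooth_manifold M" and a: "smooth_map M BM a" and b: "smooth_map M BM b"
    and ab: "\<And>x. x \<in> points M \<Longrightarrow> gcomp (a x) (b x)"
  shows "smooth_map M BM (\<lambda>x. gcmp (a x) (b x))"
proof (rule smooth_into_BM[OF M _ gcmp(1)[OF ab]])
  note a' = smooth_map_compose[OF M MB MA a incl_smooth] and b' = smooth_map_compose[OF M MB MA b incl_smooth]
  show "smooth_map M (arr P) (\<lambda>x. gcmp (a x) (b x))"
    unfolding gcmp_def
    by (intro smooth_map_cmp[OF P M _ b' gcomp_src[OF ab]] smooth_act1[OF M const_H[OF M] _ a']
        smooth_map_inv[OF lgG M] smooth_map_compose[OF M MB MG(1) b \<rho>_smooth])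
qed auto

lemma gunit_smooth: "smooth_map (obj Y) BM gunit"
proof (rule smooth_into_BM[OF MY0 _ gunit(1)])
  note GY = smooth_manifold_prod[OF MG(1) MY0]
  have "smooth_map (obj Y) (obj P) (\<lambda>y. inv_into Ob \<tau> (\<one>\<^bsub>G\<^esub>, y))"
    by (rule smooth_map_compose[OF MY0 GY MOb smooth_map_Pair[OF MY0 MG(1) MY0 const_G[OF MY0] smooth_map_ident[OF MY0]] \<tau>_inv_smooth])
  moreover have "smooth_map (obj P) (arr P) (unit_arr P)" using P by (simp add: lie_groupoid_def)
  ultimately show "smooth_map (obj Y) (arr P) gunit"
    unfolding gunit_def[abs_def] by (rule smooth_map_compose[OF MY0 MOb MA])
qed

lemma ginv_smooth: "smooth_map BM BM ginv"
proof (rule smooth_into_BM[OF MB])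
  have "smooth_map (arr P) (arr P) (inv_arr P)" using P by (simp add: lie_groupoid_def)
  from smooth_map_compose[OF MB MA MA incl_smooth this]
  show "smooth_map BM (arr P) ginv"
    unfolding ginv_def[abs_def] by (rule smooth_act1[OF MB const_H[OF MB] \<rho>_smooth])
qed (simp add: ginv(1))

text \<open>Stated for any \<open>Pr\<close> agreeing with \<open>\<pi>\<close> on \<open>B\<close>,
  since a projection defined by \<open>inv_into\<close> need not equal \<open>\<pi>\<close>
  elsewhere. Source and target of the record are total functions built from \<open>Pr\<close>, so
  \<open>\<pi>\<close> cannot simply be substituted for it.\<close>

lemma bundle_gerbe_BM:
  assumes Pr: "\<And>b. b \<in> B \<Longrightarrow> Pr b = \<pi> b"
  shows "bundle_gerbe H G C d Y
    \<lparr>obj = obj Y, arr = BM, src = (\<lambda>b. src Y (Pr b)), tgt = (\<lambda>b. tgt Y (Pr b)),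
     cmp = gcmp, unit_arr = gunit, inv_arr = ginv\<rparr> Pr \<rho> star" (is "bundle_gerbe _ _ _ _ _ ?\<Gamma> _ _ _")
proof -
  have Pr_sub: "submersion BM (arr Y) Pr"
    by (rule submersion_cong[OF MB MY1 \<pi>_BM_submersion]) (simp add: Pr)
  have Pr_smooth: "smooth_map BM (arr Y) Pr" using Pr_sub by (simp add: submersion_def)
  have Pr_surj: "Pr ` B = points (arr Y)" using \<pi>_BM_surj Pr by simp
  have Ysub: "submersion (arr Y) (obj Y) (src Y)" "src Y ` points (arr Y) = points (obj Y)"
    "submersion (arr Y) (obj Y) (tgt Y)" "tgt Y ` points (arr Y) = points (obj Y)"
    using Y by (auto simp: lie_groupoid_def surj_submersion_def)
  have src_sub: "submersion BM (obj Y) (\<lambda>b. src Y (Pr b))" and tgt_sub: "submersion BM (obj Y) (\<lambda>b. tgt Y (Pr b))"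
    by (rule submersion_compose[OF MB MY1 MY0 Pr_sub Ysub(1)], rule submersion_compose[OF MB MY1 MY0 Pr_sub Ysub(3)])
  have surj: "(\<lambda>b. src Y (Pr b)) ` B = points (obj Y)" "(\<lambda>b. tgt Y (Pr b)) ` B = points (obj Y)"
    using Ysub(2,4) unfolding Pr_surj[symmetric] image_image by simp_all
  have tgt_smooth: "smooth_map BM (obj Y) (\<lambda>b. tgt Y (Pr b))" using tgt_sub by (simp add: submersion_def)
  let ?S = "{(x, y). x \<in> points BM \<and> y \<in> points BM \<and> src Y (Pr x) = tgt Y (Pr y)}"
  let ?n = "mdim BM + mdim BM - mdim (obj Y)"
  let ?M = "submanifold (prod_manifold BM BM) ?S ?n"
  note BB = smooth_manifold_prod[OF MB MB]
  have E: "embedded_submanifold (prod_manifold BM BM) ?S ?n"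
    by (rule embedded_fibre_product[OF MB MB MY0 src_sub tgt_smooth])
  have "smooth_map ?M BM (\<lambda>z. gcmp (fst z) (snd z))"
    by (rule gcmp_smooth[OF smooth_manifold_submanifold[OF BB E]
          smooth_map_restrict[OF BB MB E smooth_map_fst[OF MB MB]] smooth_map_restrict[OF BB MB E smooth_map_snd[OF MB MB]]])
       (auto simp: embedded_submanifold_points[OF E] gcomp_def Pr)
  then have cmp_smooth: "smooth_map (composable_arrows ?\<Gamma>) BM (\<lambda>(a, b). gcmp a b)"
    by (simp add: composable_arrows_def fibre_product_def case_prod_beta')
  have comp: "gcomp a b" if "a \<in> B" "b \<in> B" "src Y (Pr a) = tgt Y (Pr b)" for a b
    using that by (simp add: gcomp_def Pr)
  have cmp_ends: "src Y (Pr (gcmp a b)) = src Y (Pr b)" "tgt Y (Pr (gcmp a b)) = tgt Y (Pr a)"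
    if "a \<in> B" "b \<in> B" "src Y (Pr a) = tgt Y (Pr b)" for a b
    using gcmp(1,4,5)[OF comp[OF that]] that B_A by (simp_all add: Pr)
  have unit_ends: "src Y (Pr (gunit y)) = y" "tgt Y (Pr (gunit y)) = y" if "y \<in> points (obj Y)" for y
    using gunit[OF that] Y that by (simp_all add: Pr lie_groupoid_def)
  have "lie_groupoid ?\<Gamma>"
    unfolding lie_groupoid_def
    using MY0 MB src_sub tgt_sub surj cmp_smooth gunit_smooth ginv_smooth
    by (simp add: surj_submersion_def cmp_ends unit_ends gcmp_assoc[OF comp comp] gcmp_unit ginv Pr)
  moreover have "lie_groupoid_morphism ?\<Gamma> Y Pr id"
    unfolding lie_groupoid_morphism_def
    using Pr_smooth smooth_map_ident[OF MY0]
    by (simp add: id_def gunit Pr gcmp[OF comp])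
  moreover have "principal_groupoid_bundle (two_group H G d) BM \<rho> star (arr Y) Pr"
  proof (rule principal_groupoid_bundleI[OF star_action MY1])
    show "surj_submersion BM (arr Y) Pr" using Pr_sub Pr_surj by (simp add: surj_submersion_def)
    show "star \<gamma> b \<in> points BM \<and> Pr (star \<gamma> b) = Pr b"
      if "\<gamma> \<in> points (arr (two_group H G d))" "b \<in> points BM" for \<gamma> b
      using that star_B(1,3) by (auto simp: two_group_simps MH(2) Pr)
    show "\<exists>\<gamma>\<in>points (arr (two_group H G d)). src (two_group H G d) \<gamma> = \<rho> b \<and> b' = star \<gamma> b"
      if b: "b \<in> points BM" "b' \<in> points BM" "Pr b = Pr b'" for b b'
    proof -
      obtain h where "h \<in> carrier H" "b' = star (h, \<rho> b) b" using star_transitive[of b b'] b Pr by auto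
      then show ?thesis
        using b B_A by (intro bexI[of _ "(h, \<rho> b)"]) (auto simp: two_group_simps MH(2) MG(2))
    qed
  qed
  ultimately show ?thesis
    unfolding bundle_gerbe_def using cm Y
    by (simp add: gcmp(2)[OF comp] gcmp_star[OF comp] semidirect_def)
qed

end

theorem proposition2p13:
  fixes H :: "('h, 'eh::euclidean_space) lie_grp"
    and G :: "('g, 'eg::euclidean_space) lie_grp"
    and C :: "'g \<Rightarrow> 'h \<Rightarrow> 'h"
    and d :: "'h \<Rightarrow> 'g"
    and Y :: "('y, 'ey::euclidean_space, 'c, 'ec::euclidean_space) groupoid"
    and P :: "('p, 'ep::euclidean_space, 'a, 'ea::euclidean_space) groupoid"
    and act1 :: "'h \<times> 'g \<Rightarrow> 'a \<Rightarrow> 'a"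
    and act0 :: "'g \<Rightarrow> 'p \<Rightarrow> 'p"
    and \<pi> :: "'a \<Rightarrow> 'c"
    and \<pi>\<^sub>0 :: "'p \<Rightarrow> 'y"
    and \<tau> :: "'p \<Rightarrow> 'g \<times> 'y"
    and pr\<^sub>G :: "'p \<Rightarrow> 'g"
    and s\<^sub>G :: "'a \<Rightarrow> 'g"
    and B :: "'a set"
    and BM :: "('a, 'ea) manifold"
    and \<phi> :: "'a \<Rightarrow> 'g \<times> 'a"
    and Pr :: "'a \<Rightarrow> 'c"
    and \<rho> :: "'a \<Rightarrow> 'g"
    and star :: "'h \<times> 'g \<Rightarrow> 'a \<Rightarrow> 'a"
    and cmp\<^sub>\<mu> :: "'a \<Rightarrow> 'a \<Rightarrow> 'a"
  assumes "principal_bundle_groupoid H G C d P act1 act0 Y \<pi> \<pi>\<^sub>0"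
    and "trivialization G (obj P) act0 (obj Y) \<pi>\<^sub>0 \<tau>"
  defines "pr\<^sub>G \<equiv> \<lambda>p. fst (\<tau> p)"
    and "s\<^sub>G \<equiv> \<lambda>\<xi>. pr\<^sub>G (src P \<xi>)"
    and "B \<equiv> {\<xi> \<in> points (arr P). s\<^sub>G \<xi> = \<one>\<^bsub>G\<^esub>}"
    and "BM \<equiv> submanifold (arr P) B (mdim (arr P) - mdim (man G))"
    and "\<phi> \<equiv> \<lambda>\<xi>. (s\<^sub>G \<xi>, act1 (\<one>\<^bsub>H\<^esub>, inv\<^bsub>G\<^esub> (s\<^sub>G \<xi>)) \<xi>)"
    and "Pr \<equiv> \<lambda>b. \<pi> (inv_into (points (arr P)) \<phi> (\<one>\<^bsub>G\<^esub>, b))"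
    and "\<rho> \<equiv> \<lambda>b. inv\<^bsub>G\<^esub> (pr\<^sub>G (tgt P b))"
    and "star \<equiv> \<lambda>(h, g) b. act1 (C (inv\<^bsub>G\<^esub> (\<rho> b)) (inv\<^bsub>H\<^esub> h), \<one>\<^bsub>G\<^esub>) b"
    and "cmp\<^sub>\<mu> \<equiv> \<lambda>b\<^sub>2 b\<^sub>1. cmp P (act1 (\<one>\<^bsub>H\<^esub>, inv\<^bsub>G\<^esub> (\<rho> b\<^sub>1)) b\<^sub>2) b\<^sub>1"
  shows "embedded_submanifold (arr P) B (mdim (arr P) - mdim (man G)) \<and>
    diffeomorphism (arr P) (prod_manifold (man G) BM) \<phi> \<and>
    (\<exists>u i. bundle_gerbe H G C d Y
       \<lparr>obj = obj Y, arr = BM,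
        src = (\<lambda>b. src Y (Pr b)), tgt = (\<lambda>b. tgt Y (Pr b)),
        cmp = cmp\<^sub>\<mu>, unit_arr = u, inv_arr = i\<rparr>
       Pr \<rho> star)"
proof -
  interpret I: trivial_base_bundle_groupoid H G C d Y P act1 act0 \<pi> \<pi>\<^sub>0 \<tau>
    by unfold_locales (rule assms(1,2))+
  have eqs: "pr\<^sub>G = I.pr" "s\<^sub>G = I.sG" "B = I.B" "BM = I.BM" "\<rho> = I.\<rho>" "star = I.star" "cmp\<^sub>\<mu> = I.gcmp"
    "\<phi> = (\<lambda>\<xi>. (I.sG \<xi>, I.retr \<xi>))"
    by (simp_all add: fun_eq_iff pr\<^sub>G_def s\<^sub>G_def B_def BM_def \<rho>_def star_def cmp\<^sub>\<mu>_def \<phi>_def I.pr_def I.sG_def I.B_def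
        I.BM_def I.\<rho>_def I.star_def I.gcmp_def I.retr_def)
  have "Pr b = \<pi> b" if "b \<in> I.B" for b
    unfolding Pr_def eqs I.splitting(2)[OF that] ..
  \<comment> \<open>The unit and inverse maps whose existence is claimed are \<open>I.gunit\<close>
    and \<open>I.ginv\<close>.\<close>
  from I.bundle_gerbe_BM[of Pr, OF this] show ?thesis
    unfolding eqs using I.B_embedded I.splitting(1) unfolding I.BM_def by blast
qed

end
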